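(* Let $0<\beta<1$, $1<p<n/\beta$, $1/s=1/p-\beta/n$, $0<\kappa<\min\{p/s,\,p\beta/n\}$ and let $w$ be a weight on $\mathbb R^n$ with $w^s\in A_1$. Let $T$ be a Calderón–Zygmund singular integral operator on $\mathbb R^n$ and suppose that $b\in Lip_\beta(\mathbb R^n)$. Then the commutator $[b,T]f(x)=b(x)Tf(x)-T(bf)(x)$ is bounded from $L^{p,\kappa}(w^p,w^s)$ to $L^{s,\kappa s/p}(w^s)$.
   Context: A weight is a locally integrable function on $\mathbb R^n$ with values in $(0,\infty)$ a.e. Cubes $Q$ have sides parallel to the axes; $|Q|$ is Lebesgue measure and $v(Q)=\int_Q v\,dx$ for a weight $v$. $v\in A_1$ means there is $C$ with $\frac1{|Q|}\int_Q v\,dx\le C\,\mathrm{ess\,inf}_{x\in Q}v(x)$ for all cubes $Q$. $T$ is a Calderón–Zygmund singular integral operator if there is a kernel function $K$ such that: (a) $Tf(x)=\mathrm{P.V.}\int_{\mathbb R^n}K(x-y)f(y)\,dy$ (principal value); (b) $|K(x)|\le C|x|^{-n}$ for $x\ne0$; (c) $|K(x-y)-K(x)|\le C|y|/|x|^{n+1}$ for $|x|\ge2|y|>0$. $b\in Lip_\beta(\mathbb R^n)$ means $b$ is locally integrable and $\|b\|_{Lip_\beta}=\sup_Q\frac1{|Q|^{\beta/n}}\cdot\frac1{|Q|}\int_Q|b(x)-b_Q|\,dx<\infty$, where $b_Q=\frac1{|Q|}\int_Q b(y)\,dy$ and the supremum is over all cubes. Weighted Morrey spaces: for $1\le p<\infty$,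 $0<\kappa<1$ and weights $u,v$, $L^{p,\kappa}(u,v)$ is the set of $f\in L^p_{loc}(u)$ with $\|f\|_{L^{p,\kappa}(u,v)}=\sup_Q\left(\frac1{v(Q)^\kappa}\int_Q|f(x)|^pu(x)\,dx\right)^{1/p}<\infty$ (supremum over all cubes); $L^{p,\kappa}(v)=L^{p,\kappa}(v,v)$. *)

theory Defs
  imports "HOL-Analysis.Analysis" "HOL-Probability.Essential_Supremum"
begin

text \<open>
  Points live in \<^typ>\<open>real^'n\<close>, so the dimension is \<open>CARD('n)\<close>. Weights are real-valued;
  the functions \<open>f\<close>, the symbol \<open>b\<close> and the kernel \<open>K\<close> are complex-valued, which includes
  the real case. Measurability and almost-everywhere statements refer to \<^term>\<open>lebesgue\<close>.
\<close>

definition cubes :: "(real^'n) set set" where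
  "cubes = {cbox a (\<chi> i. a $ i + r) | a r. 0 < r}"

definition average :: "(real^'n) set \<Rightarrow> (real^'n \<Rightarrow> 'b) \<Rightarrow> 'b::{banach, second_countable_topology}"
  where "average Q g = (LINT x:Q|lebesgue. g x) /\<^sub>R measure lebesgue Q"

definition locally_integrable :: "(real^'n \<Rightarrow> 'b::{banach, second_countable_topology}) \<Rightarrow> bool"
  where "locally_integrable g \<longleftrightarrow> (\<forall>S. compact S \<longrightarrow> set_integrable lebesgue S g)"

definition weight :: "(real^'n \<Rightarrow> real) \<Rightarrow> bool" where
  "weight v \<longleftrightarrow> locally_integrable v \<and> (AE x in lebesgue. 0 < v x)"

definition essinf_on :: "(real^'n) set \<Rightarrow> (real^'n \<Rightarrow> real) \<Rightarrow> ereal" where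
  "essinf_on Q v = - esssup (lebesgue_on Q) (\<lambda>x. - ereal (v x))"

definition A1 :: "(real^'n \<Rightarrow> real) \<Rightarrow> bool" where
  "A1 v \<longleftrightarrow> weight v \<and> (\<exists>C::real. \<forall>Q\<in>cubes. ereal (average Q v) \<le> ereal C * essinf_on Q v)"

text \<open>
  The principal value of \<open>\<integral> K(x - y) f(y) dy\<close> exists and equals \<open>l\<close>: every truncated integral
  converges absolutely, and the truncated integrals tend to \<open>l\<close>.
\<close>

definition has_pv ::
  "(real^'n \<Rightarrow> complex) \<Rightarrow> (real^'n \<Rightarrow> complex) \<Rightarrow> real^'n \<Rightarrow> complex \<Rightarrow> bool" where
  "has_pv K f x l \<longleftrightarrow>
     (\<forall>\<epsilon>>0. set_integrable lebesgue {y. \<epsilon> < norm (x - y)} (\<lambda>y. K (x - y) * f y)) \<and>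
     ((\<lambda>\<epsilon>. LINT y:{y. \<epsilon> < norm (x - y)}|lebesgue. K (x - y) * f y) \<longlongrightarrow> l) (at_right 0)"

text \<open>
  \<open>T\<close> is given almost everywhere by the principal value of any function for which this principal
  value makes sense. That it does make sense almost everywhere is required for integrable
  functions only; on functions without a principal value \<open>T\<close> is unconstrained. The kernel need
  not be assumed measurable, since the last condition makes it continuous away from \<open>0\<close>.
\<close>

definition calderon_zygmund_operator ::
  "((real^'n \<Rightarrow> complex) \<Rightarrow> real^'n \<Rightarrow> complex) \<Rightarrow> bool" where
  "calderon_zygmund_operator T \<longleftrightarrow> (\<exists>K :: real^'n \<Rightarrow> complex.
     (\<forall>f. integrable lebesgue f \<longrightarrow> (AE x in lebesgue. \<exists>l. has_pv K f x l)) \<and>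
     (\<forall>f. AE x in lebesgue. \<forall>l. has_pv K f x l \<longrightarrow> T f x = l) \<and>
     (\<exists>C. \<forall>x. x \<noteq> 0 \<longrightarrow> norm (K x) \<le> C / norm x ^ CARD('n)) \<and>
     (\<exists>C. \<forall>x y. 2 * norm y \<le> norm x \<and> 0 < norm y \<longrightarrow>
            norm (K (x - y) - K x) \<le> C * norm y / norm x ^ (CARD('n) + 1)))"

definition commutator ::
  "(real^'n \<Rightarrow> complex) \<Rightarrow> ((real^'n \<Rightarrow> complex) \<Rightarrow> real^'n \<Rightarrow> complex) \<Rightarrow>
   (real^'n \<Rightarrow> complex) \<Rightarrow> real^'n \<Rightarrow> complex" where
  "commutator b T f x = b x * T f x - T (\<lambda>y. b y * f y) x"

definition Lip_norm :: "real \<Rightarrow> (real^'n \<Rightarrow> complex) \<Rightarrow> ennreal" where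
  "Lip_norm \<beta> b = (SUP Q\<in>cubes.
     ennreal (1 / measure lebesgue Q powr (\<beta> / real CARD('n)) *
              average Q (\<lambda>x. norm (b x - average Q b))))"

definition Lip :: "real \<Rightarrow> (real^'n \<Rightarrow> complex) set" where
  "Lip \<beta> = {b. locally_integrable b \<and> Lip_norm \<beta> b < \<infinity>}"

definition Lp_loc :: "real \<Rightarrow> (real^'n \<Rightarrow> real) \<Rightarrow> (real^'n \<Rightarrow> complex) set" where
  "Lp_loc p u = {f \<in> borel_measurable lebesgue. locally_integrable (\<lambda>x. norm (f x) powr p * u x)}"

text \<open>
  The Bochner integrals in \<open>morrey_norm\<close> are meaningful only for \<open>f \<in> Lp_loc p u\<close>, which is why
  membership in \<open>morrey\<close> asks for this separately. The spaces are considered for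
  \<open>1 \<le> p < \<infinity>\<close>, \<open>0 < \<kappa> < 1\<close> and weights \<open>u\<close>, \<open>v\<close>.
\<close>

definition morrey_norm ::
  "real \<Rightarrow> real \<Rightarrow> (real^'n \<Rightarrow> real) \<Rightarrow> (real^'n \<Rightarrow> real) \<Rightarrow> (real^'n \<Rightarrow> complex) \<Rightarrow> ennreal" where
  "morrey_norm p \<kappa> u v f = (SUP Q\<in>cubes.
     ennreal ((1 / (LINT x:Q|lebesgue. v x) powr \<kappa> *
               (LINT x:Q|lebesgue. norm (f x) powr p * u x)) powr (1 / p)))"

definition morrey ::
  "real \<Rightarrow> real \<Rightarrow> (real^'n \<Rightarrow> real) \<Rightarrow> (real^'n \<Rightarrow> real) \<Rightarrow> (real^'n \<Rightarrow> complex) set" where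
  "morrey p \<kappa> u v = {f \<in> Lp_loc p u. morrey_norm p \<kappa> u v f < \<infinity>}"

definition bounded_from_to ::
  "((real^'n \<Rightarrow> complex) \<Rightarrow> real^'n \<Rightarrow> complex) \<Rightarrow>
   (real^'n \<Rightarrow> complex) set \<Rightarrow> ((real^'n \<Rightarrow> complex) \<Rightarrow> ennreal) \<Rightarrow>
   (real^'n \<Rightarrow> complex) set \<Rightarrow> ((real^'n \<Rightarrow> complex) \<Rightarrow> ennreal) \<Rightarrow> bool" where
  "bounded_from_to S X nX Y nY \<longleftrightarrow>
     (\<exists>C::real. 0 \<le> C \<and> (\<forall>f\<in>X. S f \<in> Y \<and> nY (S f) \<le> ennreal C * nX f))"

end

theory Submission
  imports Defs
begin

text \<open>Put \<open>v = w\<^sup>s\<close>, \<open>n = CARD('n)\<close> and \<open>\<alpha> = \<beta> / n\<close>, and write \<open>Q(x,r)\<close> for the cube with centre \<open>x\<close> and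
half side \<open>r\<close>.

\<^bold>\<open>From the commutator to a fractional integral.\<close> A function in \<open>Lip \<beta>\<close> agrees almost everywhere with a
Hoelder continuous one of exponent \<open>\<beta>\<close> (Campanato and Meyers, \<open>Lip_Holder_representative\<close>). Functions
\<open>f\<close> of the Morrey space, and their products with \<open>b\<close>, are locally integrable and decay enough at
infinity for their truncated integrals to converge absolutely, so both principal values exist almost
everywhere, and
\<open>[b,T]f(x) = lim \<integral> (b(x) - b(y)) K(x - y) f(y) dy\<close>. The size of \<open>K\<close> then gives
\<open>|[b,T]f(x)| \<le> C \<integral> |x - y|^(\<beta> - n) |f(y)| dy\<close> (\<open>commutator_pointwise\<close>).

\<^bold>\<open>The fractional integral.\<close> Let \<open>F = |f|^p w^p\<close>, so that \<open>\<integral>\<^sub>Q F \<le> N^p v(Q)^\<kappa>\<close> on all cubes, and let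
\<open>D(x,y) = |x - y|^n v(y)\<close>. Since \<open>1/s = 1/p - \<alpha>\<close>, the integrand factors exactly as
\<open>D(x,y)^-(1-\<alpha>) F(y)^(1/p) v(y)^(1-1/p)\<close>. The condition \<open>A\<^sub>1\<close> says that \<open>D(x,y)\<close> is at least a multiple
of the \<open>v\<close>-measure of the cube about \<open>x\<close> that just reaches \<open>y\<close>, and also of the one about \<open>y\<close> that
just reaches \<open>x\<close>; it also makes these measures grow geometrically when the cube is doubled (reverse
doubling). Hence a negative power of \<open>D\<close> can be integrated against \<open>F\<close> or \<open>v\<close> by summing a geometric
series over dyadic cubes (\<open>radial_integral_near\<close>, \<open>radial_integral_far\<close>): near the centre if the power
is smaller than the growth exponent (\<open>\<kappa>\<close> for \<open>F\<close>, \<open>1\<close> for \<open>v\<close>), away from it if it is larger.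

Away from the cube under consideration, Hoelder's inequality with the factors \<open>F D^-\<tau>\<close> and \<open>v D^-\<tau>'\<close>
suffices, because \<open>\<kappa> < p/s\<close> leaves room to choose \<open>\<tau> > \<kappa>\<close> and \<open>\<tau>' > 1\<close> (\<open>riesz_far\<close>). Near \<open>x\<close>, Hoelder's
inequality with exponents \<open>1/s\<close>, \<open>\<alpha>\<close>, \<open>1 - 1/p\<close> is applied to \<open>F D^-\<tau>\<^sub>1\<close>, \<open>F D^-\<tau>\<^sub>2\<close>, \<open>v D^-\<tau>\<^sub>1\<close> (\<open>riesz_near\<close>).
For \<open>\<kappa> = 0\<close> the exponents would be the critical ones \<open>\<tau>\<^sub>1 = 1\<close>, \<open>\<tau>\<^sub>2 = 0\<close> and the integrals would diverge,
which is why the unimproved inequality of Hardy, Littlewood and Sobolev needs maximal functions or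
interpolation; the Morrey condition with \<open>\<kappa> > 0\<close> allows \<open>\<tau>\<^sub>2\<close> to be slightly positive and \<open>\<tau>\<^sub>1\<close> slightly
smaller than \<open>1\<close>, so that all three integrals converge. The integrals of the last two factors are
bounded uniformly in \<open>x\<close>; that of the first one is integrated in \<open>x\<close> by Tonelli's theorem.\<close>

section \<open>Hoelder's inequality\<close>

text \<open>Young's inequality, applied pointwise to \<open>f / A\<close> and \<open>g / B\<close>. If \<open>A\<close> or \<open>B\<close> vanishes, so does one of
the functions almost everywhere.\<close>
lemma nn_integral_Holder:
  fixes f g :: "'a \<Rightarrow> real"
  assumes [measurable]: "f \<in> borel_measurable M" "g \<in> borel_measurable M"
    and nonneg: "\<And>x. 0 \<le> f x" "\<And>x. 0 \<le> g x"
    and \<theta>: "0 < \<theta>" "\<theta> < 1"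
    and A: "(\<integral>\<^sup>+x. f x \<partial>M) \<le> ennreal A" "0 \<le> A"
    and B: "(\<integral>\<^sup>+x. g x \<partial>M) \<le> ennreal B" "0 \<le> B"
  shows "(\<integral>\<^sup>+x. ennreal (f x powr \<theta> * g x powr (1 - \<theta>)) \<partial>M) \<le> ennreal (A powr \<theta> * B powr (1 - \<theta>))"
proof (cases "A = 0 \<or> B = 0")
  case True
  then have "AE x in M. f x = 0 \<or> g x = 0"
  proof
    assume "A = 0"
    then have "(\<integral>\<^sup>+x. f x \<partial>M) = 0" using A by simp
    then have "AE x in M. ennreal (f x) = 0" by (subst (asm) nn_integral_0_iff_AE) auto
    then show ?thesis by eventually_elim (use nonneg in \<open>auto simp: ennreal_eq_0_iff intro: antisym\<close>)
  next
    assume "B = 0"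
    then have "(\<integral>\<^sup>+x. g x \<partial>M) = 0" using B by simp
    then have "AE x in M. ennreal (g x) = 0" by (subst (asm) nn_integral_0_iff_AE) auto
    then show ?thesis by eventually_elim (use nonneg in \<open>auto simp: ennreal_eq_0_iff intro: antisym\<close>)
  qed
  then have "(\<integral>\<^sup>+x. ennreal (f x powr \<theta> * g x powr (1 - \<theta>)) \<partial>M) = (\<integral>\<^sup>+x. 0 \<partial>M)"
    by (intro nn_integral_cong_AE) (auto elim!: eventually_mono)
  then show ?thesis by simp
next
  case False
  then have pos: "A > 0" "B > 0" using A B by auto
  define K where "K = A powr \<theta> * B powr (1 - \<theta>)"
  have K: "K \<ge> 0" by (simp add: K_def)
  have pt: "f x powr \<theta> * g x powr (1 - \<theta>) \<le> K * (\<theta> / A) * f x + K * ((1-\<theta>) / B) * g x" for x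
  proof -
    have "(f x / A) powr \<theta> * (g x / B) powr (1 - \<theta>) \<le> \<theta> * (f x / A) + (1 - \<theta>) * (g x / B)"
    proof (cases "f x = 0 \<or> g x = 0")
      case True
      then show ?thesis using nonneg[of x] \<theta> pos by auto
    next
      case False
      then show ?thesis
        using Youngs_inequality_0[of \<theta> "1-\<theta>" "f x / A" "g x / B"] nonneg[of x] \<theta> pos by simp
    qed
    then have "K * ((f x / A) powr \<theta> * (g x / B) powr (1 - \<theta>)) \<le> K * (\<theta> * (f x / A) + (1 - \<theta>) * (g x / B))"
      using K by (rule mult_left_mono)
    also have "K * ((f x / A) powr \<theta> * (g x / B) powr (1 - \<theta>)) = f x powr \<theta> * g x powr (1 - \<theta>)"
      using pos nonneg[of x] by (simp add: K_def powr_divide)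
    finally show ?thesis by (simp add: field_simps)
  qed
  have "(\<integral>\<^sup>+x. ennreal (f x powr \<theta> * g x powr (1 - \<theta>)) \<partial>M) \<le>
      (\<integral>\<^sup>+x. ennreal (K * (\<theta> / A)) * f x + ennreal (K * ((1-\<theta>) / B)) * g x \<partial>M)"
  proof (intro nn_integral_mono)
    fix x
    have "ennreal (f x powr \<theta> * g x powr (1 - \<theta>)) \<le> ennreal (K * (\<theta> / A) * f x + K * ((1-\<theta>) / B) * g x)"
      using pt by (rule ennreal_leI)
    also have "\<dots> = ennreal (K * (\<theta> / A)) * f x + ennreal (K * ((1-\<theta>) / B)) * g x"
      using K pos \<theta> nonneg[of x] by (simp add: ennreal_plus ennreal_mult[symmetric])
    finally show "ennreal (f x powr \<theta> * g x powr (1 - \<theta>)) \<le> \<dots>" .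
  qed
  also have "\<dots> = ennreal (K * (\<theta> / A)) * (\<integral>\<^sup>+x. f x \<partial>M) + ennreal (K * ((1-\<theta>) / B)) * (\<integral>\<^sup>+x. g x \<partial>M)"
    by (subst nn_integral_add) (auto simp: nn_integral_cmult)
  also have "\<dots> \<le> ennreal (K * (\<theta> / A)) * ennreal A + ennreal (K * ((1-\<theta>) / B)) * ennreal B"
    by (intro add_mono mult_left_mono A B) auto
  also have "\<dots> = ennreal (K * (\<theta> / A) * A + K * ((1-\<theta>) / B) * B)"
    using K pos \<theta> by (simp add: ennreal_plus ennreal_mult[symmetric])
  also have "K * (\<theta> / A) * A + K * ((1-\<theta>) / B) * B = K" using pos by (simp add: field_simps)
  finally show ?thesis unfolding K_def .
qed

text \<open>Hoelder's inequality raised to the power \<open>s\<close>, with the integral of \<open>f\<close> kept as it is (and possibly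
infinite): that integral depends on a parameter in which it is integrated later.\<close>
lemma nn_integral_Holder_power:
  fixes f g :: "'a \<Rightarrow> real"
  assumes [measurable]: "f \<in> borel_measurable M" "g \<in> borel_measurable M"
    and nonneg: "\<And>x. 0 \<le> f x" "\<And>x. 0 \<le> g x"
    and s: "1 < s"
    and B: "(\<integral>\<^sup>+x. g x \<partial>M) \<le> ennreal B" "0 \<le> B"
    and c: "0 \<le> c" "ennreal c \<le> (\<integral>\<^sup>+x. ennreal (f x powr (1/s) * g x powr (1 - 1/s)) \<partial>M)"
  shows "ennreal (c powr s) \<le> ennreal (B powr (s - 1)) * (\<integral>\<^sup>+x. f x \<partial>M)"
proof -
  have *: "c \<le> A powr (1/s) * B powr (1 - 1/s)" if "(\<integral>\<^sup>+x. f x \<partial>M) = ennreal A" "0 \<le> A" for A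
  proof -
    have "(\<integral>\<^sup>+x. ennreal (f x powr (1/s) * g x powr (1 - 1/s)) \<partial>M) \<le> ennreal (A powr (1/s) * B powr (1 - 1/s))"
      by (rule nn_integral_Holder) (use assms that in auto)
    then have "ennreal c \<le> ennreal (A powr (1/s) * B powr (1 - 1/s))" using c(2) by (rule order_trans[rotated])
    then show ?thesis by (simp add: ennreal_le_iff)
  qed
  show ?thesis
  proof (cases "(\<integral>\<^sup>+x. f x \<partial>M) = \<infinity>")
    case True
    show ?thesis
    proof (cases "B = 0")
      case True
      then have "(\<integral>\<^sup>+x. g x \<partial>M) = 0" using B by simp
      then have "AE x in M. ennreal (g x) = 0" by (subst (asm) nn_integral_0_iff_AE) auto
      then have "(\<integral>\<^sup>+x. ennreal (f x powr (1/s) * g x powr (1 - 1/s)) \<partial>M) = (\<integral>\<^sup>+x. 0 \<partial>M)"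
        by (intro nn_integral_cong_AE, eventually_elim)
           (simp add: ennreal_eq_0_iff order.antisym[OF _ nonneg(2)])
      then have "c = 0" using c by simp
      then show ?thesis by simp
    next
      case False
      then show ?thesis using True B by (simp add: ennreal_mult_top)
    qed
  next
    case False
    then obtain A where A: "(\<integral>\<^sup>+x. f x \<partial>M) = ennreal A" "0 \<le> A"
      by (cases "\<integral>\<^sup>+x. f x \<partial>M") auto
    have "c powr s \<le> (A powr (1/s) * B powr (1 - 1/s)) powr s"
      using *[OF A] c s by (intro powr_mono2) auto
    also have "\<dots> = B powr (s - 1) * A"
      using A(2) B(2) s by (simp add: powr_mult powr_powr algebra_simps)
    finally show ?thesis
      using A by (simp add: ennreal_mult[symmetric])
  qed
qed

section \<open>Cubes\<close>

text \<open>Cubes are described by centre and half side, the form in which they are dilated below.\<close>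
definition ccube :: "real^'n \<Rightarrow> real \<Rightarrow> (real^'n) set" where
  "ccube x r = {z. \<forall>i. \<bar>z $ i - x $ i\<bar> \<le> r}"

lemma ccube_eq_cbox: "ccube x r = cbox (\<chi> i. x $ i - r) (\<chi> i. x $ i + r)"
  by (auto simp: ccube_def mem_box_cart abs_le_iff) (smt (verit))+

lemma ccube_in_cubes: "0 < r \<Longrightarrow> ccube x r \<in> cubes"
  unfolding cubes_def ccube_eq_cbox
  by (intro CollectI exI[of _ "\<chi> i. x $ i - r"] exI[of _ "2*r"]) (simp add: vec_eq_iff add.commute)

lemma cubesE:
  assumes "Q \<in> cubes"
  obtains x r where "0 < r" "Q = ccube x r"
proof -
  obtain a r where Q: "Q = cbox a (\<chi> i. a $ i + r)" and "0 < r"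
    using assms unfolding cubes_def by auto
  then have "Q = ccube (\<chi> i. a $ i + r/2) (r/2)"
    by (simp add: ccube_eq_cbox add.commute)
  then show thesis using that[of "r/2"] \<open>0 < r\<close> by simp
qed

lemma ccube_measurable [measurable]: "ccube x r \<in> sets borel"
  by (simp add: ccube_eq_cbox)

lemma compact_ccube: "compact (ccube x r)"
  by (simp add: ccube_eq_cbox compact_cbox)

lemma center_in_ccube [simp]: "0 \<le> r \<Longrightarrow> x \<in> ccube x r"
  by (simp add: ccube_def)

lemma ccube_sym: "y \<in> ccube x r \<longleftrightarrow> x \<in> ccube y r"
  by (simp add: ccube_def abs_minus_commute)

lemma ccube_subset: "x \<in> ccube y t \<Longrightarrow> r + t \<le> u \<Longrightarrow> ccube x r \<subseteq> ccube y u"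
  unfolding ccube_def by (auto; smt (verit, ccfv_SIG))

lemma ccube_mono: "r \<le> u \<Longrightarrow> ccube x r \<subseteq> ccube x u"
  unfolding ccube_def by (auto; smt (verit, ccfv_SIG))

lemma in_ccube_norm: "norm (z - x) \<le> r \<Longrightarrow> z \<in> ccube x r"
  unfolding ccube_def using component_le_norm_cart[of "z - x"] order_trans by auto

lemma norm_gt_of_not_in_ccube: "z \<notin> ccube x r \<Longrightarrow> r < norm (x - z)"
  using in_ccube_norm[of z x r] by (force simp: norm_minus_commute)

lemma measure_ccube: "0 \<le> r \<Longrightarrow> measure lborel (ccube (x::real^'n) r) = (2 * r) ^ CARD('n)"
  by (simp add: ccube_eq_cbox content_cbox_cart interval_eq_empty_cart)

lemma emeasure_ccube: "0 \<le> r \<Longrightarrow> emeasure lborel (ccube (x::real^'n) r) = ennreal ((2 * r) ^ CARD('n))"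
proof -
  assume "0 \<le> r"
  have "emeasure lborel (ccube x r) \<noteq> \<infinity>"
    unfolding ccube_eq_cbox using emeasure_lborel_cbox_finite[of "\<chi> i. x $ i - r" "\<chi> i. x $ i + r"] by simp
  then show ?thesis using measure_ccube[OF \<open>0 \<le> r\<close>, of x]
    by (metis emeasure_eq_ennreal_measure infinity_ennreal_def)
qed

lemma ccube_exhaust:
  assumes "0 < r"
  obtains k :: nat where "z \<in> ccube x (r * 2 ^ k)"
proof -
  obtain k :: nat where "norm (z - x) / r < 2 ^ k"
    using real_arch_pow[of 2 "norm (z - x) / r"] by auto
  then have "norm (z - x) \<le> r * 2 ^ k" using assms by (simp add: field_simps)
  then show thesis using that in_ccube_norm by blast
qed

lemma ccube_shrink:
  assumes "0 < r" "z \<noteq> x"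
  obtains k :: nat where "z \<notin> ccube x (r / 2 ^ k)"
proof -
  obtain i where i: "z $ i \<noteq> x $ i" using assms by (auto simp: vec_eq_iff)
  obtain k :: nat where "r / \<bar>z $ i - x $ i\<bar> < 2 ^ k"
    using real_arch_pow[of 2 "r / \<bar>z $ i - x $ i\<bar>"] by auto
  then have "r / 2 ^ k < \<bar>z $ i - x $ i\<bar>" using i assms by (simp add: field_simps)
  then have "z \<notin> ccube x (r / 2 ^ k)" unfolding ccube_def by (auto simp: not_le)
  then show thesis using that by blast
qed

definition mass :: "(real^'n \<Rightarrow> real) \<Rightarrow> real^'n \<Rightarrow> real \<Rightarrow> real" where
  "mass v x r = (LINT z:ccube x r|lborel. v z)"

section \<open>Weights of class \<open>A\<^sub>1\<close> and dyadic sums\<close>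

text \<open>Cover \<open>S\<close> by the sets \<open>E k\<close> in such a way that \<open>D\<close> is at least \<open>W k / B\<close> at some \<open>E k\<close> containing the
point. Then \<open>D powr -\<tau>\<close> is dominated by the sum of the functions \<open>(W k / B) powr -\<tau>\<close> on \<open>E k\<close>, and the
integral of \<open>g\<close> against the latter is of the order \<open>W k powr (\<kappa> - \<tau>)\<close>, which decreases geometrically.\<close>
lemma nn_integral_dyadic_sum:
  fixes g D :: "'a \<Rightarrow> real" and E :: "nat \<Rightarrow> 'a set" and W :: "nat \<Rightarrow> real"
  assumes [measurable]: "g \<in> borel_measurable M" "D \<in> borel_measurable M" "\<And>k. E k \<in> sets M"
    and g: "\<And>z. 0 \<le> g z" and W: "\<And>k. 0 < W k"
    and cover: "AE z in M. z \<in> S \<longrightarrow> (\<exists>k. z \<in> E k \<and> W k \<le> B * D z)"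
    and size: "\<And>k. (\<integral>\<^sup>+z. ennreal (g z) * indicator (E k) z \<partial>M) \<le> ennreal (K * W k powr \<kappa>)"
    and pos: "0 \<le> K" "0 \<le> \<tau>" "0 < B"
    and geom: "\<And>k. W k powr (\<kappa> - \<tau>) \<le> q ^ k * W0" "0 \<le> q" "q < 1"
  shows "(\<integral>\<^sup>+z. ennreal (g z * D z powr (-\<tau>)) * indicator S z \<partial>M) \<le> ennreal (B powr \<tau> / (1 - q) * K * W0)"
proof -
  have W0: "0 \<le> W0" using order_trans[OF powr_ge_zero geom(1)[of 0]] by simp
  define c where "c k = B powr \<tau> * W k powr (-\<tau>)" for k
  have c: "0 \<le> c k" for k by (simp add: c_def)
  have "(\<integral>\<^sup>+z. ennreal (g z * D z powr (-\<tau>)) * indicator S z \<partial>M) \<le>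
        (\<integral>\<^sup>+z. (\<Sum>k. ennreal (c k) * (ennreal (g z) * indicator (E k) z)) \<partial>M)"
  proof (rule nn_integral_mono_AE)
    show "AE z in M. ennreal (g z * D z powr (-\<tau>)) * indicator S z \<le> (\<Sum>k. ennreal (c k) * (ennreal (g z) * indicator (E k) z))"
      using cover
    proof eventually_elim
      case (elim z)
      show ?case
      proof (cases "z \<in> S")
        case True
        then obtain k where k: "z \<in> E k" "W k \<le> B * D z" using elim by auto
        have "D z powr (-\<tau>) \<le> (W k / B) powr (-\<tau>)"
          using k W[of k] pos by (intro powr_mono2') (auto simp: field_simps)
        also have "\<dots> = c k" using W[of k] pos by (simp add: c_def powr_divide powr_minus field_simps)
        finally have "g z * D z powr (-\<tau>) \<le> c k * g z" using mult_right_mono[OF _ g[of z]] by (metis mult.commute)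
        then have "ennreal (g z * D z powr (-\<tau>)) * indicator S z \<le> ennreal (c k) * (ennreal (g z) * indicator (E k) z)"
          using True k c g[of z] by (simp add: ennreal_mult[symmetric] ennreal_leI)
        also have "\<dots> \<le> (\<Sum>k. ennreal (c k) * (ennreal (g z) * indicator (E k) z))"
          using sum_le_suminf[OF summableI, of "{k}" "\<lambda>k. ennreal (c k) * (ennreal (g z) * indicator (E k) z)"] by simp
        finally show ?thesis .
      qed simp
    qed
  qed
  also have "\<dots> = (\<Sum>k. ennreal (c k) * (\<integral>\<^sup>+z. ennreal (g z) * indicator (E k) z \<partial>M))"
    by (subst nn_integral_suminf) (auto simp: nn_integral_cmult)
  also have "\<dots> \<le> (\<Sum>k. ennreal (B powr \<tau> * K * W0 * q ^ k))"
  proof (intro suminf_le summableI)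
    fix k
    have "ennreal (c k) * (\<integral>\<^sup>+z. ennreal (g z) * indicator (E k) z \<partial>M) \<le> ennreal (c k) * ennreal (K * W k powr \<kappa>)"
      by (intro mult_left_mono size) simp
    also have "\<dots> = ennreal (B powr \<tau> * K * W k powr (\<kappa> - \<tau>))"
      using c pos W[of k] by (simp add: ennreal_mult[symmetric] c_def powr_diff powr_minus field_simps)
    also have "\<dots> \<le> ennreal (B powr \<tau> * K * W0 * q ^ k)"
      using mult_left_mono[OF geom(1)[of k], of "B powr \<tau> * K"] pos by (intro ennreal_leI) (simp add: mult_ac)
    finally show "ennreal (c k) * (\<integral>\<^sup>+z. ennreal (g z) * indicator (E k) z \<partial>M) \<le> ennreal (B powr \<tau> * K * W0 * q ^ k)" .
  qed
  also have "\<dots> = ennreal (\<Sum>k. B powr \<tau> * K * W0 * q ^ k)"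
    using geom pos W0 by (intro suminf_ennreal2 summable_mult summable_geometric) auto
  also have "(\<Sum>k. B powr \<tau> * K * W0 * q ^ k) = B powr \<tau> * K * W0 * (1 / (1 - q))"
    using geom by (subst suminf_mult) (auto simp: summable_geometric suminf_geometric)
  finally show ?thesis by (simp add: field_simps)
qed

lemma powr_less_1_of_less_1: "0 < x \<Longrightarrow> x < 1 \<Longrightarrow> 0 < a \<Longrightarrow> x powr a < (1::real)"
  using powr_less_mono2[of a x 1] by simp

text \<open>A Borel representative of an \<open>A\<^sub>1\<close> weight. The exceptional null set in the last condition serves all
cubes through \<open>y\<close> at once. This matters when \<open>y\<close> is the centre of the cubes and then becomes a variable
of integration.\<close>
locale A1_weight =
  fixes v :: "real^'n \<Rightarrow> real" and A :: real
  assumes weight_measurable [measurable]: "v \<in> borel_measurable borel"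
    and weight_pos: "0 < v x"
    and weight_integrable: "set_integrable lborel (ccube x r) v"
    and A1_pointwise: "AE y in lborel. \<forall>x r. 0 < r \<longrightarrow> y \<in> ccube x r \<longrightarrow>
           mass v x r \<le> A * r ^ CARD('n) * v y"
begin

abbreviation "V \<equiv> mass v"

lemma nn_integral_weight: "(\<integral>\<^sup>+z. ennreal (v z) * indicator (ccube x r) z \<partial>lborel) = ennreal (V x r)"
proof -
  have "(\<integral>\<^sup>+z. ennreal (v z) * indicator (ccube x r) z \<partial>lborel) = (\<integral>\<^sup>+z. ennreal (indicator (ccube x r) z *\<^sub>R v z) \<partial>lborel)"
    by (intro nn_integral_cong) (auto simp: indicator_def)
  also have "\<dots> = ennreal (V x r)"
    unfolding mass_def set_lebesgue_integral_def
    using weight_integrable[of x r] weight_pos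
    by (intro nn_integral_eq_integral) (auto simp: set_integrable_def less_imp_le)
  finally show ?thesis .
qed

lemma mass_nonneg: "0 \<le> V x r"
  unfolding mass_def set_lebesgue_integral_def
  by (intro integral_nonneg_AE) (auto simp: less_imp_le weight_pos)

lemma integrate_lower_bound:
  assumes [measurable]: "E \<in> sets borel"
    and E: "emeasure lborel E = ennreal e" "0 \<le> e" and m: "(\<integral>\<^sup>+z. ennreal (v z) * indicator E z \<partial>lborel) \<le> ennreal m" "0 \<le> m"
    and c: "0 \<le> c" "0 \<le> K" "AE z in lborel. z \<in> E \<longrightarrow> c \<le> K * v z"
  shows "c * e \<le> K * m"
proof -
  have "ennreal (c * e) = (\<integral>\<^sup>+z. ennreal c * indicator E z \<partial>lborel)"
    using c E by (simp add: nn_integral_cmult_indicator ennreal_mult)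
  also have "\<dots> \<le> (\<integral>\<^sup>+z. ennreal K * (ennreal (v z) * indicator E z) \<partial>lborel)"
  proof (rule nn_integral_mono_AE)
    show "AE z in lborel. ennreal c * indicator E z \<le> ennreal K * (ennreal (v z) * indicator E z)"
      using c(3) by eventually_elim
        (use c weight_pos in \<open>auto simp: indicator_def ennreal_mult[symmetric] less_imp_le intro!: ennreal_leI\<close>)
  qed
  also have "\<dots> = ennreal K * (\<integral>\<^sup>+z. ennreal (v z) * indicator E z \<partial>lborel)"
    by (simp add: nn_integral_cmult)
  also have "\<dots> \<le> ennreal K * ennreal m" using m by (intro mult_left_mono) auto
  also have "\<dots> = ennreal (K * m)" using c m by (simp add: ennreal_mult)
  finally show ?thesis using c m by (simp add: ennreal_le_iff)
qed

lemma A1_on: "0 < r \<Longrightarrow> AE z in lborel. z \<in> ccube x r \<longrightarrow> V x r \<le> A * r ^ CARD('n) * v z"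
  using A1_pointwise by eventually_elim auto

lemma mass_pos:
  assumes "0 < r" shows "0 < V x r"
proof (rule ccontr)
  assume "\<not> 0 < V x r"
  then have "V x r = 0" using mass_nonneg[of x r] by simp
  then have "(\<integral>\<^sup>+z. ennreal (v z) * indicator (ccube x r) z \<partial>lborel) = 0"
    using nn_integral_weight[of x r] by simp
  then have zero: "AE z in lborel. ennreal (v z) * indicator (ccube x r) z = 0"
    by (subst (asm) nn_integral_0_iff_AE) auto
  have "\<not> v z \<le> 0" for z using weight_pos[of z] by simp
  with zero have "AE z in lborel. z \<notin> ccube x r"
    by (auto elim!: eventually_mono simp: indicator_def ennreal_eq_0_iff split: if_splits)
  then have "emeasure lborel (ccube x r) = 0"
    by (subst (asm) AE_iff_measurable[OF _ refl]) (auto simp: )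
  moreover have "0 < (2 * r) ^ CARD('n)" using assms by simp
  ultimately show False using emeasure_ccube[of r x] assms by (metis ennreal_eq_0_iff less_imp_le not_le)
qed

lemma mass_mono: "ccube x r \<subseteq> ccube y t \<Longrightarrow> V x r \<le> V y t"
proof -
  assume "ccube x r \<subseteq> ccube y t"
  then have "ennreal (V x r) \<le> ennreal (V y t)"
    unfolding nn_integral_weight[symmetric]
    by (intro nn_integral_mono) (auto simp: indicator_def)
  then show ?thesis using mass_nonneg by (simp add: ennreal_le_iff)
qed

lemma A_pos: "0 < A"
proof -
  obtain y where y: "\<forall>x r. 0 < r \<longrightarrow> y \<in> ccube x r \<longrightarrow> V x r \<le> A * r ^ CARD('n) * v y"
    using eventually_happens'[OF _ A1_pointwise] by (auto simp: ae_filter_eq_bot_iff)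
  have "0 < V y 1" by (rule mass_pos) simp
  also have "V y 1 \<le> A * v y" using y[rule_format, of 1 y] by simp
  finally show ?thesis using weight_pos[of y] by (simp add: zero_less_mult_iff)
qed

text \<open>Integrate the bound \<open>V y t \<le> A t\<^sup>n v(z)\<close> over the smaller cube.\<close>
lemma mass_doubling:
  assumes "0 < r" "ccube x r \<subseteq> ccube y t"
  shows "V y t \<le> A * (t / r) ^ CARD('n) * V x r"
proof -
  have t: "0 < t"
  proof -
    have "x + (\<chi> i. r) \<in> ccube x r" "x - (\<chi> i. r) \<in> ccube x r"
      using assms(1) by (auto simp: ccube_def)
    then have "x + (\<chi> i. r) \<in> ccube y t" "x - (\<chi> i. r) \<in> ccube y t"
      using assms(2) by auto
    then have "\<bar>x $ undefined + r - y $ undefined\<bar> \<le> t" "\<bar>x $ undefined - r - y $ undefined\<bar> \<le> t"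
      unfolding ccube_def by auto
    then show ?thesis using assms(1) by linarith
  qed
  have "V y t * (2 * r) ^ CARD('n) \<le> (A * t ^ CARD('n)) * V x r"
  proof (rule integrate_lower_bound[OF ccube_measurable emeasure_ccube])
    show "AE z in lborel. z \<in> ccube x r \<longrightarrow> V y t \<le> A * t ^ CARD('n) * v z"
      using A1_on[OF t, of y] by eventually_elim (use assms in auto)
  qed (use assms t A_pos in \<open>auto simp: nn_integral_weight mass_nonneg\<close>)
  moreover have "V y t * r ^ CARD('n) \<le> V y t * (2 * r) ^ CARD('n)"
    using assms mass_nonneg by (intro mult_left_mono power_mono) auto
  ultimately have "V y t * r ^ CARD('n) \<le> (A * t ^ CARD('n)) * V x r" by (rule order_trans[rotated])
  moreover have "A * (t / r) ^ CARD('n) * V x r = (A * t ^ CARD('n)) * V x r / r ^ CARD('n)"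
    by (simp add: power_divide)
  ultimately show ?thesis using assms(1) by (simp only: pos_le_divide_eq zero_less_power)
qed

text \<open>Reverse doubling. The shell between the two cubes fills at least half of the larger cube, and by \<open>A\<^sub>1\<close>
the weight on the shell is at least a multiple of the average over the larger cube; so the shell
carries at least the fraction \<open>1 / A\<close> of its mass.\<close>
lemma mass_halving:
  assumes "0 < r"
  shows "V x (r / 2) \<le> (1 - 1 / A) * V x r"
proof -
  let ?E = "ccube x r - ccube x (r / 2)"
  have sub: "ccube x (r/2) \<subseteq> ccube x r" using assms by (intro ccube_mono) auto
  have ind: "indicator (ccube x r) z = indicator ?E z + (indicator (ccube x (r/2)) z :: ennreal)" for z
    using sub by (auto simp: indicator_def)
  have "emeasure lborel ?E = emeasure lborel (ccube x r) - emeasure lborel (ccube x (r/2))"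
    using assms sub by (intro emeasure_Diff) (auto simp: emeasure_ccube)
  also have "\<dots> = ennreal ((2 * r) ^ CARD('n) - r ^ CARD('n))"
    using assms emeasure_ccube[of r x] emeasure_ccube[of "r/2" x] by (simp add: ennreal_minus)
  finally have e: "emeasure lborel ?E = ennreal ((2 * r) ^ CARD('n) - r ^ CARD('n))" .
  have "ennreal (V x r) = (\<integral>\<^sup>+z. ennreal (v z) * indicator ?E z \<partial>lborel) + ennreal (V x (r/2))"
    unfolding nn_integral_weight[symmetric] ind
    by (subst nn_integral_add[symmetric]) (auto simp: distrib_left)
  then have m: "(\<integral>\<^sup>+z. ennreal (v z) * indicator ?E z \<partial>lborel) = ennreal (V x r - V x (r/2))"
    using mass_nonneg
    by (metis ennreal_add_diff_cancel_right ennreal_minus ennreal_neq_top)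
  have two: "(2::real) ^ CARD('n) \<ge> 2"
    using power_increasing[of 1 "CARD('n)" "2::real"] by (simp add: Suc_leI)
  have "V x r * ((2 * r) ^ CARD('n) - r ^ CARD('n)) \<le> (A * r ^ CARD('n)) * (V x r - V x (r/2))"
  proof (rule integrate_lower_bound[OF _ e _ eq_refl[OF m]])
    show "AE z in lborel. z \<in> ?E \<longrightarrow> V x r \<le> A * r ^ CARD('n) * v z"
      using A1_on[OF assms, of x] by eventually_elim auto
    show "0 \<le> (2 * r) ^ CARD('n) - r ^ CARD('n)"
      using assms by (simp add: power_mono)
  qed (use assms A_pos mass_nonneg mass_mono[OF sub] in auto)
  moreover have "V x r * r ^ CARD('n) \<le> V x r * ((2 * r) ^ CARD('n) - r ^ CARD('n))"
  proof (intro mult_left_mono mass_nonneg)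
    have "2 * r ^ CARD('n) \<le> (2 * r) ^ CARD('n)"
      using two assms by (simp add: power_mult_distrib mult_right_mono)
    then show "r ^ CARD('n) \<le> (2 * r) ^ CARD('n) - r ^ CARD('n)" by simp
  qed
  ultimately have "V x r * r ^ CARD('n) \<le> (A * (V x r - V x (r/2))) * r ^ CARD('n)"
    by (simp add: mult_ac)
  then have "V x r \<le> A * (V x r - V x (r/2))" using assms by simp
  then show ?thesis using A_pos by (simp add: field_simps)
qed

text \<open>The factor by which the mass of a cube shrinks, at least, when the side is halved.\<close>
definition \<delta> where "\<delta> = 1 - 1 / A"

lemma \<delta>: "0 < \<delta>" "\<delta> < 1"
proof -
  have "0 < V 0 (1/2)" by (rule mass_pos) simp
  also have "\<dots> \<le> \<delta> * V 0 1" using mass_halving[of 1 0] by (simp add: \<delta>_def)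
  finally show "0 < \<delta>" using mass_nonneg[of 0 1] by (simp add: zero_less_mult_iff)
  show "\<delta> < 1" using A_pos by (simp add: \<delta>_def)
qed

lemma mass_shrink: "0 < r \<Longrightarrow> V x (r / 2 ^ k) \<le> \<delta> ^ k * V x r"
proof (induction k)
  case (Suc k)
  have "V x (r / 2 ^ Suc k) = V x (r / 2 ^ k / 2)" by (simp add: field_simps)
  also have "\<dots> \<le> \<delta> * V x (r / 2 ^ k)" unfolding \<delta>_def using Suc by (intro mass_halving) auto
  also have "\<dots> \<le> \<delta> * (\<delta> ^ k * V x r)" using Suc \<delta> by (intro mult_left_mono) auto
  finally show ?case by simp
qed simp

text \<open>The cubes about \<open>x\<close> of half side \<open>r / 2\<^sup>k\<close> cover the punctured cube in the sense of
\<open>nn_integral_dyadic_sum\<close>; by reverse doubling the series converges since \<open>\<kappa> - \<tau>\<close> is positive. The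
function \<open>D\<close> stands for a weighted distance to \<open>x\<close>, in one of its two forms.\<close>
lemma radial_integral_near:
  fixes g D :: "real^'n \<Rightarrow> real"
  assumes [measurable]: "g \<in> borel_measurable borel" "D \<in> borel_measurable borel"
    and g: "\<And>z. 0 \<le> g z" and pos: "0 \<le> K" "0 \<le> \<tau>" "\<tau> < \<kappa>" "0 < B" "0 < r"
    and size: "\<And>\<rho>. 0 < \<rho> \<Longrightarrow> (\<integral>\<^sup>+z. ennreal (g z) * indicator (ccube x \<rho>) z \<partial>lborel) \<le> ennreal (K * V x \<rho> powr \<kappa>)"
    and D: "AE z in lborel. \<forall>\<rho>>0. z \<in> ccube x \<rho> - ccube x (\<rho>/2) \<longrightarrow> V x \<rho> \<le> B * D z"
  shows "(\<integral>\<^sup>+z. ennreal (g z * D z powr (-\<tau>)) * indicator (ccube x r) z \<partial>lborel)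
     \<le> ennreal (B powr \<tau> / (1 - \<delta> powr (\<kappa> - \<tau>)) * K * V x r powr (\<kappa> - \<tau>))"
proof (rule nn_integral_dyadic_sum[where E = "\<lambda>k. ccube x (r / 2 ^ k)" and W = "\<lambda>k. V x (r / 2 ^ k)" and \<kappa> = \<kappa>])
  have "AE z in lborel. z \<noteq> x" by (rule AE_lborel_singleton)
  with D show "AE z in lborel. z \<in> ccube x r \<longrightarrow> (\<exists>k. z \<in> ccube x (r / 2 ^ k) \<and> V x (r / 2 ^ k) \<le> B * D z)"
  proof eventually_elim
    case (elim z)
    show ?case
    proof
      assume z: "z \<in> ccube x r"
      \<comment> \<open>The cube with index \<open>m - 1\<close> is the smallest one that contains \<open>z\<close>.\<close>
      define m where "m = (LEAST k. z \<notin> ccube x (r / 2 ^ k))"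
      have m: "z \<notin> ccube x (r / 2 ^ m)"
        unfolding m_def by (rule LeastI_ex) (use ccube_shrink[OF pos(5) elim(2)] in blast)
      with z obtain k where k: "m = Suc k" by (cases m) auto
      have "z \<in> ccube x (r / 2 ^ k)"
        using not_less_Least[of k "\<lambda>k. z \<notin> ccube x (r / 2 ^ k)"] k unfolding m_def by auto
      moreover have "z \<notin> ccube x (r / 2 ^ k / 2)" using m k by (simp add: field_simps)
      ultimately show "\<exists>k. z \<in> ccube x (r / 2 ^ k) \<and> V x (r / 2 ^ k) \<le> B * D z"
        using elim(1)[rule_format, of "r / 2 ^ k"] pos by auto
    qed
  qed
  fix k
  show "0 < V x (r / 2 ^ k)" using pos by (intro mass_pos) auto
  show "(\<integral>\<^sup>+z. ennreal (g z) * indicator (ccube x (r / 2 ^ k)) z \<partial>lborel) \<le> ennreal (K * V x (r / 2 ^ k) powr \<kappa>)"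
    using pos by (intro size) auto
  have "V x (r / 2 ^ k) powr (\<kappa> - \<tau>) \<le> (\<delta> ^ k * V x r) powr (\<kappa> - \<tau>)"
    using pos by (intro powr_mono2 mass_shrink mass_nonneg) auto
  also have "\<dots> = (\<delta> powr (\<kappa> - \<tau>)) ^ k * V x r powr (\<kappa> - \<tau>)"
    using \<delta> mass_nonneg by (simp add: powr_mult powr_powr powr_realpow[symmetric] mult.commute)
  finally show "V x (r / 2 ^ k) powr (\<kappa> - \<tau>) \<le> (\<delta> powr (\<kappa> - \<tau>)) ^ k * V x r powr (\<kappa> - \<tau>)" .
  show "\<delta> powr (\<kappa> - \<tau>) < 1" using \<delta> pos by (intro powr_less_1_of_less_1) auto
qed (use g pos in auto)

text \<open>The same with the cubes of half side \<open>r * 2\<^sup>k\<close>; now the mass grows and \<open>\<kappa> - \<tau>\<close> is negative.\<close>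
lemma radial_integral_far:
  fixes g D :: "real^'n \<Rightarrow> real"
  assumes [measurable]: "g \<in> borel_measurable borel" "D \<in> borel_measurable borel"
    and g: "\<And>z. 0 \<le> g z" and pos: "0 \<le> K" "0 \<le> \<tau>" "\<kappa> < \<tau>" "0 < B" "0 < r"
    and size: "\<And>\<rho>. 0 < \<rho> \<Longrightarrow> (\<integral>\<^sup>+z. ennreal (g z) * indicator (ccube x \<rho>) z \<partial>lborel) \<le> ennreal (K * V x \<rho> powr \<kappa>)"
    and D: "AE z in lborel. \<forall>\<rho>>0. z \<in> ccube x \<rho> - ccube x (\<rho>/2) \<longrightarrow> V x \<rho> \<le> B * D z"
  shows "(\<integral>\<^sup>+z. ennreal (g z * D z powr (-\<tau>)) * indicator (- ccube x r) z \<partial>lborel)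
     \<le> ennreal (B powr \<tau> / (1 - \<delta> powr (\<tau> - \<kappa>)) * K * V x r powr (\<kappa> - \<tau>))"
proof (rule nn_integral_dyadic_sum[where E = "\<lambda>k. ccube x (r * 2 ^ Suc k)" and W = "\<lambda>k. V x (r * 2 ^ Suc k)" and \<kappa> = \<kappa>])
  from D show "AE z in lborel. z \<in> - ccube x r \<longrightarrow> (\<exists>k. z \<in> ccube x (r * 2 ^ Suc k) \<and> V x (r * 2 ^ Suc k) \<le> B * D z)"
  proof eventually_elim
    case (elim z)
    show ?case
    proof
      assume z: "z \<in> - ccube x r"
      define m where "m = (LEAST k. z \<in> ccube x (r * 2 ^ k))"
      have m: "z \<in> ccube x (r * 2 ^ m)"
        unfolding m_def by (rule LeastI_ex) (use ccube_exhaust[OF pos(5)] in blast)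
      with z obtain k where k: "m = Suc k" by (cases m) auto
      have "z \<notin> ccube x (r * 2 ^ k)"
        using not_less_Least[of k "\<lambda>k. z \<in> ccube x (r * 2 ^ k)"] k unfolding m_def by auto
      moreover have "z \<in> ccube x (r * 2 ^ Suc k)" using m k by simp
      ultimately show "\<exists>k. z \<in> ccube x (r * 2 ^ Suc k) \<and> V x (r * 2 ^ Suc k) \<le> B * D z"
        using elim[rule_format, of "r * 2 ^ Suc k"] pos by auto
    qed
  qed
  fix k
  show "0 < V x (r * 2 ^ Suc k)" using pos by (intro mass_pos) auto
  show "(\<integral>\<^sup>+z. ennreal (g z) * indicator (ccube x (r * 2 ^ Suc k)) z \<partial>lborel) \<le> ennreal (K * V x (r * 2 ^ Suc k) powr \<kappa>)"
    using pos by (intro size) auto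
  have "V x r \<le> \<delta> ^ k * V x (r * 2 ^ k)"
    using mass_shrink[of "r * 2 ^ k" x k] pos by simp
  also have "\<dots> \<le> \<delta> ^ k * V x (r * 2 ^ Suc k)"
    using \<delta> pos by (intro mult_left_mono mass_mono ccube_mono) auto
  finally have "(\<delta> ^ k * V x (r * 2 ^ Suc k)) powr (\<kappa> - \<tau>) \<le> V x r powr (\<kappa> - \<tau>)"
    using pos mass_pos[of r x] by (intro powr_mono2') auto
  then have "(\<delta> ^ k) powr (\<kappa> - \<tau>) * V x (r * 2 ^ Suc k) powr (\<kappa> - \<tau>) \<le> V x r powr (\<kappa> - \<tau>)"
    using \<delta> mass_nonneg by (simp add: powr_mult)
  moreover have "(\<delta> ^ k) powr (\<kappa> - \<tau>) = inverse ((\<delta> powr (\<tau> - \<kappa>)) ^ k)"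
  proof -
    have "(\<delta> ^ k) powr (\<kappa> - \<tau>) = \<delta> powr (- (real k * (\<tau> - \<kappa>)))"
      using \<delta> by (simp add: powr_realpow[symmetric] powr_powr algebra_simps)
    also have "\<dots> = inverse ((\<delta> powr (\<tau> - \<kappa>)) ^ k)"
      using \<delta> by (simp only: powr_minus) (simp add: powr_realpow[symmetric] powr_powr mult.commute)
    finally show ?thesis .
  qed
  ultimately show "V x (r * 2 ^ Suc k) powr (\<kappa> - \<tau>) \<le> (\<delta> powr (\<tau> - \<kappa>)) ^ k * V x r powr (\<kappa> - \<tau>)"
    using \<delta> by (simp add: field_simps)
  show "\<delta> powr (\<tau> - \<kappa>) < 1" using \<delta> pos by (intro powr_less_1_of_less_1) auto
qed (use g pos in auto)

end

section \<open>Fractional integrals on Morrey spaces\<close>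

lemma indicator_ccube_measurable [measurable]:
  "(\<lambda>p. indicator (ccube (fst p :: real^'n) r) (snd p) :: ennreal) \<in> borel_measurable (lborel \<Otimes>\<^sub>M lborel)"
proof -
  have "closed {p :: (real^'n) \<times> (real^'n). \<forall>i. \<bar>snd p $ i - fst p $ i\<bar> \<le> r}"
    by (intro closed_Collect_all closed_Collect_le continuous_intros)
  then have [measurable]: "{p :: (real^'n) \<times> (real^'n). \<forall>i. \<bar>snd p $ i - fst p $ i\<bar> \<le> r} \<in> sets borel"
    by (rule borel_closed)
  have "(\<lambda>p. indicator (ccube (fst p) r) (snd p) :: ennreal) =
      indicator {p :: (real^'n) \<times> (real^'n). \<forall>i. \<bar>snd p $ i - fst p $ i\<bar> \<le> r}"
    by (auto simp: fun_eq_iff indicator_def ccube_def)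
  moreover have "(indicator {p :: (real^'n) \<times> (real^'n). \<forall>i. \<bar>snd p $ i - fst p $ i\<bar> \<le> r} :: _ \<Rightarrow> ennreal) \<in> borel_measurable borel"
    by measurable
  ultimately have "(\<lambda>p. indicator (ccube (fst p :: real^'n) r) (snd p) :: ennreal) \<in> borel_measurable borel"
    by (simp only:)
  then show ?thesis unfolding lborel_prod by simp
qed

context A1_weight
begin

text \<open>If \<open>z\<close> is in \<open>Q(x,\<rho>)\<close> but not in \<open>Q(x,\<rho>/2)\<close>, then \<open>|x - z| > \<rho>/2\<close>, and \<open>A\<^sub>1\<close> applies to \<open>Q(x,\<rho>)\<close> at its
point \<open>z\<close>.\<close>
lemma distance_dominates:
  "AE z in lborel. \<forall>\<rho>>0. z \<in> ccube x \<rho> - ccube x (\<rho>/2) \<longrightarrow>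
     V x \<rho> \<le> (A * 2 ^ CARD('n)) * (norm (x - z) ^ CARD('n) * v z)"
  using A1_pointwise
proof eventually_elim
  case (elim z)
  show ?case
  proof (intro allI impI)
    fix \<rho> :: real assume \<rho>: "0 < \<rho>" "z \<in> ccube x \<rho> - ccube x (\<rho>/2)"
    then have "\<rho> < 2 * norm (x - z)" using norm_gt_of_not_in_ccube[of z x "\<rho>/2"] by auto
    then have "\<rho> ^ CARD('n) \<le> 2 ^ CARD('n) * norm (x - z) ^ CARD('n)"
      using \<rho> by (subst power_mult_distrib[symmetric]) (intro power_mono, auto)
    then have "A * \<rho> ^ CARD('n) * v z \<le> A * (2 ^ CARD('n) * norm (x - z) ^ CARD('n)) * v z"
      using A_pos weight_pos[of z] by (intro mult_right_mono mult_left_mono) auto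
    moreover have "V x \<rho> \<le> A * \<rho> ^ CARD('n) * v z" using elim \<rho> by auto
    ultimately show "V x \<rho> \<le> (A * 2 ^ CARD('n)) * (norm (x - z) ^ CARD('n) * v z)" by (simp add: mult_ac)
  qed
qed

text \<open>The same with \<open>A\<^sub>1\<close> applied at the centre of the cube. Both lemmas have the weight at the
same point of the pair, so one function \<open>|x - y|\<^sup>n v(y)\<close> can be used as a distance from \<open>x\<close> and from \<open>y\<close>.\<close>
lemma distance_dominates_center:
  "AE y in lborel. \<forall>z. \<forall>\<rho>>0. z \<in> ccube y \<rho> - ccube y (\<rho>/2) \<longrightarrow>
     V y \<rho> \<le> (A * 2 ^ CARD('n)) * (norm (z - y) ^ CARD('n) * v y)"
  using A1_pointwise
proof eventually_elim
  case (elim y)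
  show ?case
  proof (intro allI impI)
    fix z and \<rho> :: real assume \<rho>: "0 < \<rho>" "z \<in> ccube y \<rho> - ccube y (\<rho>/2)"
    then have "\<rho> < 2 * norm (z - y)" using norm_gt_of_not_in_ccube[of z y "\<rho>/2"] by (auto simp: norm_minus_commute)
    then have "\<rho> ^ CARD('n) \<le> 2 ^ CARD('n) * norm (z - y) ^ CARD('n)"
      using \<rho> by (subst power_mult_distrib[symmetric]) (intro power_mono, auto)
    then have "A * \<rho> ^ CARD('n) * v y \<le> A * (2 ^ CARD('n) * norm (z - y) ^ CARD('n)) * v y"
      using A_pos weight_pos[of y] by (intro mult_right_mono mult_left_mono) auto
    moreover have "V y \<rho> \<le> A * \<rho> ^ CARD('n) * v y" using elim[rule_format, of \<rho> y] \<rho> by auto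
    ultimately show "V y \<rho> \<le> (A * 2 ^ CARD('n)) * (norm (z - y) ^ CARD('n) * v y)" by (simp add: mult_ac)
  qed
qed

end

locale morrey_exponents = A1_weight v A for v :: "real^'n \<Rightarrow> real" and A :: real +
  fixes \<beta> p s \<kappa> :: real
  assumes \<beta>: "0 < \<beta>" and p: "1 < p" "p < real CARD('n) / \<beta>"
    and s: "1 / s = 1 / p - \<beta> / real CARD('n)" and \<kappa>: "0 < \<kappa>" "\<kappa> < p / s"
begin

definition \<alpha> where "\<alpha> = \<beta> / real CARD('n)"

lemma n_pos: "0 < real CARD('n)" by simp

lemma \<alpha>: "0 < \<alpha>" "\<alpha> < 1 / p" "\<alpha> < 1" and one_div_s: "1 / s = 1 / p - \<alpha>"
proof -
  show 1: "0 < \<alpha>" using \<beta> n_pos by (simp add: \<alpha>_def)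
  show 2: "\<alpha> < 1 / p" using p \<beta> n_pos by (simp add: \<alpha>_def field_simps)
  have "1 / p < 1" using p by simp
  then show "\<alpha> < 1" using 2 by linarith
  show "1 / s = 1 / p - \<alpha>" using s by (simp add: \<alpha>_def)
qed

lemma s_gt: "p < s" "1 < s"
proof -
  have "0 < 1 / s" using \<alpha> one_div_s by linarith
  then have s0: "0 < s" by simp
  have "1 / s < 1 / p" using \<alpha> one_div_s by linarith
  then show "p < s" using s0 p by (simp add: field_simps)
  then show "1 < s" using p by simp
qed

lemma \<kappa>_less_1: "\<kappa> < 1"
  using \<kappa> s_gt p by (smt (verit) divide_less_eq_1_pos)

lemma \<alpha>_s: "\<alpha> * s + 1 = s / p"
proof -
  have "\<alpha> = 1 / p - 1 / s" using one_div_s by simp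
  then show ?thesis using s_gt p by (simp add: field_simps)
qed

text \<open>This is \<open>|f|\<^sup>p w\<^sup>p\<close>, written in terms of \<open>v = w\<^sup>s\<close>.\<close>
definition morrey_density :: "(real^'n \<Rightarrow> real) \<Rightarrow> real^'n \<Rightarrow> real" where
  "morrey_density f y = f y powr p * v y powr (p / s)"

definition weighted_dist :: "real^'n \<Rightarrow> real^'n \<Rightarrow> real" where
  "weighted_dist x y = norm (x - y) ^ CARD('n) * v y"

definition morrey_bound :: "(real^'n \<Rightarrow> real) \<Rightarrow> real \<Rightarrow> bool" where
  "morrey_bound f M \<longleftrightarrow> f \<in> borel_measurable borel \<and> (\<forall>y. 0 \<le> f y) \<and> 0 \<le> M \<and>
     (\<forall>x \<rho>. 0 < \<rho> \<longrightarrow>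
        (\<integral>\<^sup>+y. ennreal (morrey_density f y) * indicator (ccube x \<rho>) y \<partial>lborel) \<le> ennreal (M * V x \<rho> powr \<kappa>))"

lemma weighted_dist_measurable [measurable]: "weighted_dist x \<in> borel_measurable borel"
  unfolding weighted_dist_def[abs_def] by measurable

lemma weighted_dist_nonneg: "0 \<le> weighted_dist x y"
  using weight_pos[of y] by (simp add: weighted_dist_def less_imp_le)

lemma morrey_density_measurable [measurable]:
  assumes [measurable]: "f \<in> borel_measurable borel"
  shows "morrey_density f \<in> borel_measurable borel"
  unfolding morrey_density_def[abs_def] by measurable

lemma morrey_density_nonneg: "0 \<le> morrey_density f y"
  by (simp add: morrey_density_def)

text \<open>The powers of \<open>|x - y|\<close> agree because \<open>n (1 - \<alpha>) = n - \<beta>\<close>, those of \<open>v\<close> because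
\<open>1 / s = 1 / p - \<alpha>\<close>. For \<open>x = y\<close> both sides vanish, as \<open>0 powr a = 0\<close>.\<close>
lemma riesz_kernel_factor:
  assumes "0 \<le> f y"
  shows "norm (x - y) powr (\<beta> - real CARD('n)) * f y =
     weighted_dist x y powr (-(1 - \<alpha>)) * morrey_density f y powr (1 / p) * v y powr (1 - 1 / p)"
proof (cases "x = y")
  case True
  then show ?thesis by (simp add: weighted_dist_def)
next
  case False
  have "weighted_dist x y powr (-(1 - \<alpha>)) = norm (x - y) powr (real CARD('n) * (\<alpha> - 1)) * v y powr (\<alpha> - 1)"
    using False weight_pos[of y] by (simp add: weighted_dist_def powr_mult powr_powr powr_realpow[symmetric])
  also have "real CARD('n) * (\<alpha> - 1) = \<beta> - real CARD('n)"
    by (simp add: \<alpha>_def field_simps)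
  finally have 1: "weighted_dist x y powr (-(1 - \<alpha>)) = norm (x - y) powr (\<beta> - real CARD('n)) * v y powr (\<alpha> - 1)" .
  have 2: "morrey_density f y powr (1 / p) = f y * v y powr (1 / s)"
    using assms p weight_pos[of y] by (simp add: morrey_density_def powr_mult powr_powr)
  have "v y powr (\<alpha> - 1) * v y powr (1 / s) * v y powr (1 - 1 / p) = v y powr (\<alpha> - 1 + 1 / s + (1 - 1 / p))"
    by (simp only: powr_add)
  also have "\<alpha> - 1 + 1 / s + (1 - 1 / p) = 0" using one_div_s by simp
  finally have 3: "v y powr (\<alpha> - 1) * v y powr (1 / s) * v y powr (1 - 1 / p) = 1"
    using weight_pos[of y] by simp
  have "weighted_dist x y powr (-(1 - \<alpha>)) * morrey_density f y powr (1 / p) * v y powr (1 - 1 / p)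
     = norm (x - y) powr (\<beta> - real CARD('n)) * f y * (v y powr (\<alpha> - 1) * v y powr (1 / s) * v y powr (1 - 1 / p))"
    unfolding 1 2 by (simp only: mult_ac)
  then show ?thesis unfolding 3 by simp
qed

lemma radial_scale: "0 < A * 2 ^ CARD('n)"
  using A_pos by simp

lemma weight_size: "(\<integral>\<^sup>+z. ennreal (v z) * indicator (ccube x \<rho>) z \<partial>lborel) \<le> ennreal (1 * V x \<rho> powr 1)"
  by (simp add: nn_integral_weight mass_nonneg)

text \<open>Hoelder's inequality for \<open>(F D^-(\<kappa>+\<eta>))^(1/p) (v D^-(1+\<eta>))^(1-1/p)\<close>. The exponents of \<open>D\<close> must add up to
\<open>1 - \<alpha>\<close>, which determines \<open>\<eta> = 1/s - \<kappa>/p\<close>, and this is positive exactly when \<open>\<kappa> < p/s\<close>.\<close>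
lemma riesz_far:
  obtains C where "0 \<le> C" "\<And>f M x r. morrey_bound f M \<Longrightarrow> 0 < r \<Longrightarrow>
     (\<integral>\<^sup>+y. ennreal (norm (x - y) powr (\<beta> - real CARD('n)) * f y) * indicator (- ccube x r) y \<partial>lborel)
       \<le> ennreal (C * M powr (1 / p) * V x r powr (\<kappa> / p - 1 / s))"
proof -
  define \<eta> where "\<eta> = 1 / s - \<kappa> / p"
  have \<eta>: "0 < \<eta>"
    using \<kappa> s_gt p by (simp add: \<eta>_def field_simps)
  define C1 where "C1 = (A * 2 ^ CARD('n)) powr (\<kappa> + \<eta>) / (1 - \<delta> powr (\<kappa> + \<eta> - \<kappa>))"
  define C2 where "C2 = (A * 2 ^ CARD('n)) powr (1 + \<eta>) / (1 - \<delta> powr (1 + \<eta> - 1))"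
  have "\<delta> powr \<eta> < 1" using \<delta> \<eta> by (intro powr_less_1_of_less_1) auto
  then have C: "0 \<le> C1" "0 \<le> C2" by (auto simp: C1_def C2_def)
  show thesis
  proof (rule that[of "C1 powr (1/p) * C2 powr (1 - 1/p)"])
    show "0 \<le> C1 powr (1/p) * C2 powr (1 - 1/p)" by simp
    fix f M x and r :: real
    assume M: "morrey_bound f M" and r: "0 < r"
    then have [measurable]: "f \<in> borel_measurable borel" and f: "\<And>y. 0 \<le> f y" and M0: "0 \<le> M"
      and size: "\<And>x \<rho>. 0 < \<rho> \<Longrightarrow>
        (\<integral>\<^sup>+y. ennreal (morrey_density f y) * indicator (ccube x \<rho>) y \<partial>lborel) \<le> ennreal (M * V x \<rho> powr \<kappa>)"
      by (auto simp: morrey_bound_def)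
    define D where "D = weighted_dist x"
    have [measurable]: "D \<in> borel_measurable borel" unfolding D_def by measurable
    have D0: "0 \<le> D y" for y by (simp add: D_def weighted_dist_nonneg)
    have dom: "AE z in lborel. \<forall>\<rho>>0. z \<in> ccube x \<rho> - ccube x (\<rho>/2) \<longrightarrow> V x \<rho> \<le> (A * 2 ^ CARD('n)) * D z"
      unfolding D_def weighted_dist_def by (rule distance_dominates)
    let ?I = "indicator (- ccube x r) :: real^'n \<Rightarrow> real"
    have I: "ennreal a * indicator (- ccube x r) y = ennreal (a * ?I y)" for a y
      by (simp add: indicator_def)
    have F1: "(\<integral>\<^sup>+y. ennreal (morrey_density f y * D y powr (-(\<kappa> + \<eta>)) * ?I y) \<partial>lborel) \<le> ennreal (C1 * M * V x r powr (\<kappa> - (\<kappa> + \<eta>)))"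
      unfolding I[symmetric] C1_def
      by (rule radial_integral_far[OF _ _ _ _ _ _ _ _ size dom])
         (use M0 \<kappa> \<eta> r radial_scale morrey_density_nonneg in auto)
    have F2: "(\<integral>\<^sup>+y. ennreal (v y * D y powr (-(1 + \<eta>)) * ?I y) \<partial>lborel) \<le> ennreal (C2 * 1 * V x r powr (1 - (1 + \<eta>)))"
      unfolding I[symmetric] C2_def
      by (rule radial_integral_far[OF _ _ _ _ _ _ _ _ weight_size dom])
         (use \<eta> r radial_scale weight_pos in \<open>auto simp: less_imp_le\<close>)
    have "(\<integral>\<^sup>+y. ennreal (norm (x - y) powr (\<beta> - real CARD('n)) * f y) * indicator (- ccube x r) y \<partial>lborel)
       = (\<integral>\<^sup>+y. ennreal ((morrey_density f y * D y powr (-(\<kappa> + \<eta>)) * ?I y) powr (1 / p) *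
            (v y * D y powr (-(1 + \<eta>)) * ?I y) powr (1 - 1 / p)) \<partial>lborel)"
    proof (intro nn_integral_cong)
      fix y
      have e: "(\<kappa> + \<eta>) * (1 / p) + (1 + \<eta>) * (1 - 1 / p) = 1 - \<alpha>"
      proof -
        have "(\<kappa> + \<eta>) * (1 / p) + (1 + \<eta>) * (1 - 1 / p) = \<kappa> / p + \<eta> + (1 - 1 / p)"
          by (simp add: algebra_simps add_divide_distrib)
        then show ?thesis using one_div_s by (simp add: \<eta>_def)
      qed
      have "D y powr (-(1 - \<alpha>)) = D y powr (-(\<kappa> + \<eta>) * (1 / p)) * D y powr (-(1 + \<eta>) * (1 - 1 / p))"
        unfolding powr_add[symmetric] e[symmetric] by (simp add: algebra_simps add_divide_distrib)
      then show "ennreal (norm (x - y) powr (\<beta> - real CARD('n)) * f y) * indicator (- ccube x r) y =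
        ennreal ((morrey_density f y * D y powr (-(\<kappa> + \<eta>)) * ?I y) powr (1 / p) *
            (v y * D y powr (-(1 + \<eta>)) * ?I y) powr (1 - 1 / p))"
        using f[of y] weight_pos[of y] morrey_density_nonneg[of f y] D0[of y]
        unfolding I riesz_kernel_factor[of f y x, OF f] D_def[symmetric]
        by (simp add: powr_mult powr_powr indicator_def)
    qed
    also have "\<dots> \<le> ennreal ((C1 * M * V x r powr (\<kappa> - (\<kappa> + \<eta>))) powr (1 / p) * (C2 * 1 * V x r powr (1 - (1 + \<eta>))) powr (1 - 1 / p))"
      using F1 F2 p C M0 weight_pos morrey_density_nonneg
      by (intro nn_integral_Holder) (auto simp: less_imp_le)
    also have "(C1 * M * V x r powr (\<kappa> - (\<kappa> + \<eta>))) powr (1 / p) * (C2 * 1 * V x r powr (1 - (1 + \<eta>))) powr (1 - 1 / p)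
       = C1 powr (1 / p) * C2 powr (1 - 1 / p) * M powr (1 / p) * (V x r powr (- \<eta> * (1 / p)) * V x r powr (- \<eta> * (1 - 1 / p)))"
      using C M0 by (simp add: powr_mult powr_powr mult_ac)
    also have "V x r powr (- \<eta> * (1 / p)) * V x r powr (- \<eta> * (1 - 1 / p)) = V x r powr (\<kappa> / p - 1 / s)"
      unfolding powr_add[symmetric] by (simp add: \<eta>_def algebra_simps)
    finally show "(\<integral>\<^sup>+y. ennreal (norm (x - y) powr (\<beta> - real CARD('n)) * f y) * indicator (- ccube x r) y \<partial>lborel)
       \<le> ennreal (C1 powr (1 / p) * C2 powr (1 - 1 / p) * M powr (1 / p) * V x r powr (\<kappa> / p - 1 / s))" .
  qed
qed

text \<open>Hoelder's inequality for \<open>(F D^-(1-h))^(1/s) (F D^-\<tau>)^\<alpha> (v D^-(1-h))^(1-1/p)\<close>, where \<open>D\<close> is the weighted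
distance to \<open>x\<close>. The last two factors are grouped as \<open>G^(1-1/s)\<close>, and the integral of \<open>G\<close> is bounded by
another application of the inequality with weights \<open>\<theta>\<close> and \<open>1 - \<theta>\<close>. In the remaining integral of
\<open>F(y) D(x,y)^-(1-h)\<close> the order of integration is exchanged; the integral in \<open>x\<close> against \<open>v(x)\<close> is again
a radial one, now about \<open>y\<close>.\<close>
lemma riesz_near:
  obtains C where "0 \<le> C" "\<And>f M x0 r c. morrey_bound f M \<Longrightarrow> 0 < r \<Longrightarrow> (\<And>x. 0 \<le> c x) \<Longrightarrow>
     AE x in lborel. x \<in> ccube x0 r \<longrightarrow> ennreal (c x) \<le>
       (\<integral>\<^sup>+y. ennreal (norm (x - y) powr (\<beta> - real CARD('n)) * f y) * indicator (ccube x r) y \<partial>lborel) \<Longrightarrow>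
     (\<integral>\<^sup>+x. ennreal (c x powr s * v x) * indicator (ccube x0 r) x \<partial>lborel)
       \<le> ennreal (C * M powr (s / p) * V x0 r powr (\<kappa> * s / p))"
proof -
  \<comment> \<open>Lowering the exponent of \<open>D\<close> from \<open>1\<close> to \<open>1 - h\<close> in two factors changes the total by
  \<open>h (1/s + 1 - 1/p) = h (1 - \<alpha>)\<close>, and the middle factor makes up for it with \<open>\<tau> \<alpha>\<close>.\<close>
  define h where "h = \<alpha> * \<kappa> / 2"
  define \<tau> where "\<tau> = \<kappa> * (1 - \<alpha>) / 2"
  define \<theta> where "\<theta> = \<alpha> / (1 - 1 / s)"
  have s0: "0 < 1 - 1 / s" using s_gt by simp
  have h: "0 < h" "h < 1"
  proof -
    show "0 < h" using \<alpha> \<kappa> by (simp add: h_def)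
    have "\<alpha> * \<kappa> \<le> 1 * 1" using \<alpha> \<kappa> \<kappa>_less_1 by (intro mult_mono) auto
    then show "h < 1" by (simp add: h_def)
  qed
  have \<tau>: "0 \<le> \<tau>" "\<tau> < \<kappa>"
  proof -
    show "0 \<le> \<tau>" using \<alpha> \<kappa> by (simp add: \<tau>_def)
    have "\<kappa> * (1 - \<alpha>) < \<kappa> * 1" using \<alpha> \<kappa> by (intro mult_strict_left_mono) auto
    then show "\<tau> < \<kappa>" using \<kappa> by (simp add: \<tau>_def)
  qed
  have \<theta>_mult: "\<theta> * (1 - 1 / s) = \<alpha>" "(1 - \<theta>) * (1 - 1 / s) = 1 - 1 / p"
  proof -
    have "a / c * c = a" if "c \<noteq> 0" for a c :: real using that by simp
    then show 1: "\<theta> * (1 - 1 / s) = \<alpha>" using s0 unfolding \<theta>_def by (metis less_irrefl)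
    have "(1 - \<theta>) * (1 - 1 / s) = 1 - 1 / s - \<theta> * (1 - 1 / s)" by (simp add: left_diff_distrib)
    then show "(1 - \<theta>) * (1 - 1 / s) = 1 - 1 / p" unfolding 1 using one_div_s by linarith
  qed
  have \<theta>: "0 < \<theta>" "\<theta> < 1"
  proof -
    show "0 < \<theta>" using \<alpha> s0 by (simp add: \<theta>_def)
    have "0 < (1 - \<theta>) * (1 - 1 / s)" unfolding \<theta>_mult using p by simp
    then show "\<theta> < 1" using s0 by (simp add: zero_less_mult_iff)
  qed
  have \<theta>_s: "\<theta> * (s - 1) = \<alpha> * s" "(1 - \<theta>) * (s - 1) = s * (1 - 1 / p)"
  proof -
    have e: "s - 1 = s * (1 - 1 / s)" using s_gt by (simp add: field_simps)
    show "\<theta> * (s - 1) = \<alpha> * s" unfolding e using \<theta>_mult(1) by (metis mult.assoc mult.commute)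
    show "(1 - \<theta>) * (s - 1) = s * (1 - 1 / p)" unfolding e using \<theta>_mult(2) by (metis mult.left_commute)
  qed
  define C1 where "C1 = (A * 2 ^ CARD('n)) powr (1 - h) / (1 - \<delta> powr (1 - (1 - h)))"
  define C2 where "C2 = (A * 2 ^ CARD('n)) powr \<tau> / (1 - \<delta> powr (\<kappa> - \<tau>))"
  have "\<delta> powr h < 1" "\<delta> powr (\<kappa> - \<tau>) < 1" using \<delta> h \<tau> by (auto intro!: powr_less_1_of_less_1)
  then have C: "0 \<le> C1" "0 \<le> C2" by (auto simp: C1_def C2_def)
  define Cd where "Cd = A * 3 ^ CARD('n)"
  have Cd: "0 < Cd" using A_pos by (simp add: Cd_def)
  define C0 where "C0 = C2 powr (\<alpha> * s) * C1 powr (s * (1 - 1 / p)) * C1 * Cd powr (\<kappa> * s / p)"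
  show thesis
  proof (rule that[of C0])
    show "0 \<le> C0" using C by (simp add: C0_def)
    fix f M x0 and r :: real and c :: "real^'n \<Rightarrow> real"
    assume M: "morrey_bound f M" and r: "0 < r" and c0: "\<And>x. 0 \<le> c x"
      and c: "AE x in lborel. x \<in> ccube x0 r \<longrightarrow> ennreal (c x) \<le>
       (\<integral>\<^sup>+y. ennreal (norm (x - y) powr (\<beta> - real CARD('n)) * f y) * indicator (ccube x r) y \<partial>lborel)"
    from M have [measurable]: "f \<in> borel_measurable borel" and f: "\<And>y. 0 \<le> f y" and M0: "0 \<le> M"
      and size: "\<And>x \<rho>. 0 < \<rho> \<Longrightarrow>
        (\<integral>\<^sup>+y. ennreal (morrey_density f y) * indicator (ccube x \<rho>) y \<partial>lborel) \<le> ennreal (M * V x \<rho> powr \<kappa>)"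
      by (auto simp: morrey_bound_def)
    let ?F = "morrey_density f"
    \<comment> \<open>\<open>W\<close> bounds the masses of all cubes \<open>Q(y,r)\<close> with \<open>y\<close> in \<open>Q(x0,2r)\<close>.\<close>
    define W where "W = Cd * V x0 r"
    have W3: "V x0 (3 * r) \<le> W"
      using mass_doubling[of r x0 x0 "3 * r"] r ccube_mono[of r "3*r" x0] by (simp add: W_def Cd_def)
    have W: "0 < W" using Cd mass_pos[OF r] by (simp add: W_def)
    have VW: "V y r \<le> W" if "y \<in> ccube x0 (2 * r)" for y
      using mass_mono[OF ccube_subset[OF that, of r "3 * r"]] W3 by simp
    define B0 where "B0 = (C2 * M * W powr (\<kappa> - \<tau>)) powr (\<alpha> * s) * (C1 * W powr h) powr (s * (1 - 1 / p))"
    have B0: "0 \<le> B0" by (simp add: B0_def)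
    have pointwise: "ennreal (c x powr s) \<le> ennreal B0 *
        (\<integral>\<^sup>+y. ennreal (?F y * weighted_dist x y powr (-(1 - h))) * indicator (ccube x r) y \<partial>lborel)"
      if cx: "ennreal (c x) \<le>
       (\<integral>\<^sup>+y. ennreal (norm (x - y) powr (\<beta> - real CARD('n)) * f y) * indicator (ccube x r) y \<partial>lborel)"
       and x: "x \<in> ccube x0 r" for x
    proof -
      define D where "D = weighted_dist x"
      have [measurable]: "D \<in> borel_measurable borel" unfolding D_def by measurable
      have D0: "0 \<le> D y" for y by (simp add: D_def weighted_dist_nonneg)
      have dom: "AE z in lborel. \<forall>\<rho>>0. z \<in> ccube x \<rho> - ccube x (\<rho>/2) \<longrightarrow> V x \<rho> \<le> (A * 2 ^ CARD('n)) * D z"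
        unfolding D_def weighted_dist_def by (rule distance_dominates)
      let ?I = "indicator (ccube x r) :: real^'n \<Rightarrow> real"
      have I: "ennreal a * indicator (ccube x r) y = ennreal (a * ?I y)" for a y
        by (simp add: indicator_def)
      have F1: "(\<integral>\<^sup>+y. ennreal (?F y * D y powr (-\<tau>) * ?I y) \<partial>lborel) \<le> ennreal (C2 * M * V x r powr (\<kappa> - \<tau>))"
        unfolding I[symmetric] C2_def
        by (rule radial_integral_near[OF _ _ _ _ _ _ _ _ size dom])
           (use M0 \<tau> r radial_scale morrey_density_nonneg in auto)
      have F2: "(\<integral>\<^sup>+y. ennreal (v y * D y powr (-(1 - h)) * ?I y) \<partial>lborel) \<le> ennreal (C1 * 1 * V x r powr (1 - (1 - h)))"
        unfolding I[symmetric] C1_def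
        by (rule radial_integral_near[OF _ _ _ _ _ _ _ _ weight_size dom])
           (use h r radial_scale weight_pos in \<open>auto simp: less_imp_le\<close>)
      define G where "G y = (?F y * D y powr (-\<tau>) * ?I y) powr \<theta> * (v y * D y powr (-(1 - h)) * ?I y) powr (1 - \<theta>)" for y
      have [measurable]: "G \<in> borel_measurable borel" unfolding G_def[abs_def] by measurable
      define B where "B = (C2 * M * V x r powr (\<kappa> - \<tau>)) powr \<theta> * (C1 * 1 * V x r powr (1 - (1 - h))) powr (1 - \<theta>)"
      have GB: "(\<integral>\<^sup>+y. ennreal (G y) \<partial>lborel) \<le> ennreal B"
        unfolding G_def B_def using F1 F2 \<theta> C M0 weight_pos morrey_density_nonneg
        by (intro nn_integral_Holder) (auto simp: less_imp_le)
      have "ennreal (c x) \<le> (\<integral>\<^sup>+y. ennreal ((?F y * D y powr (-(1 - h)) * ?I y) powr (1 / s) * G y powr (1 - 1 / s)) \<partial>lborel)"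
      proof -
        have "ennreal (norm (x - y) powr (\<beta> - real CARD('n)) * f y) * indicator (ccube x r) y
            = ennreal ((?F y * D y powr (-(1 - h)) * ?I y) powr (1 / s) * G y powr (1 - 1 / s))" for y
        proof (cases "y \<in> ccube x r")
          case False
          then show ?thesis by (simp add: G_def)
        next
          case True
          have e: "(1 - h) * (1 / s) + \<tau> * \<alpha> + (1 - h) * (1 - 1 / p) = 1 - \<alpha>"
          proof -
            have "(1 - h) * (1 / s) + \<tau> * \<alpha> + (1 - h) * (1 - 1 / p) = (1 - h) * (1 / s + (1 - 1 / p)) + \<tau> * \<alpha>"
              by (simp only: distrib_left)
            also have "1 / s + (1 - 1 / p) = 1 - \<alpha>" using one_div_s by simp
            finally show ?thesis by (simp add: h_def \<tau>_def algebra_simps)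
          qed
          have "G y powr (1 - 1 / s) = (?F y * D y powr (-\<tau>)) powr (\<theta> * (1 - 1 / s)) *
              (v y * D y powr (-(1 - h))) powr ((1 - \<theta>) * (1 - 1 / s))"
            using True by (simp only: G_def powr_mult powr_powr powr_ge_zero indicator_simps mult_1_right mult.assoc)
          also have "\<dots> = (?F y * D y powr (-\<tau>)) powr \<alpha> * (v y * D y powr (-(1 - h))) powr (1 - 1 / p)"
            by (simp only: \<theta>_mult)
          also have "\<dots> = ?F y powr \<alpha> * v y powr (1 - 1 / p) *
              (D y powr (- \<tau> * \<alpha>) * D y powr (-(1 - h) * (1 - 1 / p)))"
            using morrey_density_nonneg[of f y] less_imp_le[OF weight_pos[of y]]
            by (simp only: powr_mult powr_powr powr_ge_zero mult_ac)
          finally have G: "G y powr (1 - 1 / s) = ?F y powr \<alpha> * v y powr (1 - 1 / p) *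
              (D y powr (- \<tau> * \<alpha>) * D y powr (-(1 - h) * (1 - 1 / p)))" .
          have "(?F y * D y powr (-(1 - h)) * ?I y) powr (1 / s) * G y powr (1 - 1 / s)
              = (?F y powr (1 / s) * ?F y powr \<alpha>) * v y powr (1 - 1 / p) *
                (D y powr (-(1 - h) * (1 / s)) * D y powr (- \<tau> * \<alpha>) * D y powr (-(1 - h) * (1 - 1 / p)))"
            unfolding G using True D0[of y] morrey_density_nonneg[of f y]
            by (simp add: powr_mult powr_powr mult_ac)
          also have "?F y powr (1 / s) * ?F y powr \<alpha> = ?F y powr (1 / p)"
            unfolding powr_add[symmetric] one_div_s by simp
          also have "D y powr (-(1 - h) * (1 / s)) * D y powr (- \<tau> * \<alpha>) * D y powr (-(1 - h) * (1 - 1 / p))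
              = D y powr (-(1 - \<alpha>))"
            unfolding powr_add[symmetric] e[symmetric] by (simp add: algebra_simps add_divide_distrib diff_divide_distrib)
          finally show ?thesis using True unfolding riesz_kernel_factor[of f y x, OF f] D_def[symmetric]
            by (simp add: mult_ac)
        qed
        then show ?thesis using cx by simp
      qed
      then have "ennreal (c x powr s) \<le> ennreal (B powr (s - 1)) * (\<integral>\<^sup>+y. ennreal (?F y * D y powr (-(1 - h)) * ?I y) \<partial>lborel)"
        using s_gt c0 GB morrey_density_nonneg
        by (intro nn_integral_Holder_power[where g = G]) (auto simp: G_def B_def)
      also have "\<dots> \<le> ennreal B0 * (\<integral>\<^sup>+y. ennreal (?F y * D y powr (-(1 - h)) * ?I y) \<partial>lborel)"
      proof (intro mult_right_mono ennreal_leI)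
        have Vx: "V x r \<le> W" "0 \<le> V x r"
          using VW[of x] x r ccube_mono[of r "2 * r" x0] mass_nonneg by auto
        have "B powr (s - 1) = (C2 * M * V x r powr (\<kappa> - \<tau>)) powr (\<theta> * (s - 1)) * (C1 * V x r powr h) powr ((1 - \<theta>) * (s - 1))"
          using C M0 by (simp add: B_def powr_mult powr_powr mult.assoc)
        also have "\<dots> \<le> B0"
          unfolding B0_def \<theta>_s using Vx C M0 \<alpha> s_gt p h \<tau>
          by (intro mult_mono powr_mono2 mult_left_mono) auto
        finally show "B powr (s - 1) \<le> B0" .
      qed simp
      finally show ?thesis unfolding I D_def .
    qed
    let ?k = "\<lambda>x y. ennreal (v x) * (ennreal (?F y * weighted_dist x y powr (-(1 - h))) * indicator (ccube x r) y) * indicator (ccube x0 r) x"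
    have joint [measurable]: "(\<lambda>p. ?k (fst p) (snd p)) \<in> borel_measurable (lborel \<Otimes>\<^sub>M lborel)"
      unfolding weighted_dist_def by measurable
    have "(\<integral>\<^sup>+x. ennreal (c x powr s * v x) * indicator (ccube x0 r) x \<partial>lborel)
       \<le> (\<integral>\<^sup>+x. ennreal B0 * (\<integral>\<^sup>+y. ?k x y \<partial>lborel) \<partial>lborel)"
    proof (rule nn_integral_mono_AE)
      show "AE x in lborel. ennreal (c x powr s * v x) * indicator (ccube x0 r) x \<le> ennreal B0 * (\<integral>\<^sup>+y. ?k x y \<partial>lborel)"
        using c
      proof eventually_elim
        case (elim x)
        show ?case
        proof (cases "x \<in> ccube x0 r")
          case True
          have "ennreal (c x powr s * v x) = ennreal (v x) * ennreal (c x powr s)"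
            using weight_pos[of x] by (simp add: ennreal_mult mult.commute less_imp_le)
          also have "\<dots> \<le> ennreal (v x) * (ennreal B0 *
              (\<integral>\<^sup>+y. ennreal (?F y * weighted_dist x y powr (-(1 - h))) * indicator (ccube x r) y \<partial>lborel))"
            using True elim by (intro mult_left_mono pointwise) auto
          also have "\<dots> = ennreal B0 * (\<integral>\<^sup>+y. ?k x y \<partial>lborel)"
            using True by (simp add: nn_integral_cmult mult_ac)
          finally show ?thesis using True by simp
        qed simp
      qed
    qed
    also have "\<dots> = ennreal B0 * (\<integral>\<^sup>+x. \<integral>\<^sup>+y. ?k x y \<partial>lborel \<partial>lborel)"
      using joint by (intro nn_integral_cmult) (simp add: lborel.borel_measurable_nn_integral split_beta')
    also have "\<dots> \<le> ennreal B0 * (ennreal (C1 * W powr h) * ennreal (M * W powr \<kappa>))"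
    proof (rule mult_left_mono)
      have "(\<integral>\<^sup>+x. \<integral>\<^sup>+y. ?k x y \<partial>lborel \<partial>lborel) = (\<integral>\<^sup>+y. \<integral>\<^sup>+x. ?k x y \<partial>lborel \<partial>lborel)"
        using lborel_pair.Fubini[of "\<lambda>p. ?k (fst p) (snd p)"] joint by simp
      also have "\<dots> \<le> (\<integral>\<^sup>+y. ennreal (C1 * W powr h) * (ennreal (?F y) * indicator (ccube x0 (2 * r)) y) \<partial>lborel)"
      proof (rule nn_integral_mono_AE)
        show "AE y in lborel. (\<integral>\<^sup>+x. ?k x y \<partial>lborel) \<le> ennreal (C1 * W powr h) * (ennreal (?F y) * indicator (ccube x0 (2 * r)) y)"
          using distance_dominates_center
        proof eventually_elim
          case (elim y)
          show ?case
          proof (cases "y \<in> ccube x0 (2 * r)")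
            case False
            have k0: "?k x y = 0" for x
            proof (cases "x \<in> ccube x0 r \<and> y \<in> ccube x r")
              case True
              then have "y \<in> ccube x0 (2 * r)" using ccube_subset[of x x0 r r "2 * r"] by auto
              then show ?thesis using False by simp
            qed (auto simp: indicator_def)
            have e: "(\<integral>\<^sup>+x. ?k x y \<partial>lborel) = (\<integral>\<^sup>+x. 0 \<partial>(lborel :: (real^'n) measure))"
              by (rule nn_integral_cong) (rule k0)
            show ?thesis unfolding e by simp
          next
            case True
            have "(\<integral>\<^sup>+x. ?k x y \<partial>lborel) \<le> (\<integral>\<^sup>+x. ennreal (?F y) * (ennreal (v x * weighted_dist x y powr (-(1 - h))) * indicator (ccube y r) x) \<partial>lborel)"
              by (intro nn_integral_mono)
                 (use ccube_sym weight_pos morrey_density_nonneg in \<open>auto simp: indicator_def less_imp_le ennreal_mult[symmetric] mult_ac intro!: ennreal_leI\<close>)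
            also have "\<dots> = ennreal (?F y) * (\<integral>\<^sup>+x. ennreal (v x * weighted_dist x y powr (-(1 - h))) * indicator (ccube y r) x \<partial>lborel)"
              unfolding weighted_dist_def by (intro nn_integral_cmult) measurable
            also have "ennreal (?F y) * (\<integral>\<^sup>+x. ennreal (v x * weighted_dist x y powr (-(1 - h))) * indicator (ccube y r) x \<partial>lborel)
                \<le> ennreal (?F y) * ennreal (C1 * 1 * V y r powr (1 - (1 - h)))"
              unfolding C1_def
            proof (rule mult_left_mono[OF radial_integral_near[OF _ _ _ _ _ _ _ _ weight_size]])
              show "AE z in lborel. \<forall>\<rho>>0. z \<in> ccube y \<rho> - ccube y (\<rho> / 2) \<longrightarrow> V y \<rho> \<le> A * 2 ^ CARD('n) * weighted_dist z y"
                using elim by (simp add: weighted_dist_def)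
              show "(\<lambda>x. weighted_dist x y) \<in> borel_measurable borel"
                unfolding weighted_dist_def by measurable
            qed (use h r radial_scale weight_pos in \<open>auto simp: less_imp_le\<close>)
            also have "\<dots> \<le> ennreal (?F y) * ennreal (C1 * W powr h)"
              using VW[OF True] C h mass_nonneg by (intro mult_left_mono ennreal_leI) (auto intro!: mult_left_mono powr_mono2)
            also have "\<dots> = ennreal (C1 * W powr h) * (ennreal (?F y) * indicator (ccube x0 (2 * r)) y)"
              using True by (simp add: mult.commute)
            finally show ?thesis .
          qed
        qed
      qed
      also have "\<dots> = ennreal (C1 * W powr h) * (\<integral>\<^sup>+y. ennreal (?F y) * indicator (ccube x0 (2 * r)) y \<partial>lborel)"
        by (intro nn_integral_cmult) measurable
      also have "\<dots> \<le> ennreal (C1 * W powr h) * ennreal (M * W powr \<kappa>)"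
      proof (intro mult_left_mono)
        have "V x0 (2 * r) \<le> W" using mass_mono[OF ccube_mono[of "2 * r" "3 * r" x0]] W3 r by simp
        then have "M * V x0 (2 * r) powr \<kappa> \<le> M * W powr \<kappa>"
          using M0 \<kappa> mass_nonneg by (intro mult_left_mono powr_mono2) auto
        then show "(\<integral>\<^sup>+y. ennreal (?F y) * indicator (ccube x0 (2 * r)) y \<partial>lborel) \<le> ennreal (M * W powr \<kappa>)"
          using r by (intro order_trans[OF size ennreal_leI]) auto
      qed simp
      finally show "(\<integral>\<^sup>+x. \<integral>\<^sup>+y. ?k x y \<partial>lborel \<partial>lborel) \<le> ennreal (C1 * W powr h) * ennreal (M * W powr \<kappa>)" .
    qed simp
    also have "\<dots> = ennreal (B0 * (C1 * W powr h) * (M * W powr \<kappa>))"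
      using B0 C M0 by (simp add: ennreal_mult mult.assoc)
    also have "B0 * (C1 * W powr h) * (M * W powr \<kappa>) = C0 * M powr (s / p) * V x0 r powr (\<kappa> * s / p)"
    proof -
      have M_exp: "M powr (\<alpha> * s) * M = M powr (s / p)"
        unfolding \<alpha>_s[symmetric] powr_add using M0 by simp
      have e: "(\<kappa> - \<tau>) * (\<alpha> * s) + h * (s * (1 - 1 / p)) + h + \<kappa> = \<kappa> * s / p"
      proof -
        have "s * (1 - 1 / p) + 1 = s - (s / p - 1)" by (simp add: algebra_simps)
        also have "\<dots> = s * (1 - \<alpha>)" unfolding \<alpha>_s[symmetric] by (simp add: algebra_simps)
        finally have 1: "s * (1 - 1 / p) + 1 = s * (1 - \<alpha>)" .
        have "(\<kappa> - \<tau>) * (\<alpha> * s) + h * (s * (1 - 1 / p)) + h + \<kappa>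
            = \<kappa> * (\<alpha> * s + 1) + (h * (s * (1 - 1 / p) + 1) - \<tau> * (\<alpha> * s))"
          by (simp add: algebra_simps)
        also have "h * (s * (1 - 1 / p) + 1) - \<tau> * (\<alpha> * s) = 0"
          unfolding 1 by (simp add: h_def \<tau>_def)
        finally show ?thesis unfolding \<alpha>_s by simp
      qed
      have "B0 * (C1 * W powr h) * (M * W powr \<kappa>) = C2 powr (\<alpha> * s) * C1 powr (s * (1 - 1 / p)) * C1 * (M powr (\<alpha> * s) * M) *
          (W powr ((\<kappa> - \<tau>) * (\<alpha> * s)) * W powr (h * (s * (1 - 1 / p))) * W powr h * W powr \<kappa>)"
        unfolding B0_def by (simp only: powr_mult powr_powr mult_ac)
      also have "W powr ((\<kappa> - \<tau>) * (\<alpha> * s)) * W powr (h * (s * (1 - 1 / p))) * W powr h * W powr \<kappa> = W powr (\<kappa> * s / p)"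
        unfolding powr_add[symmetric] e ..
      also have "\<dots> = Cd powr (\<kappa> * s / p) * V x0 r powr (\<kappa> * s / p)"
        using Cd mass_nonneg by (simp add: W_def powr_mult)
      finally show ?thesis unfolding M_exp C0_def by (simp only: mult_ac)
    qed
    finally show "(\<integral>\<^sup>+x. ennreal (c x powr s * v x) * indicator (ccube x0 r) x \<partial>lborel)
       \<le> ennreal (C0 * M powr (s / p) * V x0 r powr (\<kappa> * s / p))" .
  qed
qed

text \<open>On \<open>Q(x0,r)\<close> the far part of the integral is at most a constant \<open>t\<close>, since all cubes \<open>Q(x,r)\<close> with
\<open>x\<close> in it have comparable mass; what exceeds \<open>t\<close> comes from the near part.\<close>
lemma riesz_potential_bound:
  obtains C where "0 \<le> C" "\<And>f M x0 r c. morrey_bound f M \<Longrightarrow> 0 < r \<Longrightarrow>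
     c \<in> borel_measurable borel \<Longrightarrow> (\<And>x. 0 \<le> c x) \<Longrightarrow>
     AE x in lborel. ennreal (c x) \<le>
       (\<integral>\<^sup>+y. ennreal (norm (x - y) powr (\<beta> - real CARD('n)) * f y) \<partial>lborel) \<Longrightarrow>
     (\<integral>\<^sup>+x. ennreal (c x powr s * v x) * indicator (ccube x0 r) x \<partial>lborel)
       \<le> ennreal (C * M powr (s / p) * V x0 r powr (\<kappa> * s / p))"
proof -
  obtain Cf where Cf: "0 \<le> Cf" "\<And>f M x r. morrey_bound f M \<Longrightarrow> 0 < r \<Longrightarrow>
     (\<integral>\<^sup>+y. ennreal (norm (x - y) powr (\<beta> - real CARD('n)) * f y) * indicator (- ccube x r) y \<partial>lborel)
       \<le> ennreal (Cf * M powr (1 / p) * V x r powr (\<kappa> / p - 1 / s))"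
    by (rule riesz_far) blast
  obtain Cn where Cn: "0 \<le> Cn" "\<And>f M x0 r c. morrey_bound f M \<Longrightarrow> 0 < r \<Longrightarrow> (\<And>x. 0 \<le> c x) \<Longrightarrow>
     AE x in lborel. x \<in> ccube x0 r \<longrightarrow> ennreal (c x) \<le>
       (\<integral>\<^sup>+y. ennreal (norm (x - y) powr (\<beta> - real CARD('n)) * f y) * indicator (ccube x r) y \<partial>lborel) \<Longrightarrow>
     (\<integral>\<^sup>+x. ennreal (c x powr s * v x) * indicator (ccube x0 r) x \<partial>lborel)
       \<le> ennreal (Cn * M powr (s / p) * V x0 r powr (\<kappa> * s / p))"
    by (rule riesz_near) blast
  define Cd where "Cd = A * 2 ^ CARD('n)"
  have Cd: "0 < Cd" using A_pos by (simp add: Cd_def)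
  define Ct where "Ct = Cf * (1 / Cd) powr (\<kappa> / p - 1 / s)"
  have Ct: "0 \<le> Ct" using Cf by (simp add: Ct_def)
  show thesis
  proof (rule that[of "2 powr s * (Cn + Ct powr s)"])
    show "0 \<le> 2 powr s * (Cn + Ct powr s)" using Cn by simp
    fix f M x0 and r :: real and c :: "real^'n \<Rightarrow> real"
    assume M: "morrey_bound f M" and r: "0 < r" and [measurable]: "c \<in> borel_measurable borel" and c0: "\<And>x. 0 \<le> c x"
      and c: "AE x in lborel. ennreal (c x) \<le>
       (\<integral>\<^sup>+y. ennreal (norm (x - y) powr (\<beta> - real CARD('n)) * f y) \<partial>lborel)"
    have [measurable]: "f \<in> borel_measurable borel" and M0: "0 \<le> M" using M by (auto simp: morrey_bound_def)
    define t where "t = Ct * M powr (1 / p) * V x0 r powr (\<kappa> / p - 1 / s)"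
    have t: "0 \<le> t" using Ct by (simp add: t_def)
    define c' where "c' x = max 0 (c x - t)" for x
    have near: "(\<integral>\<^sup>+x. ennreal (c' x powr s * v x) * indicator (ccube x0 r) x \<partial>lborel)
       \<le> ennreal (Cn * M powr (s / p) * V x0 r powr (\<kappa> * s / p))"
    proof (rule Cn(2)[OF M r])
      show "0 \<le> c' x" for x by (simp add: c'_def)
      show "AE x in lborel. x \<in> ccube x0 r \<longrightarrow> ennreal (c' x) \<le>
        (\<integral>\<^sup>+y. ennreal (norm (x - y) powr (\<beta> - real CARD('n)) * f y) * indicator (ccube x r) y \<partial>lborel)"
        using c
      proof eventually_elim
        case (elim x)
        show ?case
        proof
          assume x: "x \<in> ccube x0 r"
          let ?k = "\<lambda>y. ennreal (norm (x - y) powr (\<beta> - real CARD('n)) * f y)"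
          have "V x0 r \<le> V x (2 * r)"
            using x by (intro mass_mono ccube_subset) (auto simp: ccube_sym[of x0])
          also have "\<dots> \<le> Cd * V x r"
            using mass_doubling[of r x x "2 * r"] r ccube_mono[of r "2 * r" x] by (simp add: Cd_def)
          finally have Vx: "1 / Cd * V x0 r \<le> V x r" using Cd by (simp add: field_simps)
          have "(\<integral>\<^sup>+y. ?k y * indicator (- ccube x r) y \<partial>lborel) \<le> ennreal (Cf * M powr (1 / p) * V x r powr (\<kappa> / p - 1 / s))"
            by (rule Cf(2)[OF M r])
          also have "\<dots> \<le> ennreal t"
          proof (rule ennreal_leI)
            have "\<kappa> / p - 1 / s \<le> 0" using \<kappa> p s_gt by (simp add: field_simps)
            then have "V x r powr (\<kappa> / p - 1 / s) \<le> (1 / Cd * V x0 r) powr (\<kappa> / p - 1 / s)"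
              using Vx Cd mass_pos[OF r, of x0] by (intro powr_mono2') auto
            also have "\<dots> = (1 / Cd) powr (\<kappa> / p - 1 / s) * V x0 r powr (\<kappa> / p - 1 / s)" by (rule powr_mult)
            finally have "Cf * M powr (1 / p) * V x r powr (\<kappa> / p - 1 / s) \<le>
               Cf * M powr (1 / p) * ((1 / Cd) powr (\<kappa> / p - 1 / s) * V x0 r powr (\<kappa> / p - 1 / s))"
              using Cf by (intro mult_left_mono) auto
            then show "Cf * M powr (1 / p) * V x r powr (\<kappa> / p - 1 / s) \<le> t"
              by (simp add: t_def Ct_def mult_ac)
          qed
          finally have far: "(\<integral>\<^sup>+y. ?k y * indicator (- ccube x r) y \<partial>lborel) \<le> ennreal t" .
          have "(\<integral>\<^sup>+y. ?k y \<partial>lborel) = (\<integral>\<^sup>+y. ?k y * indicator (ccube x r) y + ?k y * indicator (- ccube x r) y \<partial>lborel)"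
            by (intro nn_integral_cong) (auto simp: indicator_def)
          also have "\<dots> = (\<integral>\<^sup>+y. ?k y * indicator (ccube x r) y \<partial>lborel) + (\<integral>\<^sup>+y. ?k y * indicator (- ccube x r) y \<partial>lborel)"
            by (intro nn_integral_add) auto
          also have "\<dots> \<le> (\<integral>\<^sup>+y. ?k y * indicator (ccube x r) y \<partial>lborel) + ennreal t"
            using far by (intro add_left_mono)
          finally have le: "ennreal (c x) \<le> (\<integral>\<^sup>+y. ?k y * indicator (ccube x r) y \<partial>lborel) + ennreal t"
            using elim by (rule order_trans[rotated])
          have "ennreal (c' x) = ennreal (c x) - ennreal t"
            using t by (auto simp: c'_def ennreal_minus max_def ennreal_neg)
          also have "\<dots> \<le> (\<integral>\<^sup>+y. ?k y * indicator (ccube x r) y \<partial>lborel)"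
            using le by (simp add: ennreal_minus_le_iff add.commute)
          finally show "ennreal (c' x) \<le> (\<integral>\<^sup>+y. ?k y * indicator (ccube x r) y \<partial>lborel)" .
        qed
      qed
    qed
    have split: "c x powr s \<le> 2 powr s * (c' x powr s + t powr s)" for x
    proof -
      have "c x \<le> 2 * max (c' x) t" using t by (auto simp: c'_def max_def)
      then have "c x powr s \<le> (2 * max (c' x) t) powr s" using c0 s_gt by (intro powr_mono2) auto
      also have "\<dots> = 2 powr s * max (c' x) t powr s" by (rule powr_mult)
      also have "\<dots> \<le> 2 powr s * (c' x powr s + t powr s)"
        by (intro mult_left_mono) (auto simp: max_def)
      finally show ?thesis .
    qed
    define c'' where "c'' x = ennreal (c' x powr s * v x) * indicator (ccube x0 r) x" for x
    have [measurable]: "c'' \<in> borel_measurable borel"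
      unfolding c''_def[abs_def] c'_def[abs_def] by measurable
    have "(\<integral>\<^sup>+x. ennreal (c x powr s * v x) * indicator (ccube x0 r) x \<partial>lborel)
      \<le> (\<integral>\<^sup>+x. ennreal (2 powr s) * (c'' x + ennreal (t powr s) * (ennreal (v x) * indicator (ccube x0 r) x)) \<partial>lborel)"
    proof (intro nn_integral_mono)
      fix x
      have "c x powr s * v x \<le> 2 powr s * (c' x powr s * v x + t powr s * v x)"
        using mult_right_mono[OF split[of x] less_imp_le[OF weight_pos[of x]]] by (simp add: algebra_simps)
      then show "ennreal (c x powr s * v x) * indicator (ccube x0 r) x \<le>
         ennreal (2 powr s) * (c'' x + ennreal (t powr s) * (ennreal (v x) * indicator (ccube x0 r) x))"
        unfolding c''_def using weight_pos[of x]
        by (auto simp: indicator_def ennreal_mult[symmetric] ennreal_plus[symmetric] simp del: ennreal_plus intro!: ennreal_leI)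
    qed
    also have "\<dots> = ennreal (2 powr s) * ((\<integral>\<^sup>+x. c'' x \<partial>lborel) + ennreal (t powr s) * (\<integral>\<^sup>+x. ennreal (v x) * indicator (ccube x0 r) x \<partial>lborel))"
      by (simp add: nn_integral_cmult nn_integral_add)
    also have "\<dots> \<le> ennreal (2 powr s) * (ennreal (Cn * M powr (s / p) * V x0 r powr (\<kappa> * s / p)) + ennreal (t powr s * V x0 r))"
      using near unfolding c''_def nn_integral_weight
      by (intro mult_left_mono add_mono) (auto simp: ennreal_mult mass_nonneg)
    also have "\<dots> = ennreal (2 powr s * (Cn * M powr (s / p) * V x0 r powr (\<kappa> * s / p) + t powr s * V x0 r))"
      using Cn mass_nonneg by (simp add: ennreal_mult ennreal_plus)
    also have "t powr s * V x0 r = Ct powr s * M powr (s / p) * V x0 r powr (\<kappa> * s / p)"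
    proof -
      have "(\<kappa> / p - 1 / s) * s + 1 = \<kappa> * s / p" using s_gt by (simp add: algebra_simps)
      then have "V x0 r powr ((\<kappa> / p - 1 / s) * s) * V x0 r = V x0 r powr (\<kappa> * s / p)"
        using mass_pos[OF r, of x0] by (metis powr_add powr_one mass_nonneg)
      then show ?thesis using Ct M0 by (simp add: t_def powr_mult powr_powr mult_ac)
    qed
    finally show "(\<integral>\<^sup>+x. ennreal (c x powr s * v x) * indicator (ccube x0 r) x \<partial>lborel)
       \<le> ennreal (2 powr s * (Cn + Ct powr s) * M powr (s / p) * V x0 r powr (\<kappa> * s / p))"
      by (simp add: algebra_simps)
  qed
qed

end

section \<open>Hoelder continuous representatives\<close>

lemma AE_lebesgue_iff: "(AE x in lebesgue. P x) \<longleftrightarrow> (AE x in lborel. P x)"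
  by (rule AE_completion_iff)

lemma measure_lebesgue_ccube: "0 \<le> r \<Longrightarrow> measure lebesgue (ccube (x::real^'n) r) = (2 * r) ^ CARD('n)"
  using measure_ccube[of r x] by simp

text \<open>The restrictions to balls of growing radius are integrable.\<close>
lemma locally_integrable_imp_measurable:
  fixes g :: "real^'n \<Rightarrow> 'b::{banach, second_countable_topology}"
  assumes "locally_integrable g" shows "g \<in> borel_measurable lebesgue"
proof (rule borel_measurable_LIMSEQ_metric)
  fix k :: nat
  have "set_integrable lebesgue (cball 0 (real k)) g"
    using assms by (simp add: locally_integrable_def)
  then show "(\<lambda>x. indicator (cball 0 (real k)) x *\<^sub>R g x) \<in> borel_measurable lebesgue"
    unfolding set_integrable_def by (rule borel_measurable_integrable)
next
  fix x :: "real^'n"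
  obtain m :: nat where m: "norm x \<le> real m" using real_arch_simple by blast
  have "eventually (\<lambda>k. indicator (cball 0 (real k)) x *\<^sub>R g x = g x) sequentially"
    using eventually_ge_at_top[of m] by eventually_elim (use m in \<open>auto simp: indicator_def\<close>)
  then show "(\<lambda>k. indicator (cball 0 (real k)) x *\<^sub>R g x) \<longlonglongrightarrow> g x"
    by (rule tendsto_eventually)
qed

lemma integrable_indicator_ccube:
  "integrable lebesgue (indicator (ccube (x::real^'n) r) :: _ \<Rightarrow> real)"
  using emeasure_lborel_cbox_finite[of "\<chi> i. x $ i - r" "\<chi> i. x $ i + r"]
  by (simp add: integrable_indicator_iff ccube_eq_cbox less_top)

text \<open>The constant \<open>L\<close> absorbs the powers of two that relate the half side of a cube to its volume.\<close>
locale campanato =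
  fixes b :: "real^'n \<Rightarrow> complex" and \<beta> L :: real
  assumes locally_integrable: "locally_integrable b" and \<beta>: "0 < \<beta>" and L: "0 \<le> L"
    and oscillation: "0 < r \<Longrightarrow> (LINT z:ccube x r|lebesgue. norm (b z - average (ccube x r) b))
          \<le> L * r powr \<beta> * (2 * r) ^ CARD('n)"
begin

definition avg where "avg x r = average (ccube x r) b"

lemma set_integrable_ccube: "set_integrable lebesgue (ccube x r) b"
  using locally_integrable compact_ccube unfolding locally_integrable_def by blast

lemma set_integrable_const: "set_integrable lebesgue (ccube (x::real^'n) r) (\<lambda>_. c :: complex)"
  unfolding set_integrable_def by (intro integrable_scaleR_left integrable_indicator_ccube)

lemma set_integrable_diff: "set_integrable lebesgue (ccube x r) (\<lambda>z. b z - c)"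
  by (intro set_integral_diff set_integrable_ccube set_integrable_const)

lemma set_integrable_norm_diff: "set_integrable lebesgue (ccube x r) (\<lambda>z. norm (b z - c))"
  using set_integrable_norm[OF set_integrable_diff] .

lemma avg_compare:
  assumes "0 < \<rho>" "0 < r" and sub: "ccube y \<rho> \<subseteq> ccube x r"
  shows "norm (avg y \<rho> - avg x r) \<le> (r / \<rho>) ^ CARD('n) * L * r powr \<beta>"
proof -
  let ?c = "avg x r"
  define m where "m = (2 * \<rho>) ^ CARD('n)"
  have m: "0 < m" using assms by (simp add: m_def)
  have meas: "measure lebesgue (ccube y \<rho>) = m"
    using measure_lebesgue_ccube[of \<rho> y] assms(1) by (simp add: m_def)
  have "(LINT z:ccube y \<rho>|lebesgue. b z - ?c) = (LINT z:ccube y \<rho>|lebesgue. b z) - (LINT z:ccube y \<rho>|lebesgue. ?c)"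
    by (intro set_integral_diff set_integrable_ccube set_integrable_const)
  also have "(LINT z:ccube y \<rho>|lebesgue. ?c) = m *\<^sub>R ?c"
    using meas integral_scaleR_left[of ?c lebesgue "indicator (ccube y \<rho>)"] integrable_indicator_ccube[of y \<rho>]
    by (simp add: set_lebesgue_integral_def)
  finally have "avg y \<rho> - ?c = (LINT z:ccube y \<rho>|lebesgue. b z - ?c) /\<^sub>R m"
    using m meas unfolding avg_def[of y] average_def by (simp add: scaleR_diff_right)
  then have "norm (avg y \<rho> - ?c) = norm (LINT z:ccube y \<rho>|lebesgue. b z - ?c) / m"
    using m by (simp add: divide_inverse mult.commute)
  also have "\<dots> \<le> (L * r powr \<beta> * (2 * r) ^ CARD('n)) / m"
  proof (rule divide_right_mono)
    have "norm (LINT z:ccube y \<rho>|lebesgue. b z - ?c) \<le> (LINT z:ccube y \<rho>|lebesgue. norm (b z - ?c))"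
      by (rule set_integral_norm_bound[OF set_integrable_diff])
    also have "\<dots> \<le> (LINT z:ccube x r|lebesgue. norm (b z - ?c))"
      unfolding set_lebesgue_integral_def
      using sub set_integrable_norm_diff[unfolded set_integrable_def]
      by (intro integral_mono) (auto simp: indicator_def)
    also have "\<dots> \<le> L * r powr \<beta> * (2 * r) ^ CARD('n)"
      using oscillation[OF assms(2)] by (simp add: avg_def)
    finally show "norm (LINT z:ccube y \<rho>|lebesgue. b z - ?c) \<le> L * r powr \<beta> * (2 * r) ^ CARD('n)" .
  qed (use m in auto)
  also have "\<dots> = (r / \<rho>) ^ CARD('n) * L * r powr \<beta>"
    using assms by (simp add: m_def power_mult_distrib power_divide)
  finally show ?thesis .
qed

definition halving_const where "halving_const = 2 ^ CARD('n) * L"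
definition chain_const where "chain_const = halving_const / (1 - (1/2) powr \<beta>)"

lemma half_powr: "0 < (1/2) powr \<beta>" "(1/2) powr \<beta> < (1::real)"
  using powr_less_1_of_less_1[of "1/2" \<beta>] \<beta> by auto

lemma halving_const: "0 \<le> halving_const" and chain_const: "0 \<le> chain_const" "halving_const \<le> chain_const" "halving_const = chain_const - chain_const * (1/2) powr \<beta>"
proof -
  show halving_const: "0 \<le> halving_const" using L by (simp add: halving_const_def)
  then show "0 \<le> chain_const" using half_powr by (simp add: chain_const_def)
  show 1: "halving_const = chain_const - chain_const * (1/2) powr \<beta>"
  proof -
    have "halving_const = chain_const * (1 - (1/2) powr \<beta>)" using half_powr(2) \<beta> by (simp add: chain_const_def)
    then show ?thesis by (simp only: right_diff_distrib mult_1_right)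
  qed
  then show "halving_const \<le> chain_const" using \<open>0 \<le> chain_const\<close> half_powr by (metis diff_ge_0_iff_ge diff_le_eq le_add_same_cancel1 less_imp_le mult_nonneg_nonneg)
qed

lemma avg_compare_2:
  assumes "0 < \<rho>" "r \<le> 2 * \<rho>" "ccube y \<rho> \<subseteq> ccube x r" "0 < r"
  shows "norm (avg y \<rho> - avg x r) \<le> halving_const * r powr \<beta>"
proof -
  have "norm (avg y \<rho> - avg x r) \<le> (r / \<rho>) ^ CARD('n) * L * r powr \<beta>"
    using assms by (intro avg_compare) auto
  also have "\<dots> \<le> 2 ^ CARD('n) * L * r powr \<beta>"
    using assms L by (intro mult_right_mono power_mono) (auto simp: field_simps)
  finally show ?thesis by (simp add: halving_const_def)
qed

text \<open>Halve the larger cube until the smaller one is reached within a factor of two. The errors form a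
geometric series with ratio \<open>2 powr -\<beta>\<close>, and \<open>chain_const\<close> is its sum.\<close>
lemma avg_concentric_aux:
  "0 < r \<Longrightarrow> r / 2 ^ m \<le> \<rho> \<Longrightarrow> \<rho> \<le> r \<Longrightarrow> norm (avg x \<rho> - avg x r) \<le> chain_const * r powr \<beta>"
proof (induction m arbitrary: r)
  case 0
  then show ?case using chain_const by simp
next
  case (Suc m)
  have \<rho>: "0 < \<rho>" using Suc.prems(1,2) by (smt (verit) divide_pos_pos zero_less_power)
  show ?case
  proof (cases "r / 2 \<le> \<rho>")
    case True
    have "norm (avg x \<rho> - avg x r) \<le> halving_const * r powr \<beta>"
      using Suc.prems \<rho> True by (intro avg_compare_2 ccube_mono) auto
    also have "\<dots> \<le> chain_const * r powr \<beta>" using chain_const by (intro mult_right_mono) auto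
    finally show ?thesis .
  next
    case False
    have 1: "norm (avg x \<rho> - avg x (r/2)) \<le> chain_const * (r/2) powr \<beta>"
      using Suc.prems False by (intro Suc.IH) (auto simp: field_simps)
    have 2: "norm (avg x (r/2) - avg x r) \<le> halving_const * r powr \<beta>"
      using Suc.prems by (intro avg_compare_2 ccube_mono) auto
    have "norm (avg x \<rho> - avg x r) \<le> chain_const * (r/2) powr \<beta> + halving_const * r powr \<beta>"
      using norm_triangle_le[OF add_mono[OF 1 2]] by simp
    also have "(r/2) powr \<beta> = (1/2) powr \<beta> * r powr \<beta>"
      using powr_mult[of "1/2" r \<beta>] by simp
    also have "chain_const * ((1/2) powr \<beta> * r powr \<beta>) + halving_const * r powr \<beta> = chain_const * r powr \<beta>"
      by (subst chain_const(3)) (simp add: algebra_simps)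
    finally show ?thesis .
  qed
qed

lemma avg_concentric:
  assumes "0 < \<rho>" "\<rho> \<le> r"
  shows "norm (avg x \<rho> - avg x r) \<le> chain_const * r powr \<beta>"
proof -
  obtain m :: nat where "r / \<rho> < 2 ^ m" using real_arch_pow[of 2 "r / \<rho>"] by auto
  then show ?thesis using assms by (intro avg_concentric_aux[of r m]) (auto simp: field_simps)
qed

text \<open>The averages converge at every point, at a rate that does not depend on the point; so their limit is
Hoelder continuous before anything is known about its relation to \<open>b\<close>.\<close>
definition rep where "rep x = lim (\<lambda>k. avg x (1 / 2 ^ k))"

lemma avg_tendsto: "(\<lambda>k. avg x (1 / 2 ^ k)) \<longlonglongrightarrow> rep x"
proof -
  have small: "(\<lambda>k. chain_const * (1 / 2 ^ k) powr \<beta>) \<longlonglongrightarrow> 0"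
  proof -
    have "(\<lambda>k. chain_const * ((1/2) powr \<beta>) ^ k) \<longlonglongrightarrow> chain_const * 0"
      using half_powr by (intro tendsto_mult_left LIMSEQ_realpow_zero) auto
    moreover have "((1/2) powr \<beta>) ^ k = (1 / 2 ^ k) powr \<beta>" for k :: nat
      by (simp add: powr_realpow[symmetric] powr_powr powr_divide mult.commute power_one_over[symmetric] powr_power)
    ultimately show ?thesis by simp
  qed
  have "Cauchy (\<lambda>k. avg x (1 / 2 ^ k))"
  proof (rule metric_CauchyI)
    fix e :: real assume "0 < e"
    then obtain N where N: "chain_const * (1 / 2 ^ N) powr \<beta> < e / 2"
      using order_tendstoD(2)[OF small, of "e/2"] by (auto simp: eventually_sequentially)
    have d: "dist (avg x (1 / 2 ^ k)) (avg x (1 / 2 ^ N)) < e / 2" if "N \<le> k" for k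
      using avg_concentric[of "1 / 2 ^ k" "1 / 2 ^ N" x] that N
      by (auto simp: dist_norm field_simps)
    show "\<exists>M. \<forall>m\<ge>M. \<forall>n\<ge>M. dist (avg x (1 / 2 ^ m)) (avg x (1 / 2 ^ n)) < e"
      using d dist_triangle_half_l by (metis dist_commute)
  qed
  then show ?thesis unfolding rep_def by (simp add: Cauchy_convergent_iff convergent_LIMSEQ_iff)
qed

lemma rep_avg:
  assumes "0 < r" shows "norm (rep x - avg x r) \<le> chain_const * r powr \<beta>"
proof (rule tendsto_upperbound)
  show "(\<lambda>k. norm (avg x (1 / 2 ^ k) - avg x r)) \<longlonglongrightarrow> norm (rep x - avg x r)"
    by (intro tendsto_intros avg_tendsto)
  have "(\<lambda>k. (1/2::real) ^ k) \<longlonglongrightarrow> 0" by (intro LIMSEQ_realpow_zero) auto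
  then have "eventually (\<lambda>k. (1/2) ^ k < r) sequentially" by (rule order_tendstoD(2)) (rule assms)
  then show "eventually (\<lambda>k. norm (avg x (1 / 2 ^ k) - avg x r) \<le> chain_const * r powr \<beta>) sequentially"
    by eventually_elim (intro avg_concentric, auto simp: power_one_over)
qed simp

definition holder_const where "holder_const = (chain_const + halving_const + chain_const) * 2 powr \<beta>"

lemma holder_const: "0 \<le> holder_const" using halving_const chain_const by (simp add: holder_const_def)

text \<open>Pass from \<open>x\<close> to \<open>y\<close> through the averages over the nested cubes \<open>Q(x,\<rho>)\<close> and \<open>Q(y,2\<rho>)\<close>, where
\<open>\<rho> = |x - y|\<close>.\<close>
lemma rep_holder: "norm (rep x - rep y) \<le> holder_const * norm (x - y) powr \<beta>"
proof (cases "x = y")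
  case False
  define \<rho> where "\<rho> = norm (x - y)"
  have \<rho>: "0 < \<rho>" using False by (simp add: \<rho>_def)
  have sub: "ccube x \<rho> \<subseteq> ccube y (2 * \<rho>)"
    by (rule ccube_subset[OF in_ccube_norm]) (auto simp: \<rho>_def)
  have 1: "norm (rep x - avg x \<rho>) \<le> chain_const * (2 * \<rho>) powr \<beta>"
    using rep_avg[OF \<rho>, of x] \<rho> \<beta> chain_const(1)
    by (elim order_trans) (intro mult_left_mono powr_mono2, auto)
  have 2: "norm (avg x \<rho> - avg y (2 * \<rho>)) \<le> halving_const * (2 * \<rho>) powr \<beta>"
    using \<rho> sub by (intro avg_compare_2) auto
  have 3: "norm (avg y (2 * \<rho>) - rep y) \<le> chain_const * (2 * \<rho>) powr \<beta>"
    using rep_avg[of "2 * \<rho>" y] \<rho> by (simp add: norm_minus_commute)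
  have "rep x - rep y = (rep x - avg x \<rho>) + (avg x \<rho> - avg y (2 * \<rho>)) + (avg y (2 * \<rho>) - rep y)" by simp
  then have "norm (rep x - rep y) \<le> chain_const * (2 * \<rho>) powr \<beta> + halving_const * (2 * \<rho>) powr \<beta> + chain_const * (2 * \<rho>) powr \<beta>"
    using norm_add_rule_thm[OF norm_add_rule_thm[OF 1 2] 3] by simp
  also have "\<dots> = (chain_const + halving_const + chain_const) * (2 * \<rho>) powr \<beta>" by (simp only: distrib_right)
  also have "\<dots> = holder_const * norm (x - y) powr \<beta>" by (simp add: holder_const_def powr_mult \<rho>_def)
  finally show ?thesis .
qed (use holder_const in simp)

lemma rep_continuous: "continuous_on UNIV rep"
proof -
  have "isCont rep x" for x
  proof -
    have "((\<lambda>y. holder_const * norm (y - x) powr \<beta>) \<longlongrightarrow> holder_const * norm (x - x) powr \<beta>) (at x)"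
      using \<beta> by (intro tendsto_intros tendsto_powr') auto
    then have "((\<lambda>y. holder_const * norm (y - x) powr \<beta>) \<longlongrightarrow> 0) (at x)" by simp
    then have "((\<lambda>y. rep y - rep x) \<longlongrightarrow> 0) (at x)"
      by (rule Lim_null_comparison[rotated]) (auto intro!: always_eventually rep_holder)
    then show ?thesis unfolding isCont_def by (simp add: LIM_zero_iff)
  qed
  then show ?thesis by (simp add: continuous_at_imp_continuous_on)
qed

lemma rep_measurable [measurable]: "rep \<in> borel_measurable borel"
  by (intro borel_measurable_continuous_onI rep_continuous)

definition osc_const where "osc_const = L + halving_const * 2 powr \<beta> + chain_const * 2 powr \<beta>"

text \<open>On a small cube both \<open>b\<close> and \<open>rep\<close> are close to the average of \<open>b\<close>, the former in the mean.\<close>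
lemma oscillation_rep:
  assumes r: "0 < r"
  shows "(\<integral>\<^sup>+z. ennreal (norm (b z - rep z)) * indicator (ccube a r) z \<partial>lebesgue)
     \<le> ennreal (osc_const * r powr \<beta> * (2 * r) ^ CARD('n))"
proof -
  define G where "G = (halving_const * 2 powr \<beta> + chain_const * 2 powr \<beta>) * r powr \<beta>"
  have G: "0 \<le> G" using halving_const chain_const by (simp add: G_def)
  have pt: "norm (b z - rep z) \<le> norm (b z - avg a r) + G" if "z \<in> ccube a r" for z
  proof -
    have sub: "ccube a r \<subseteq> ccube z (2 * r)"
      using that by (intro ccube_subset) (auto simp: ccube_sym)
    have 2: "norm (avg a r - avg z (2 * r)) \<le> halving_const * (2 * r) powr \<beta>"
      using r sub by (intro avg_compare_2) auto
    have 3: "norm (avg z (2 * r) - rep z) \<le> chain_const * (2 * r) powr \<beta>"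
      using rep_avg[of "2 * r" z] r by (simp add: norm_minus_commute)
    have "norm (b z - rep z) \<le> norm (b z - avg a r) + (halving_const * (2 * r) powr \<beta> + chain_const * (2 * r) powr \<beta>)"
      using norm_add_rule_thm[OF order_refl[of "norm (b z - avg a r)"] norm_add_rule_thm[OF 2 3]] by simp
    also have "halving_const * (2 * r) powr \<beta> + chain_const * (2 * r) powr \<beta> = G"
      by (simp add: G_def powr_mult distrib_right)
    finally show ?thesis .
  qed
  let ?i = "\<lambda>z. indicator (ccube a r) z * norm (b z - avg a r) + G * indicator (ccube a r) z"
  have int: "integrable lebesgue (\<lambda>z. indicator (ccube a r) z * norm (b z - avg a r))"
    using set_integrable_norm_diff[of a r "avg a r"] by (simp add: set_integrable_def)
  have int2: "integrable lebesgue (indicator (ccube a r) :: _ \<Rightarrow> real)"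
    using emeasure_ccube[of r a] r by (simp add: integrable_indicator_iff)
  have "(\<integral>\<^sup>+z. ennreal (norm (b z - rep z)) * indicator (ccube a r) z \<partial>lebesgue) \<le> (\<integral>\<^sup>+z. ennreal (?i z) \<partial>lebesgue)"
    using pt by (intro nn_integral_mono) (auto simp: indicator_def intro!: ennreal_leI)
  also have "\<dots> = ennreal (integral\<^sup>L lebesgue ?i)"
    using G int int2 by (intro nn_integral_eq_integral) auto
  also have "integral\<^sup>L lebesgue ?i = (LINT z:ccube a r|lebesgue. norm (b z - avg a r)) + G * (2 * r) ^ CARD('n)"
    using int int2 measure_ccube[of r a] r
    by (simp add: set_lebesgue_integral_def)
  also have "\<dots> \<le> L * r powr \<beta> * (2 * r) ^ CARD('n) + G * (2 * r) ^ CARD('n)"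
    using oscillation[OF r, of a] by (simp add: avg_def)
  also have "\<dots> = osc_const * r powr \<beta> * (2 * r) ^ CARD('n)" by (simp add: osc_const_def G_def algebra_simps)
  finally show ?thesis by (simp add: ennreal_leI)
qed

text \<open>The mean of \<open>|b - rep|\<close> over every cube of half side \<open>r\<close> is at most a multiple of \<open>r powr \<beta>\<close>. Integrate
these means over all centres in a large cube: by Tonelli's theorem the result is at least the
integral of \<open>|b - rep|\<close> over a slightly smaller cube, which therefore vanishes as \<open>r\<close> tends to \<open>0\<close>. This
takes the place of the Lebesgue differentiation theorem.\<close>
lemma AE_eq_rep: "AE x in lebesgue. b x = rep x"
proof -
  have b [measurable]: "b \<in> borel_measurable lebesgue"
    by (rule locally_integrable_imp_measurable[OF locally_integrable])
  have [measurable]: "rep \<in> borel_measurable lebesgue" by (rule measurable_completion) simp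
  have "(\<lambda>z. ennreal (norm (b z - rep z))) \<in> borel_measurable lebesgue" by measurable
  then obtain g where g [measurable]: "g \<in> borel_measurable lborel"
    and g_eq: "AE z in lborel. ennreal (norm (b z - rep z)) = g z"
    using completion_ex_borel_measurable by blast
  have osc: "(\<integral>\<^sup>+z. g z * indicator (ccube a r) z \<partial>lborel) \<le> ennreal (osc_const * r powr \<beta> * (2 * r) ^ CARD('n))"
    if "0 < r" for a r
  proof -
    have "(\<integral>\<^sup>+z. g z * indicator (ccube a r) z \<partial>lborel) = (\<integral>\<^sup>+z. ennreal (norm (b z - rep z)) * indicator (ccube a r) z \<partial>lborel)"
      using g_eq by (intro nn_integral_cong_AE) (auto elim!: eventually_mono)
    also have "\<dots> = (\<integral>\<^sup>+z. ennreal (norm (b z - rep z)) * indicator (ccube a r) z \<partial>lebesgue)"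
      by (simp add: nn_integral_completion)
    finally show ?thesis using oscillation_rep[OF that] by simp
  qed
  have small: "(\<integral>\<^sup>+z. g z * indicator (ccube 0 R) z \<partial>lborel) \<le> ennreal (osc_const * (2 * (R + 1)) ^ CARD('n) * r powr \<beta>)"
    if r: "0 < r" "r \<le> 1" and R: "0 < R" for r R
  proof -
    define m where "m = (2 * r) ^ CARD('n)"
    have m: "0 < m" using r by (simp add: m_def)
    have D0: "0 \<le> osc_const" using L halving_const chain_const by (simp add: osc_const_def)
    \<comment> \<open>Integrated first in the centre \<open>a\<close>, this counts each \<open>z\<close> of the smaller cube with the volume \<open>m\<close>.\<close>
    let ?k = "\<lambda>a z. indicator (ccube 0 (R + 1)) a * (g z * indicator (ccube a r) z)"
    have joint [measurable]: "(\<lambda>p. ?k (fst p) (snd p)) \<in> borel_measurable (lborel \<Otimes>\<^sub>M lborel)"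
      by measurable
    have "ennreal m * (\<integral>\<^sup>+z. g z * indicator (ccube 0 R) z \<partial>lborel) = (\<integral>\<^sup>+z. (g z * indicator (ccube 0 R) z) * ennreal m \<partial>lborel)"
      by (subst nn_integral_multc) (simp_all add: mult.commute)
    also have "\<dots> \<le> (\<integral>\<^sup>+z. \<integral>\<^sup>+a. ?k a z \<partial>lborel \<partial>lborel)"
    proof (rule nn_integral_mono)
      fix z
      show "(g z * indicator (ccube 0 R) z) * ennreal m \<le> (\<integral>\<^sup>+a. ?k a z \<partial>lborel)"
      proof (cases "z \<in> ccube 0 R")
        case True
        then have sub: "ccube z r \<subseteq> ccube 0 (R + 1)" using r by (intro ccube_subset) auto
        have "g z * ennreal m = (\<integral>\<^sup>+a. g z * indicator (ccube z r) a \<partial>lborel)"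
          using emeasure_ccube[of r z] r by (simp add: nn_integral_cmult_indicator m_def)
        also have "\<dots> \<le> (\<integral>\<^sup>+a. ?k a z \<partial>lborel)"
          using sub by (intro nn_integral_mono) (auto simp: indicator_def ccube_sym[of z])
        finally show ?thesis using True by simp
      qed simp
    qed
    also have "\<dots> = (\<integral>\<^sup>+a. \<integral>\<^sup>+z. ?k a z \<partial>lborel \<partial>lborel)"
      using lborel_pair.Fubini[of "\<lambda>p. ?k (fst p) (snd p)"] joint by simp
    also have "\<dots> \<le> (\<integral>\<^sup>+a. ennreal (osc_const * r powr \<beta> * m) * indicator (ccube (0::real^'n) (R + 1)) a \<partial>lborel)"
    proof (rule nn_integral_mono)
      fix a
      have "(\<integral>\<^sup>+z. ?k a z \<partial>lborel) = indicator (ccube 0 (R + 1)) a * (\<integral>\<^sup>+z. g z * indicator (ccube a r) z \<partial>lborel)"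
        by (intro nn_integral_cmult) measurable
      also have "\<dots> \<le> indicator (ccube 0 (R + 1)) a * ennreal (osc_const * r powr \<beta> * m)"
        using r unfolding m_def by (intro mult_left_mono osc) auto
      finally show "(\<integral>\<^sup>+z. ?k a z \<partial>lborel) \<le> ennreal (osc_const * r powr \<beta> * m) * indicator (ccube 0 (R + 1)) a"
        by (simp only: mult.commute)
    qed
    also have "\<dots> = ennreal (osc_const * r powr \<beta> * m) * ennreal ((2 * (R + 1)) ^ CARD('n))"
      using emeasure_ccube[of "R + 1" "0 :: real^'n"] R by (simp add: nn_integral_cmult_indicator)
    also have "\<dots> = ennreal m * ennreal (osc_const * (2 * (R + 1)) ^ CARD('n) * r powr \<beta>)"
      using D0 R m by (simp add: ennreal_mult[symmetric] mult_ac)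
    finally show ?thesis using m by (simp add: ennreal_mult_le_mult_iff)
  qed
  have zero: "(\<integral>\<^sup>+z. g z * indicator (ccube 0 R) z \<partial>lborel) = 0" if R: "0 < R" for R
  proof -
    let ?X = "\<lambda>k. ennreal (osc_const * (2 * (R + 1)) ^ CARD('n) * (1 / real (Suc k)) powr \<beta>)"
    have "(\<lambda>k. osc_const * (2 * (R + 1)) ^ CARD('n) * (1 / real (Suc k)) powr \<beta>) \<longlonglongrightarrow> osc_const * (2 * (R + 1)) ^ CARD('n) * 0 powr \<beta>"
      using \<beta> LIMSEQ_inverse_real_of_nat
      by (intro tendsto_mult_left tendsto_powr') (auto simp: inverse_eq_divide)
    then have "?X \<longlonglongrightarrow> ennreal 0" using \<beta> by (intro tendsto_ennrealI) simp
    then have "(\<integral>\<^sup>+z. g z * indicator (ccube 0 R) z \<partial>lborel) \<le> ennreal 0"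
      by (rule LIMSEQ_le_const) (intro exI[of _ 0] allI impI small R, auto)
    then show ?thesis by simp
  qed
  have "AE z in lborel. g z * indicator (ccube 0 (real (Suc k))) z = 0" for k
  proof -
    have "(\<integral>\<^sup>+z. g z * indicator (ccube 0 (real (Suc k))) z \<partial>lborel) = 0" by (rule zero) simp
    then show ?thesis by (subst (asm) nn_integral_0_iff_AE) auto
  qed
  then have "AE z in lborel. \<forall>k. g z * indicator (ccube 0 (real (Suc k))) z = 0"
    by (simp only: AE_all_countable) blast
  with g_eq have "AE z in lborel. b z = rep z"
  proof eventually_elim
    case (elim z)
    obtain k where "norm z \<le> real k" using real_arch_simple by blast
    then have "z \<in> ccube 0 (real (Suc k))" by (intro in_ccube_norm) simp
    then have "g z = 0" using elim(2) by (auto dest!: spec[of _ k])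
    then show ?case using elim(1) by simp
  qed
  then show ?thesis by (simp add: AE_lebesgue_iff)
qed

end

text \<open>The theorem of Campanato and Meyers.\<close>
theorem Lip_Holder_representative:
  fixes b :: "real^'n \<Rightarrow> complex"
  assumes b: "b \<in> Lip \<beta>" and \<beta>: "0 < \<beta>"
  obtains b' H where "0 \<le> H" "\<And>x y. norm (b' x - b' y) \<le> H * norm (x - y) powr \<beta>"
    "b' \<in> borel_measurable borel" "AE x in lebesgue. b x = b' x"
proof -
  define L where "L = enn2real (Lip_norm \<beta> b)"
  have fin: "Lip_norm \<beta> b = ennreal L" and L: "0 \<le> L"
    using b by (auto simp: Lip_def L_def less_top)
  interpret campanato b \<beta> "L * 2 powr \<beta>"
  proof
    show "locally_integrable b" using b by (simp add: Lip_def)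
    show "0 < \<beta>" by fact
    show "0 \<le> L * 2 powr \<beta>" using L by simp
    fix x :: "real^'n" and r :: real assume r: "0 < r"
    let ?Q = "ccube x r"
    define J where "J = (LINT z:?Q|lebesgue. norm (b z - average ?Q b))"
    have meas: "measure lebesgue ?Q = (2 * r) ^ CARD('n)"
      using measure_lebesgue_ccube[of r x] r by simp
    have pw: "measure lebesgue ?Q powr (\<beta> / real CARD('n)) = (2 * r) powr \<beta>"
    proof -
      have "0 < 2 * r" using r by simp
      then show ?thesis unfolding meas by (subst powr_realpow[symmetric]) (simp_all only: powr_powr, simp)
    qed
    have "ennreal (1 / measure lebesgue ?Q powr (\<beta> / real CARD('n)) *
              average ?Q (\<lambda>x. norm (b x - average ?Q b))) \<le> Lip_norm \<beta> b"
      unfolding Lip_norm_def by (rule SUP_upper[OF ccube_in_cubes[OF r]])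
    then have "1 / (2 * r) powr \<beta> * (J / (2 * r) ^ CARD('n)) \<le> L"
      unfolding fin pw using L
      by (simp add: ennreal_le_iff average_def[of ?Q "\<lambda>x. norm (b x - average ?Q b)"] meas J_def divide_inverse mult.commute)
    then have "J \<le> L * (2 * r) powr \<beta> * (2 * r) ^ CARD('n)"
      using r by (simp add: field_simps)
    then show "J \<le> L * 2 powr \<beta> * r powr \<beta> * (2 * r) ^ CARD('n)"
      using powr_mult[of 2 r \<beta>] by (simp add: mult.assoc)
  qed
  show thesis
    using that[OF holder_const rep_holder rep_measurable AE_eq_rep] .
qed

section \<open>Borel representatives of \<open>A\<^sub>1\<close> weights\<close>

lemma lebesgue_measurable_cong_AE:
  fixes f g :: "real^'n \<Rightarrow> 'b::topological_space"
  assumes g: "g \<in> borel_measurable lebesgue" and ae: "AE x in lebesgue. f x = g x"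
  shows "f \<in> borel_measurable lebesgue"
proof (rule measurableI)
  fix S :: "'b set" assume S: "S \<in> sets borel"
  show "f -` S \<inter> space lebesgue \<in> sets lebesgue"
  proof (rule completion.in_sets_AE)
    show "AE x in lebesgue. (x \<in> g -` S \<inter> space lebesgue) = (x \<in> f -` S \<inter> space lebesgue)"
      using ae by eventually_elim simp
    show "g -` S \<inter> space lebesgue \<in> sets lebesgue" using g S by (rule measurable_sets)
  qed simp
qed simp

lemma lebesgue_ex_borel_complex:
  fixes g :: "real^'n \<Rightarrow> complex"
  assumes g: "g \<in> borel_measurable lebesgue"
  obtains h where "h \<in> borel_measurable borel" "AE x in lebesgue. g x = h x"
proof -
  have ReIm: "Re \<in> borel_measurable borel" "Im \<in> borel_measurable borel"
    by (intro borel_measurable_continuous_onI continuous_intros)+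
  have "(\<lambda>x. Re (g x)) \<in> borel_measurable lebesgue" "(\<lambda>x. Im (g x)) \<in> borel_measurable lebesgue"
    by (rule measurable_compose[OF g ReIm(1)], rule measurable_compose[OF g ReIm(2)])
  note Re_Im = completion_ex_borel_measurable_real[OF this(1)] completion_ex_borel_measurable_real[OF this(2)]
  obtain u where u: "u \<in> borel_measurable lborel" "AE x in lborel. Re (g x) = u x"
    using Re_Im(1) by (elim bexE)
  obtain v where v: "v \<in> borel_measurable lborel" "AE x in lborel. Im (g x) = v x"
    using Re_Im(2) by (elim bexE)
  have [measurable]: "u \<in> borel_measurable borel" "v \<in> borel_measurable borel" using u v by auto
  show thesis
  proof (rule that)
    show "(\<lambda>x. complex_of_real (u x) + \<i> * complex_of_real (v x)) \<in> borel_measurable borel" by measurable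
    show "AE x in lebesgue. g x = complex_of_real (u x) + \<i> * complex_of_real (v x)"
      unfolding AE_lebesgue_iff using u(2) v(2) by eventually_elim (simp add: complex_eq_iff)
  qed
qed

lemma nn_integral_lebesgue: "(\<integral>\<^sup>+x. f x \<partial>lebesgue) = (\<integral>\<^sup>+x. f x \<partial>lborel)"
  by (rule nn_integral_completion)

text \<open>The essential infimum bounds the weight from below almost everywhere. It is not negative, so the
constant may be replaced by its positive part.\<close>
lemma A1_average:
  fixes v :: "real^'n \<Rightarrow> real"
  assumes "A1 v"
  obtains C where "0 \<le> C" "\<And>Q. Q \<in> cubes \<Longrightarrow> AE x in lebesgue. x \<in> Q \<longrightarrow> average Q v \<le> C * v x"
proof -
  have int: "locally_integrable v" and pos: "AE x in lebesgue. 0 < v x" using assms by (auto simp: A1_def weight_def)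
  have meas: "v \<in> borel_measurable lebesgue" by (rule locally_integrable_imp_measurable[OF int])
  obtain C where C: "\<And>Q. Q \<in> cubes \<Longrightarrow> ereal (average Q v) \<le> ereal C * essinf_on Q v"
    using assms by (auto simp: A1_def)
  show thesis
  proof (rule that[of "max C 0"])
    fix Q :: "(real^'n) set" assume Q: "Q \<in> cubes"
    have Qm: "Q \<in> sets lebesgue" using Q by (auto simp: cubes_def)
    let ?f = "\<lambda>x. - ereal (v x)"
    have f: "?f \<in> borel_measurable (lebesgue_on Q)"
      using meas by (intro borel_measurable_uminus_ereal borel_measurable_ereal measurable_restrict_space1)
    have ae: "(AE x in lebesgue_on Q. P x) \<longleftrightarrow> (AE x in lebesgue. x \<in> Q \<longrightarrow> P x)" for P
      using Qm by (intro AE_restrict_space_iff) auto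
    have "AE x in lebesgue_on Q. ?f x \<le> 0"
      unfolding ae using pos by eventually_elim (auto simp: zero_ereal_def)
    then have "esssup (lebesgue_on Q) ?f \<le> 0"
      unfolding esssup_def if_P[OF f] by (rule Limsup_bounded)
    then have "0 \<le> essinf_on Q v" unfolding essinf_on_def by (simp add: ereal_uminus_le_reorder)
    then have le: "ereal (average Q v) \<le> ereal (max C 0) * essinf_on Q v"
      using C[OF Q] by (elim order_trans) (intro ereal_mult_right_mono, auto)
    have "AE x in lebesgue_on Q. ?f x \<le> esssup (lebesgue_on Q) ?f" by (rule esssup_AE)
    then show "AE x in lebesgue. x \<in> Q \<longrightarrow> average Q v \<le> max C 0 * v x"
      unfolding ae
    proof eventually_elim
      case (elim x)
      show ?case
      proof
        assume "x \<in> Q"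
        then have "essinf_on Q v \<le> ereal (v x)" using elim unfolding essinf_on_def
          by (simp add: ereal_uminus_le_reorder)
        then have "ereal (max C 0) * essinf_on Q v \<le> ereal (max C 0) * ereal (v x)"
          by (intro ereal_mult_left_mono) (auto simp: max_def)
        with le have "ereal (average Q v) \<le> ereal (max C 0) * ereal (v x)" by (rule order_trans)
        then show "average Q v \<le> max C 0 * v x" by (simp only: times_ereal.simps ereal_less_eq)
      qed
    qed
  qed simp
qed

text \<open>Cubes with rational half side and centre in a countable dense set need only one null set, and every
cube of half side \<open>r\<close> is contained in one of them of half side at most \<open>3 r\<close>.\<close>
lemma A1_weight_intro:
  fixes v :: "real^'n \<Rightarrow> real"
  assumes meas: "v \<in> borel_measurable borel" and pos: "\<And>x. 0 < v x"
    and int: "\<And>x r. set_integrable lborel (ccube x r) v" and C: "0 \<le> C"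
    and avg: "\<And>x r. 0 < r \<Longrightarrow> AE y in lborel. y \<in> ccube x r \<longrightarrow> mass v x r \<le> C * (2 * r) ^ CARD('n) * v y"
  shows "A1_weight v (C * 6 ^ CARD('n))"
proof
  show "v \<in> borel_measurable borel" by fact
  show "\<And>x. 0 < v x" by fact
  show "\<And>x r. set_integrable lborel (ccube x r) v" by fact
  obtain X :: "(real^'n) set" where X: "countable X" "\<And>U. open U \<Longrightarrow> U \<noteq> {} \<Longrightarrow> \<exists>d\<in>X. d \<in> U"
    by (rule countable_dense_setE) blast
  have "AE y in lborel. \<forall>q\<in>X. \<forall>\<rho>\<in>(\<rat>::real set). 0 < \<rho> \<longrightarrow> y \<in> ccube q \<rho> \<longrightarrow> mass v q \<rho> \<le> C * (2 * \<rho>) ^ CARD('n) * v y"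
  proof (intro AE_ball_countable' X(1) countable_rat)
    fix q and \<rho> :: real
    show "AE y in lborel. 0 < \<rho> \<longrightarrow> y \<in> ccube q \<rho> \<longrightarrow> mass v q \<rho> \<le> C * (2 * \<rho>) ^ CARD('n) * v y"
      using avg[of \<rho> q] by (cases "0 < \<rho>") auto
  qed
  then show "AE y in lborel. \<forall>x r. 0 < r \<longrightarrow> y \<in> ccube x r \<longrightarrow> mass v x r \<le> C * 6 ^ CARD('n) * r ^ CARD('n) * v y"
  proof eventually_elim
    case (elim y)
    show ?case
    proof (intro allI impI)
      fix x and r :: real assume r: "0 < r" and y: "y \<in> ccube x r"
      obtain q where q: "q \<in> X" "q \<in> ball x r" using X(2)[of "ball x r"] r by auto
      obtain \<rho> where \<rho>: "\<rho> \<in> \<rat>" "2 * r < \<rho>" "\<rho> < 3 * r" using Rats_dense_in_real[of "2 * r" "3 * r"] r by auto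
      have "x \<in> ccube q r" using q(2) by (intro in_ccube_norm) (simp add: dist_norm)
      then have sub: "ccube x r \<subseteq> ccube q \<rho>" using \<rho> by (intro ccube_subset) auto
      have "mass v x r \<le> mass v q \<rho>"
        unfolding mass_def set_lebesgue_integral_def
        using int sub by (intro integral_mono) (auto simp: set_integrable_def indicator_def less_imp_le pos)
      also have "\<dots> \<le> C * (2 * \<rho>) ^ CARD('n) * v y"
        using elim[rule_format, OF q(1) \<rho>(1)] sub y \<rho> r by auto
      also have "\<dots> \<le> C * (6 * r) ^ CARD('n) * v y"
        using \<rho> r C pos[of y] by (intro mult_right_mono mult_left_mono power_mono) auto
      finally show "mass v x r \<le> C * 6 ^ CARD('n) * r ^ CARD('n) * v y"
        by (simp add: power_mult_distrib mult.assoc)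
    qed
  qed
qed

lemma A1_imp_A1_weight:
  fixes u :: "real^'n \<Rightarrow> real"
  assumes "A1 u"
  obtains v A where "A1_weight v A" "AE x in lebesgue. u x = v x"
    "\<And>x r. mass v x r = (LINT z:ccube x r|lebesgue. u z)"
proof -
  have loc: "locally_integrable u" and pos: "AE x in lebesgue. 0 < u x" using assms by (auto simp: A1_def weight_def)
  have meas: "u \<in> borel_measurable lebesgue" by (rule locally_integrable_imp_measurable[OF loc])
  obtain v' where v': "v' \<in> borel_measurable lborel" "AE x in lborel. u x = v' x"
    using completion_ex_borel_measurable_real[OF meas] by auto
  have [measurable]: "v' \<in> borel_measurable borel" using v' by simp
  \<comment> \<open>On the null set where \<open>v'\<close> is not positive, any positive value will do.\<close>
  define v where "v x = (if 0 < v' x then v' x else 1)" for x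
  have v [measurable]: "v \<in> borel_measurable borel" unfolding v_def[abs_def] by measurable
  have vpos: "0 < v x" for x by (simp add: v_def)
  have eq: "AE x in lebesgue. u x = v x"
    using pos v'(2) unfolding AE_lebesgue_iff by eventually_elim (simp add: v_def)
  have ind: "(\<lambda>z. indicator (ccube x r) z *\<^sub>R v z) \<in> borel_measurable lborel" for x r by measurable
  have eqi: "AE z in lebesgue. indicator (ccube x r) z *\<^sub>R u z = indicator (ccube x r) z *\<^sub>R v z" for x r
    using eq by eventually_elim simp
  have mv: "(\<lambda>z. indicator (ccube x r) z *\<^sub>R v z) \<in> borel_measurable lebesgue" for x r
    using ind by (rule measurable_completion)
  have mu: "(\<lambda>z. indicator (ccube x r) z *\<^sub>R u z) \<in> borel_measurable lebesgue" for x r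
    by (rule lebesgue_measurable_cong_AE[OF mv eqi])
  have int: "set_integrable lborel (ccube x r) v" for x r
  proof -
    have "integrable lebesgue (\<lambda>z. indicator (ccube x r) z *\<^sub>R u z)"
      using loc compact_ccube unfolding locally_integrable_def set_integrable_def by blast
    then have "integrable lebesgue (\<lambda>z. indicator (ccube x r) z *\<^sub>R v z)"
      using integrable_cong_AE[OF mu mv eqi] by blast
    then show ?thesis unfolding set_integrable_def using integrable_completion[OF ind] by blast
  qed
  have mass: "mass v x r = (LINT z:ccube x r|lebesgue. u z)" for x r
  proof -
    have "(LINT z:ccube x r|lebesgue. u z) = (LINT z:ccube x r|lebesgue. v z)"
      unfolding set_lebesgue_integral_def by (rule integral_cong_AE[OF mu mv eqi])
    also have "\<dots> = mass v x r"
      unfolding set_lebesgue_integral_def mass_def by (rule integral_completion[OF ind])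
    finally show ?thesis ..
  qed
  obtain C where C: "0 \<le> C" "\<And>Q. Q \<in> cubes \<Longrightarrow> AE x in lebesgue. x \<in> Q \<longrightarrow> average Q u \<le> C * u x"
    by (rule A1_average[OF assms]) blast
  have "A1_weight v (C * 6 ^ CARD('n))"
  proof (rule A1_weight_intro[OF v vpos int C(1)])
    fix x :: "real^'n" and r :: real assume r: "0 < r"
    have "average (ccube x r) u = mass v x r / (2 * r) ^ CARD('n)"
      using r measure_lebesgue_ccube[of r x] unfolding average_def mass by (simp add: divide_inverse mult.commute)
    then have "mass v x r = average (ccube x r) u * (2 * r) ^ CARD('n)" using r by simp
    moreover have "AE y in lborel. y \<in> ccube x r \<longrightarrow> average (ccube x r) u \<le> C * v y"
      using C(2)[OF ccube_in_cubes[OF r], of x] eq unfolding AE_lebesgue_iff by eventually_elim auto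
    ultimately show "AE y in lborel. y \<in> ccube x r \<longrightarrow> mass v x r \<le> C * (2 * r) ^ CARD('n) * v y"
      using r by (auto elim!: eventually_mono simp: mult_ac intro!: mult_left_mono)
  qed
  then show thesis using that eq mass by blast
qed

section \<open>Principal values\<close>

text \<open>The regularity condition makes the kernel continuous away from the origin.\<close>
lemma kernel_measurable:
  fixes K :: "real^'n \<Rightarrow> complex"
  assumes reg: "\<And>x y. 2 * norm y \<le> norm x \<Longrightarrow> 0 < norm y \<Longrightarrow> norm (K (x - y) - K x) \<le> C * norm y / norm x ^ (CARD('n) + 1)"
  shows "K \<in> borel_measurable borel"
proof -
  have "isCont K x" if x: "x \<noteq> 0" for x
  proof -
    have "((\<lambda>z. C * norm (x - z) / norm x ^ (CARD('n) + 1)) \<longlongrightarrow> C * norm (x - x) / norm x ^ (CARD('n) + 1)) (at x)"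
      using x by (intro tendsto_intros) auto
    then have lim: "((\<lambda>z. C * norm (x - z) / norm x ^ (CARD('n) + 1)) \<longlongrightarrow> 0) (at x)" by simp
    have "((\<lambda>z. K z - K x) \<longlongrightarrow> 0) (at x)"
    proof (rule Lim_null_comparison[OF _ lim])
      have "eventually (\<lambda>z. dist z x < norm x / 2 \<and> z \<noteq> x) (at x)"
        using x by (auto simp: eventually_at intro!: exI[of _ "norm x / 2"])
      then show "eventually (\<lambda>z. norm (K z - K x) \<le> C * norm (x - z) / norm x ^ (CARD('n) + 1)) (at x)"
      proof eventually_elim
        case (elim z)
        then show ?case using reg[of "x - z" x] by (auto simp: dist_norm norm_minus_commute)
      qed
    qed
    then show ?thesis unfolding isCont_def by (simp add: LIM_zero_iff)
  qed
  then have "continuous_on (- {0}) K" by (intro continuous_at_imp_continuous_on) auto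
  then have "(\<lambda>x. indicator (- {0}) x *\<^sub>R K x) \<in> borel_measurable borel"
    by (intro borel_measurable_continuous_on_indicator) auto
  then have "(\<lambda>x. indicator (- {0}) x *\<^sub>R K x + indicator {0} x *\<^sub>R K 0) \<in> borel_measurable borel"
    by measurable
  also have "(\<lambda>x. indicator (- {0}) x *\<^sub>R K x + indicator {0} x *\<^sub>R K 0) = K"
    by (auto simp: fun_eq_iff indicator_def)
  finally show ?thesis .
qed

lemma far_set_measurable [measurable]: "{y :: real^'n. \<epsilon> < norm (x - y)} \<in> sets borel"
  by measurable

lemma truncated_integral_measurable:
  fixes K g :: "real^'n \<Rightarrow> complex"
  assumes K [measurable]: "K \<in> borel_measurable borel" and g: "g \<in> borel_measurable lebesgue"
  shows "(\<lambda>x. LINT y:{y. \<epsilon> < norm (x - y)}|lebesgue. K (x - y) * g y) \<in> borel_measurable borel"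
proof -
  obtain h where h [measurable]: "h \<in> borel_measurable borel" and gh: "AE x in lebesgue. g x = h x"
    using lebesgue_ex_borel_complex[OF g] by blast
  have eq: "(LINT y:{y. \<epsilon> < norm (x - y)}|lebesgue. K (x - y) * g y)
      = (LINT y|lborel. indicator {y. \<epsilon> < norm (x - y)} y *\<^sub>R (K (x - y) * h y))" for x
  proof -
    have m: "(\<lambda>y. indicator {y. \<epsilon> < norm (x - y)} y *\<^sub>R (K (x - y) * h y)) \<in> borel_measurable lborel"
      by measurable
    have ae: "AE y in lebesgue. indicator {y. \<epsilon> < norm (x - y)} y *\<^sub>R (K (x - y) * g y)
        = indicator {y. \<epsilon> < norm (x - y)} y *\<^sub>R (K (x - y) * h y)"
      using gh by eventually_elim simp
    have m': "(\<lambda>y. indicator {y. \<epsilon> < norm (x - y)} y *\<^sub>R (K (x - y) * h y)) \<in> borel_measurable lebesgue"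
      using m by (rule measurable_completion)
    have "(LINT y:{y. \<epsilon> < norm (x - y)}|lebesgue. K (x - y) * g y)
        = (LINT y|lebesgue. indicator {y. \<epsilon> < norm (x - y)} y *\<^sub>R (K (x - y) * h y))"
      unfolding set_lebesgue_integral_def
      by (rule integral_cong_AE[OF lebesgue_measurable_cong_AE[OF m' ae] m' ae])
    also have "\<dots> = (LINT y|lborel. indicator {y. \<epsilon> < norm (x - y)} y *\<^sub>R (K (x - y) * h y))"
      by (rule integral_completion[OF m])
    finally show ?thesis .
  qed
  have "(\<lambda>x. LINT y|lborel. indicator {p. \<epsilon> < norm (fst p - snd p)} (x, y) *\<^sub>R (K (x - y) * h y)) \<in> borel_measurable lborel"
  proof (rule lborel.borel_measurable_lebesgue_integral)
    show "(\<lambda>(x, y). indicator {p. \<epsilon> < norm (fst p - snd p)} (x, y) *\<^sub>R (K (x - y) * h y)) \<in> borel_measurable (lborel \<Otimes>\<^sub>M lborel)"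
    proof -
      have "open {p :: (real^'n) \<times> (real^'n). \<epsilon> < norm (fst p - snd p)}"
        by (intro open_Collect_less continuous_intros)
      then have [measurable]: "{p :: (real^'n) \<times> (real^'n). \<epsilon> < norm (fst p - snd p)} \<in> sets (lborel \<Otimes>\<^sub>M lborel)"
        unfolding lborel_prod by simp
      show ?thesis unfolding split_beta' by measurable
    qed
  qed
  then show ?thesis unfolding eq by (simp add: indicator_def)
qed

text \<open>Near a point of the ball of radius \<open>m - 1\<close>, the part of \<open>f\<close> outside the ball of radius \<open>m\<close> contributes to
all truncated integrals with \<open>\<epsilon> < 1\<close> the same constant; the part inside is integrable.\<close>
lemma has_pv_exists_AE:
  fixes K f :: "real^'n \<Rightarrow> complex"
  assumes ex: "\<And>f. integrable lebesgue f \<Longrightarrow> AE x in lebesgue. \<exists>l. has_pv K f x l"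
    and loc: "\<And>m::nat. set_integrable lebesgue (cball 0 (real m)) f"
    and far: "\<And>x \<epsilon>. 0 < \<epsilon> \<Longrightarrow> set_integrable lebesgue {y. \<epsilon> < norm (x - y)} (\<lambda>y. K (x - y) * f y)"
  shows "AE x in lebesgue. \<exists>l. has_pv K f x l"
proof -
  define g where "g m = (\<lambda>y. indicator (cball 0 (real m)) y *\<^sub>R f y)" for m :: nat
  have "AE x in lebesgue. \<forall>m. \<exists>l. has_pv K (g m) x l"
    unfolding AE_all_countable g_def using loc by (auto intro!: ex simp: set_integrable_def)
  then show ?thesis
  proof eventually_elim
    case (elim x)
    obtain m :: nat where m: "norm x + 1 \<le> real m" using real_arch_simple by blast
    obtain l where l: "has_pv K (g m) x l" using elim by blast
    let ?S = "\<lambda>\<epsilon>. {y. \<epsilon> < norm (x - y)}"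
    define c where "c = (LINT y:?S 1|lebesgue. K (x - y) * f y - K (x - y) * g m y)"
    have gint: "set_integrable lebesgue (?S \<epsilon>) (\<lambda>y. K (x - y) * g m y)" if "0 < \<epsilon>" for \<epsilon>
      using l that by (auto simp: has_pv_def)
    have split: "(LINT y:?S \<epsilon>|lebesgue. K (x - y) * f y) = (LINT y:?S \<epsilon>|lebesgue. K (x - y) * g m y) + c"
      if e: "0 < \<epsilon>" "\<epsilon> < 1" for \<epsilon>
    proof -
      have "(LINT y:?S \<epsilon>|lebesgue. K (x - y) * f y - K (x - y) * g m y) = c"
        unfolding c_def set_lebesgue_integral_def
      proof (rule Bochner_Integration.integral_cong[OF refl])
        fix y
        have "1 < norm (x - y)" if "y \<notin> cball 0 (real m)"
          using that m norm_triangle_sub[of y x] by (auto simp: norm_minus_commute)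
        then show "indicator (?S \<epsilon>) y *\<^sub>R (K (x - y) * f y - K (x - y) * g m y) =
            indicator (?S 1) y *\<^sub>R (K (x - y) * f y - K (x - y) * g m y)"
          using e by (cases "y \<in> cball 0 (real m)") (auto simp: g_def indicator_def)
      qed
      moreover have "(LINT y:?S \<epsilon>|lebesgue. K (x - y) * f y - K (x - y) * g m y)
         = (LINT y:?S \<epsilon>|lebesgue. K (x - y) * f y) - (LINT y:?S \<epsilon>|lebesgue. K (x - y) * g m y)"
        using far[OF e(1)] gint[OF e(1)] by (rule set_integral_diff)
      ultimately show ?thesis by (simp add: algebra_simps)
    qed
    have "((\<lambda>\<epsilon>. (LINT y:?S \<epsilon>|lebesgue. K (x - y) * g m y) + c) \<longlongrightarrow> l + c) (at_right 0)"
      using l by (intro tendsto_intros) (auto simp: has_pv_def)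
    moreover have "eventually (\<lambda>\<epsilon>. (LINT y:?S \<epsilon>|lebesgue. K (x - y) * g m y) + c = (LINT y:?S \<epsilon>|lebesgue. K (x - y) * f y)) (at_right (0::real))"
      using eventually_at_right_real[OF zero_less_one] by eventually_elim (simp only: split greaterThanLessThan_iff)
    ultimately have "((\<lambda>\<epsilon>. LINT y:?S \<epsilon>|lebesgue. K (x - y) * f y) \<longlongrightarrow> l + c) (at_right 0)"
      by (rule Lim_transform_eventually)
    then show ?case using far unfolding has_pv_def by blast
  qed
qed

section \<open>The commutator\<close>

lemma far_set_subset_compl_ccube:
  fixes x :: "real^'n"
  assumes "0 < \<epsilon>" shows "{y. \<epsilon> < norm (x - y)} \<subseteq> - ccube x (\<epsilon> / real CARD('n))"
proof (safe)
  fix y assume y: "\<epsilon> < norm (x - y)" "y \<in> ccube x (\<epsilon> / real CARD('n))"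
  have "norm (x - y) \<le> (\<Sum>i\<in>UNIV. \<bar>(x - y) $ i\<bar>)" by (rule norm_le_l1_cart)
  also have "\<dots> \<le> (\<Sum>i\<in>(UNIV::'n set). \<epsilon> / real CARD('n))"
    using y(2) by (intro sum_mono) (auto simp: ccube_def abs_minus_commute)
  also have "\<dots> = \<epsilon>" by simp
  finally show False using y(1) by simp
qed

context morrey_exponents
begin

text \<open>The passage from a Lebesgue measurable \<open>f\<close> and Bochner integrals to a Borel function and nonnegative
integrals, for which Tonelli's theorem is available.\<close>
lemma exists_morrey_bound:
  assumes f: "f \<in> morrey p \<kappa> (\<lambda>x. w x powr p) (\<lambda>x. w x powr s)"
    and w: "AE x in lebesgue. w x powr s = v x"
    and mass: "\<And>x r. V x r = (LINT z:ccube x r|lebesgue. w z powr s)"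
    and N: "morrey_norm p \<kappa> (\<lambda>x. w x powr p) (\<lambda>x. w x powr s) f = ennreal N" "0 \<le> N"
  obtains f0 where "AE x in lebesgue. norm (f x) = f0 x" "morrey_bound f0 (N powr p)"
proof -
  have fm: "f \<in> borel_measurable lebesgue"
    and loc: "locally_integrable (\<lambda>x. norm (f x) powr p * w x powr p)"
    using f by (auto simp: morrey_def Lp_loc_def)
  have "(\<lambda>x. norm (f x)) \<in> borel_measurable lebesgue" using fm by measurable
  from completion_ex_borel_measurable_real[OF this]
  obtain f1 where f1: "f1 \<in> borel_measurable lborel" "AE x in lborel. norm (f x) = f1 x" by (elim bexE)
  have [measurable]: "f1 \<in> borel_measurable borel" using f1(1) by simp
  define f0 where "f0 x = \<bar>f1 x\<bar>" for x
  have f0m: "f0 \<in> borel_measurable borel" unfolding f0_def[abs_def] by measurable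
  have f0: "AE x in lebesgue. norm (f x) = f0 x"
    unfolding AE_lebesgue_iff using f1(2)
  proof eventually_elim
    case (elim x)
    then show ?case using norm_ge_zero[of "f x"] by (simp add: f0_def)
  qed
  have "(\<integral>\<^sup>+y. ennreal (morrey_density f0 y) * indicator (ccube x \<rho>) y \<partial>lborel) \<le> ennreal (N powr p * V x \<rho> powr \<kappa>)"
    if \<rho>: "0 < \<rho>" for x \<rho>
  proof -
    define J where "J = (LINT z:ccube x \<rho>|lebesgue. norm (f z) powr p * w z powr p)"
    have J0: "0 \<le> J" unfolding J_def set_lebesgue_integral_def by (intro integral_nonneg_AE) auto
    have "(\<integral>\<^sup>+y. ennreal (morrey_density f0 y) * indicator (ccube x \<rho>) y \<partial>lborel)
       = (\<integral>\<^sup>+y. ennreal (indicator (ccube x \<rho>) y *\<^sub>R (norm (f y) powr p * w y powr p)) \<partial>lborel)"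
    proof (rule nn_integral_cong_AE)
      show "AE y in lborel. ennreal (morrey_density f0 y) * indicator (ccube x \<rho>) y
         = ennreal (indicator (ccube x \<rho>) y *\<^sub>R (norm (f y) powr p * w y powr p))"
        using f0 w unfolding AE_lebesgue_iff
      proof eventually_elim
        case (elim y)
        have "v y powr (p / s) = w y powr p" using s_gt unfolding elim(2)[symmetric] powr_powr by simp
        then show ?case using elim(1) by (simp add: morrey_density_def indicator_def)
      qed
    qed
    also have "\<dots> = (\<integral>\<^sup>+y. ennreal (indicator (ccube x \<rho>) y *\<^sub>R (norm (f y) powr p * w y powr p)) \<partial>lebesgue)"
      by (rule nn_integral_lebesgue[symmetric])
    also have "\<dots> = ennreal J"
      unfolding J_def set_lebesgue_integral_def
      using loc compact_ccube[of x \<rho>] unfolding locally_integrable_def set_integrable_def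
      by (intro nn_integral_eq_integral) auto
    also have "\<dots> \<le> ennreal (N powr p * V x \<rho> powr \<kappa>)"
    proof (rule ennreal_leI)
      define R where "R = 1 / V x \<rho> powr \<kappa> * J"
      have R0: "0 \<le> R" using J0 by (simp add: R_def)
      have "ennreal (R powr (1 / p)) \<le> ennreal N"
        unfolding N(1)[symmetric] morrey_norm_def R_def mass J_def
        by (rule SUP_upper[OF ccube_in_cubes[OF \<rho>]])
      then have "R powr (1 / p) \<le> N" using N(2) by simp
      then have "(R powr (1 / p)) powr p \<le> N powr p" using p by (intro powr_mono2) auto
      then have "R \<le> N powr p" using p R0 by (simp add: powr_powr)
      then show "J \<le> N powr p * V x \<rho> powr \<kappa>"
        using mass_pos[OF \<rho>, of x] by (simp add: R_def field_simps)
    qed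
    finally show ?thesis .
  qed
  then have "morrey_bound f0 (N powr p)"
    unfolding morrey_bound_def using f0m by (auto simp: f0_def)
  then show thesis using that f0 by blast
qed

definition riesz :: "(real^'n \<Rightarrow> real) \<Rightarrow> real^'n \<Rightarrow> ennreal" where
  "riesz f x = (\<integral>\<^sup>+y. ennreal (norm (x - y) powr (\<beta> - real CARD('n)) * f y) \<partial>lborel)"

lemma riesz_far_finite:
  assumes "morrey_bound f M" "0 < r"
  shows "(\<integral>\<^sup>+y. ennreal (norm (x - y) powr (\<beta> - real CARD('n)) * f y) * indicator (- ccube x r) y \<partial>lborel) < \<infinity>"
proof -
  obtain C where C: "0 \<le> C" "\<And>f M x r. morrey_bound f M \<Longrightarrow> 0 < r \<Longrightarrow>
     (\<integral>\<^sup>+y. ennreal (norm (x - y) powr (\<beta> - real CARD('n)) * f y) * indicator (- ccube x r) y \<partial>lborel)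
       \<le> ennreal (C * M powr (1 / p) * V x r powr (\<kappa> / p - 1 / s))"
    by (rule riesz_far) blast
  show ?thesis by (rule le_less_trans[OF C(2)[OF assms]]) simp
qed

lemma \<beta>_less_n: "\<beta> < real CARD('n)"
  using \<alpha>(3) n_pos by (simp add: \<alpha>_def)

text \<open>Seen from a point \<open>x\<close> far from the ball, the ball is part of the far region, where
\<open>|x - y| powr (\<beta> - n) |f(y)|\<close> is integrable; on the ball the kernel is bounded from below.\<close>
lemma locally_integrable_of_morrey:
  assumes f: "f \<in> borel_measurable lebesgue" and f0: "AE x in lebesgue. norm (f x) = f0 x"
    and M: "morrey_bound f0 M" and R: "0 < R"
  shows "set_integrable lebesgue (cball 0 R) (f :: real^'n \<Rightarrow> complex)"
proof -
  \<comment> \<open>Each coordinate of \<open>x\<close> differs by more than \<open>R\<close> from that of every point of the ball.\<close>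
  define x :: "real^'n" where "x = (\<chi> i. 2 * R + 1)"
  define B where "B = norm x + R"
  have B: "0 < B" using R by (simp add: B_def add_nonneg_pos)
  have [measurable]: "f0 \<in> borel_measurable borel" using M by (simp add: morrey_bound_def)
  have pt: "f0 y * indicator (cball 0 R) y \<le> B powr (real CARD('n) - \<beta>) *
       (norm (x - y) powr (\<beta> - real CARD('n)) * f0 y * indicator (- ccube x R) y)" for y
  proof (cases "y \<in> cball 0 R")
    case True
    have "\<bar>y $ undefined\<bar> \<le> R" using True component_le_norm_cart[of y undefined] by simp
    then have "\<not> \<bar>y $ undefined - x $ undefined\<bar> \<le> R" using R by (simp add: x_def abs_if split: if_splits)
    then have far: "y \<notin> ccube x R" by (auto simp: ccube_def)
    have le: "norm (x - y) \<le> B" using True norm_triangle_ineq4[of x y] by (simp add: B_def)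
    have pos: "0 < norm (x - y)" using norm_gt_of_not_in_ccube[OF far] R by linarith
    have "B powr (\<beta> - real CARD('n)) \<le> norm (x - y) powr (\<beta> - real CARD('n))"
      using le pos \<beta>_less_n by (intro powr_mono2') auto
    then have "B powr (real CARD('n) - \<beta>) * B powr (\<beta> - real CARD('n)) \<le> B powr (real CARD('n) - \<beta>) * norm (x - y) powr (\<beta> - real CARD('n))"
      by (rule mult_left_mono) simp
    then have "1 \<le> B powr (real CARD('n) - \<beta>) * norm (x - y) powr (\<beta> - real CARD('n))"
      using B by (simp add: powr_add[symmetric])
    then have "1 * f0 y \<le> B powr (real CARD('n) - \<beta>) * norm (x - y) powr (\<beta> - real CARD('n)) * f0 y"
      using M by (intro mult_right_mono) (auto simp: morrey_bound_def)
    then show ?thesis using True far by (simp add: mult.assoc)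
  next
    case False
    then show ?thesis using M by (auto simp: morrey_bound_def)
  qed
  have "(\<integral>\<^sup>+y. ennreal (norm (indicator (cball 0 R) y *\<^sub>R f y)) \<partial>lebesgue) = (\<integral>\<^sup>+y. ennreal (norm (indicator (cball 0 R) y *\<^sub>R f y)) \<partial>lborel)"
    by (rule nn_integral_lebesgue)
  also have "\<dots> = (\<integral>\<^sup>+y. ennreal (f0 y * indicator (cball 0 R) y) \<partial>lborel)"
    using f0 unfolding AE_lebesgue_iff by (intro nn_integral_cong_AE) (auto elim!: eventually_mono simp: indicator_def)
  also have "\<dots> \<le> (\<integral>\<^sup>+y. ennreal (B powr (real CARD('n) - \<beta>)) * (ennreal (norm (x - y) powr (\<beta> - real CARD('n)) * f0 y) * indicator (- ccube x R) y) \<partial>lborel)"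
  proof (rule nn_integral_mono)
    fix y
    have "ennreal (f0 y * indicator (cball 0 R) y) \<le> ennreal (B powr (real CARD('n) - \<beta>) *
       (norm (x - y) powr (\<beta> - real CARD('n)) * f0 y * indicator (- ccube x R) y))"
      by (rule ennreal_leI[OF pt])
    also have "\<dots> = ennreal (B powr (real CARD('n) - \<beta>)) * (ennreal (norm (x - y) powr (\<beta> - real CARD('n)) * f0 y) * indicator (- ccube x R) y)"
      by (auto simp: indicator_def ennreal_mult')
    finally show "ennreal (f0 y * indicator (cball 0 R) y) \<le> \<dots>" .
  qed
  also have "\<dots> = ennreal (B powr (real CARD('n) - \<beta>)) * (\<integral>\<^sup>+y. ennreal (norm (x - y) powr (\<beta> - real CARD('n)) * f0 y) * indicator (- ccube x R) y \<partial>lborel)"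
    by (intro nn_integral_cmult) measurable
  also have "\<dots> < \<infinity>"
    using riesz_far_finite[OF M R, of x] by (simp add: ennreal_mult_less_top)
  finally have fin: "(\<integral>\<^sup>+y. ennreal (norm (indicator (cball 0 R) y *\<^sub>R f y)) \<partial>lebesgue) < \<infinity>" .
  have "(\<lambda>y. indicator (cball 0 R) y *\<^sub>R f y) \<in> borel_measurable lebesgue"
    using f by (intro borel_measurable_scaleR borel_measurable_indicator) auto
  then show ?thesis unfolding set_integrable_def using fin by (rule integrableI_bounded)
qed

text \<open>Used with \<open>\<phi>(y) = b(x) - b(y)\<close>, where \<open>B\<close> is the Hoelder constant, and with \<open>\<phi> = 1\<close>, where the bound
holds with \<open>B = \<epsilon> powr -\<beta>\<close> since only \<open>|x - y| > \<epsilon>\<close> is considered.\<close>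
lemma truncated_kernel:
  fixes Ker f \<phi> :: "real^'n \<Rightarrow> complex"
  assumes Ker [measurable]: "Ker \<in> borel_measurable borel" and Cb: "0 \<le> C1" "\<forall>x. x \<noteq> 0 \<longrightarrow> norm (Ker x) \<le> C1 / norm x ^ CARD('n)"
    and f: "f \<in> borel_measurable lebesgue" and f0: "AE x in lebesgue. norm (f x) = f0 x"
    and M: "morrey_bound f0 M" and \<epsilon>: "0 < \<epsilon>"
    and \<phi>: "\<phi> \<in> borel_measurable lebesgue" "0 \<le> B" "AE y in lebesgue. \<epsilon> < norm (x - y) \<longrightarrow> norm (\<phi> y) \<le> B * norm (x - y) powr \<beta>"
  shows "set_integrable lebesgue {y. \<epsilon> < norm (x - y)} (\<lambda>y. Ker (x - y) * (\<phi> y * f y))" (is "set_integrable _ ?S _")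
    and "ennreal (norm (LINT y:{y. \<epsilon> < norm (x - y)}|lebesgue. Ker (x - y) * (\<phi> y * f y))) \<le> ennreal (C1 * B) * riesz f0 x"
proof -
  let ?h = "\<lambda>y. indicator ?S y *\<^sub>R (Ker (x - y) * (\<phi> y * f y))"
  have [measurable]: "f0 \<in> borel_measurable borel" using M by (simp add: morrey_bound_def)
  have "(\<lambda>y. Ker (x - y)) \<in> borel_measurable lborel" by measurable
  then have "(\<lambda>y. Ker (x - y)) \<in> borel_measurable lebesgue" by (rule measurable_completion)
  then have h: "?h \<in> borel_measurable lebesgue"
    using f \<phi>(1) far_set_measurable[of \<epsilon> x]
    by (intro borel_measurable_scaleR borel_measurable_indicator borel_measurable_times) (auto simp: sets_completionI_sets)
  let ?G = "\<lambda>y. ennreal (norm (x - y) powr (\<beta> - real CARD('n)) * f0 y)"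
  have "AE y in lborel. ennreal (norm (?h y)) \<le> ennreal (C1 * B) * (?G y * indicator ?S y)"
    using f0 \<phi>(3) unfolding AE_lebesgue_iff
  proof eventually_elim
    case (elim y)
    show ?case
    proof (cases "y \<in> ?S")
      case True
      then have y: "\<epsilon> < norm (x - y)" by simp
      then have ne: "x - y \<noteq> 0" using \<epsilon> by auto
      have "norm (Ker (x - y)) * (norm (\<phi> y) * norm (f y)) \<le> C1 / norm (x - y) ^ CARD('n) * ((B * norm (x - y) powr \<beta>) * f0 y)"
        using Cb(2)[rule_format, OF ne] elim y Cb(1) \<phi>(2) M by (intro mult_mono mult_nonneg_nonneg) (auto simp: morrey_bound_def)
      also have "\<dots> = C1 * B * (norm (x - y) powr (\<beta> - real CARD('n)) * f0 y)"
        using ne by (simp add: powr_diff powr_realpow)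
      finally show ?thesis using True Cb(1) \<phi>(2)
        by (simp add: norm_mult ennreal_mult'[symmetric] ennreal_leI)
    qed simp
  qed
  then have "(\<integral>\<^sup>+y. ennreal (norm (?h y)) \<partial>lborel) \<le> (\<integral>\<^sup>+y. ennreal (C1 * B) * (?G y * indicator ?S y) \<partial>lborel)"
    by (rule nn_integral_mono_AE)
  also have "\<dots> = ennreal (C1 * B) * (\<integral>\<^sup>+y. ?G y * indicator ?S y \<partial>lborel)"
    by (intro nn_integral_cmult) measurable
  finally have le: "(\<integral>\<^sup>+y. ennreal (norm (?h y)) \<partial>lebesgue) \<le> ennreal (C1 * B) * (\<integral>\<^sup>+y. ?G y * indicator ?S y \<partial>lborel)"
    unfolding nn_integral_lebesgue .
  have "(\<integral>\<^sup>+y. ?G y * indicator ?S y \<partial>lborel) \<le> (\<integral>\<^sup>+y. ?G y * indicator (- ccube x (\<epsilon> / real CARD('n))) y \<partial>lborel)"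
    using far_set_subset_compl_ccube[OF \<epsilon>, of x] by (intro nn_integral_mono) (auto simp: indicator_def)
  also have "\<dots> < \<infinity>" using \<epsilon> by (intro riesz_far_finite[OF M]) simp
  finally have "(\<integral>\<^sup>+y. ennreal (norm (?h y)) \<partial>lebesgue) < \<infinity>"
    using le by (simp add: ennreal_mult_less_top le_less_trans)
  with h have int: "integrable lebesgue ?h" by (rule integrableI_bounded)
  then show "set_integrable lebesgue ?S (\<lambda>y. Ker (x - y) * (\<phi> y * f y))" by (simp add: set_integrable_def)
  have "ennreal (norm (LINT y:?S|lebesgue. Ker (x - y) * (\<phi> y * f y))) \<le> (\<integral>\<^sup>+y. ennreal (norm (?h y)) \<partial>lebesgue)"
    unfolding set_lebesgue_integral_def by (rule integral_norm_bound_ennreal[OF int])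
  also note le
  also have "ennreal (C1 * B) * (\<integral>\<^sup>+y. ?G y * indicator ?S y \<partial>lborel) \<le> ennreal (C1 * B) * riesz f0 x"
    unfolding riesz_def by (intro mult_left_mono nn_integral_mono) (auto simp: indicator_def)
  finally show "ennreal (norm (LINT y:?S|lebesgue. Ker (x - y) * (\<phi> y * f y))) \<le> ennreal (C1 * B) * riesz f0 x" .
qed

text \<open>The principal values of \<open>f\<close> and \<open>b f\<close> exist almost everywhere, and the truncations of
\<open>b(x) T f(x) - T (b f)(x)\<close> combine to one integral with the factor \<open>b(x) - b(y)\<close>. Measurability
passes from the truncations to their limit.\<close>
lemma commutator_pointwise:
  fixes Ker b b' f :: "real^'n \<Rightarrow> complex" and T :: "(real^'n \<Rightarrow> complex) \<Rightarrow> real^'n \<Rightarrow> complex"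
  assumes Ker: "Ker \<in> borel_measurable borel" and Cb: "0 \<le> C1" "\<forall>x. x \<noteq> 0 \<longrightarrow> norm (Ker x) \<le> C1 / norm x ^ CARD('n)"
    and ex: "\<forall>f. integrable lebesgue f \<longrightarrow> (AE x in lebesgue. \<exists>l. has_pv Ker f x l)"
    and T: "\<And>f. AE x in lebesgue. \<forall>l. has_pv Ker f x l \<longrightarrow> T f x = l"
    and b': "b' \<in> borel_measurable borel" "0 \<le> H" "\<And>x y. norm (b' x - b' y) \<le> H * norm (x - y) powr \<beta>"
    and b: "AE x in lebesgue. b x = b' x"
    and f: "f \<in> borel_measurable lebesgue" and f0: "AE x in lebesgue. norm (f x) = f0 x"
    and M: "morrey_bound f0 M"
  shows "commutator b T f \<in> borel_measurable lebesgue"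
    and "AE x in lebesgue. ennreal (norm (commutator b T f x)) \<le> ennreal (C1 * H) * riesz f0 x"
proof -
  let ?S = "\<lambda>\<epsilon> x. {y. \<epsilon> < norm (x - y)}"
  have b'm: "b' \<in> borel_measurable lebesgue" using b'(1) by (intro measurable_completion) simp
  have bm: "b \<in> borel_measurable lebesgue" using b by (rule lebesgue_measurable_cong_AE[OF b'm])
  have bfm: "(\<lambda>y. b y * f y) \<in> borel_measurable lebesgue" using bm f by (rule borel_measurable_times)
  note kernel = truncated_kernel[OF Ker Cb f f0 M]
  have diffm: "(\<lambda>y. b' x - b y) \<in> borel_measurable lebesgue" for x
    using bm by (intro borel_measurable_diff) auto
  have int_f: "set_integrable lebesgue (?S \<epsilon> x) (\<lambda>y. Ker (x - y) * f y)" if "0 < \<epsilon>" for \<epsilon> x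
  proof -
    have "set_integrable lebesgue (?S \<epsilon> x) (\<lambda>y. Ker (x - y) * (1 * f y))"
    proof (rule kernel(1)[OF that])
      show "AE y in lebesgue. \<epsilon> < norm (x - y) \<longrightarrow> norm (1::complex) \<le> (1 / \<epsilon>) powr \<beta> * norm (x - y) powr \<beta>"
      proof (intro AE_I2 impI)
        fix y assume "\<epsilon> < norm (x - y)"
        then have "1 \<le> (1 / \<epsilon> * norm (x - y)) powr \<beta>"
          using that \<beta> by (intro ge_one_powr_ge_zero) (auto simp: field_simps)
        then show "norm (1::complex) \<le> (1 / \<epsilon>) powr \<beta> * norm (x - y) powr \<beta>" by (simp add: powr_mult[symmetric])
      qed
    qed auto
    then show ?thesis by simp
  qed
  have osc: "AE y in lebesgue. \<epsilon> < norm (x - y) \<longrightarrow> norm (b' x - b y) \<le> H * norm (x - y) powr \<beta>" for \<epsilon> x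
    using b by eventually_elim (simp add: b'(3))
  note int_diff = kernel(1)[OF _ diffm b'(2) osc] and bound_diff = kernel(2)[OF _ diffm b'(2) osc]
  have int_bf: "set_integrable lebesgue (?S \<epsilon> x) (\<lambda>y. Ker (x - y) * (b y * f y))" if "0 < \<epsilon>" for \<epsilon> x
  proof -
    have "set_integrable lebesgue (?S \<epsilon> x) (\<lambda>y. b' x * (Ker (x - y) * f y) - Ker (x - y) * ((b' x - b y) * f y))"
      using int_f[OF that] int_diff[OF that] by (intro set_integral_diff set_integrable_mult_right) auto
    also have "(\<lambda>y. b' x * (Ker (x - y) * f y) - Ker (x - y) * ((b' x - b y) * f y)) = (\<lambda>y. Ker (x - y) * (b y * f y))"
      by (simp add: fun_eq_iff algebra_simps)
    finally show ?thesis .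
  qed
  have u: "b' x * (LINT y:?S \<epsilon> x|lebesgue. Ker (x - y) * f y) - (LINT y:?S \<epsilon> x|lebesgue. Ker (x - y) * (b y * f y))
      = (LINT y:?S \<epsilon> x|lebesgue. Ker (x - y) * ((b' x - b y) * f y))" if "0 < \<epsilon>" for \<epsilon> x
  proof -
    have "(LINT y:?S \<epsilon> x|lebesgue. Ker (x - y) * ((b' x - b y) * f y))
       = (LINT y:?S \<epsilon> x|lebesgue. b' x * (Ker (x - y) * f y) - Ker (x - y) * (b y * f y))"
      by (simp add: algebra_simps)
    also have "\<dots> = (LINT y:?S \<epsilon> x|lebesgue. b' x * (Ker (x - y) * f y)) - (LINT y:?S \<epsilon> x|lebesgue. Ker (x - y) * (b y * f y))"
      using int_f[OF that] int_bf[OF that] by (intro set_integral_diff set_integrable_mult_right) auto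
    finally show ?thesis by simp
  qed
  have loc_f: "set_integrable lebesgue (cball 0 (real m)) f" for m :: nat
    by (rule set_integrable_subset[OF locally_integrable_of_morrey[OF f f0 M, of "real m + 1"]]) auto
  have loc_bf: "set_integrable lebesgue (cball 0 (real m)) (\<lambda>y. b y * f y)" for m :: nat
  proof -
    define B where "B = norm (b' 0) + H * real m powr \<beta>"
    have B: "0 \<le> B" using b'(2) by (simp add: B_def)
    have "set_integrable lebesgue (cball 0 (real m)) (\<lambda>y. B *\<^sub>R f y)"
      using loc_f by (intro set_integrable_scaleR_right) auto
    then show ?thesis
    proof (rule set_integrable_bound)
      show "set_borel_measurable lebesgue (cball 0 (real m)) (\<lambda>y. b y * f y)"
        unfolding set_borel_measurable_def using bfm by (intro borel_measurable_scaleR borel_measurable_indicator) auto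
      show "AE y in lebesgue. y \<in> cball 0 (real m) \<longrightarrow> norm (b y * f y) \<le> norm (B *\<^sub>R f y)"
        using b
      proof eventually_elim
        case (elim y)
        show ?case
        proof
          assume y: "y \<in> cball 0 (real m)"
          have "norm (b' y) \<le> norm (b' 0) + norm (b' y - b' 0)" by (rule norm_triangle_sub)
          also have "\<dots> \<le> norm (b' 0) + H * norm (y - 0) powr \<beta>" using b'(3)[of y 0] by simp
          also have "\<dots> \<le> B" unfolding B_def using y b'(2) \<beta> by (intro add_left_mono mult_left_mono powr_mono2) auto
          finally show "norm (b y * f y) \<le> norm (B *\<^sub>R f y)" using elim B by (simp add: norm_mult mult_right_mono)
        qed
      qed
    qed
  qed
  have pv_f: "AE x in lebesgue. \<exists>l. has_pv Ker f x l" by (rule has_pv_exists_AE[OF ex[rule_format] loc_f int_f])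
  have pv_bf: "AE x in lebesgue. \<exists>l. has_pv Ker (\<lambda>y. b y * f y) x l" by (rule has_pv_exists_AE[OF ex[rule_format] loc_bf int_bf])
  define U where "U \<epsilon> x = b' x * (LINT y:?S \<epsilon> x|lebesgue. Ker (x - y) * f y) - (LINT y:?S \<epsilon> x|lebesgue. Ker (x - y) * (b y * f y))" for \<epsilon> x
  have lim: "AE x in lebesgue. ((\<lambda>\<epsilon>. U \<epsilon> x) \<longlongrightarrow> commutator b T f x) (at_right 0)"
    using pv_f pv_bf T[of f] T[of "\<lambda>y. b y * f y"] b
  proof eventually_elim
    case (elim x)
    obtain l1 where l1: "has_pv Ker f x l1" using elim(1) by blast
    obtain l2 where l2: "has_pv Ker (\<lambda>y. b y * f y) x l2" using elim(2) by blast
    have "commutator b T f x = b' x * l1 - l2"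
      using elim(3-5) l1 l2 by (simp add: commutator_def)
    then show ?case unfolding U_def using l1 l2 by (auto simp: has_pv_def intro!: tendsto_intros)
  qed
  show "AE x in lebesgue. ennreal (norm (commutator b T f x)) \<le> ennreal (C1 * H) * riesz f0 x"
    using lim
  proof eventually_elim
    case (elim x)
    show ?case
    proof (rule tendsto_upperbound)
      show "((\<lambda>\<epsilon>. ennreal (norm (U \<epsilon> x))) \<longlongrightarrow> ennreal (norm (commutator b T f x))) (at_right 0)"
        by (intro tendsto_ennrealI tendsto_norm elim)
      have "eventually (\<lambda>\<epsilon>::real. \<epsilon> \<in> {0<..<1}) (at_right 0)" by (rule eventually_at_right_real) simp
      then show "eventually (\<lambda>\<epsilon>. ennreal (norm (U \<epsilon> x)) \<le> ennreal (C1 * H) * riesz f0 x) (at_right 0)"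
        by eventually_elim (simp add: U_def u bound_diff)
    qed simp
  qed
  have Um: "U \<epsilon> \<in> borel_measurable borel" for \<epsilon>
    unfolding U_def
    by (intro borel_measurable_diff borel_measurable_times b'(1) truncated_integral_measurable Ker f bfm)
  have "(\<lambda>x. lim (\<lambda>k. U (inverse (real (Suc k))) x)) \<in> borel_measurable borel"
    using Um by (intro borel_measurable_lim_metric)
  then have limm: "(\<lambda>x. lim (\<lambda>k. U (inverse (real (Suc k))) x)) \<in> borel_measurable lebesgue"
    by (intro measurable_completion) simp
  show "commutator b T f \<in> borel_measurable lebesgue"
  proof (rule lebesgue_measurable_cong_AE[OF limm])
    show "AE x in lebesgue. commutator b T f x = lim (\<lambda>k. U (inverse (real (Suc k))) x)"
      using lim
    proof eventually_elim
      case (elim x)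
      have "filterlim (\<lambda>k. inverse (real (Suc k))) (at_right 0) sequentially"
        by (rule tendsto_imp_filterlim_at_right[OF LIMSEQ_inverse_real_of_nat]) simp
      then have "(\<lambda>k. U (inverse (real (Suc k))) x) \<longlonglongrightarrow> commutator b T f x"
        by (rule filterlim_compose[OF elim])
      then show ?case by (rule limI[symmetric])
    qed
  qed
qed

text \<open>The passage back to Bochner integrals. A compact set lies in a cube, so finiteness on cubes also gives
local integrability.\<close>
lemma integral_over_cubes_imp_morrey:
  fixes g :: "real^'n \<Rightarrow> complex"
  assumes g: "g \<in> borel_measurable lebesgue" and wm: "w \<in> borel_measurable lebesgue"
    and w: "AE x in lebesgue. w x powr s = v x"
    and mass: "\<And>x r. V x r = (LINT z:ccube x r|lebesgue. w z powr s)"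
    and bound: "\<And>x r. 0 < r \<Longrightarrow> (\<integral>\<^sup>+y. ennreal (norm (g y) powr s * v y) * indicator (ccube x r) y \<partial>lborel)
        \<le> ennreal (R powr s * V x r powr (\<kappa> * s / p))"
    and R: "0 \<le> R"
  shows "g \<in> morrey s (\<kappa> * s / p) (\<lambda>x. w x powr s) (\<lambda>x. w x powr s)"
    and "morrey_norm s (\<kappa> * s / p) (\<lambda>x. w x powr s) (\<lambda>x. w x powr s) g \<le> ennreal R"
proof -
  let ?h = "\<lambda>y. norm (g y) powr s * w y powr s"
  have hm: "?h \<in> borel_measurable lebesgue" using g wm by measurable
  have nn: "(\<integral>\<^sup>+y. ennreal (indicator (ccube x r) y *\<^sub>R ?h y) \<partial>lebesgue) \<le> ennreal (R powr s * V x r powr (\<kappa> * s / p))"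
    if "0 < r" for x r
  proof -
    have "(\<integral>\<^sup>+y. ennreal (indicator (ccube x r) y *\<^sub>R ?h y) \<partial>lebesgue)
        = (\<integral>\<^sup>+y. ennreal (norm (g y) powr s * v y) * indicator (ccube x r) y \<partial>lborel)"
      unfolding nn_integral_lebesgue using w unfolding AE_lebesgue_iff
      by (intro nn_integral_cong_AE) (auto elim!: eventually_mono simp: indicator_def)
    then show ?thesis using bound[OF that, of x] by simp
  qed
  have int: "set_integrable lebesgue (ccube x r) ?h" if "0 < r" for x r
    unfolding set_integrable_def
  proof (rule integrableI_bounded)
    have "ccube x r \<in> sets lebesgue" by simp
    then show "(\<lambda>y. indicator (ccube x r) y *\<^sub>R ?h y) \<in> borel_measurable lebesgue"
      using hm by (intro borel_measurable_scaleR borel_measurable_indicator)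
    show "(\<integral>\<^sup>+y. ennreal (norm (indicator (ccube x r) y *\<^sub>R ?h y)) \<partial>lebesgue) < \<infinity>"
      using le_less_trans[OF nn[OF that, of x]] by simp
  qed
  have loc: "locally_integrable ?h"
    unfolding locally_integrable_def
  proof (intro allI impI)
    fix S :: "(real^'n) set" assume S: "compact S"
    obtain B where B: "0 < B" "\<forall>y\<in>S. norm y \<le> B" using compact_imp_bounded[OF S] by (auto simp: bounded_pos)
    have "S \<subseteq> ccube 0 B" using B by (auto intro!: in_ccube_norm)
    moreover have "S \<in> sets lebesgue" using compact_imp_closed[OF S] by (intro sets_completionI_sets) auto
    ultimately show "set_integrable lebesgue S ?h" using int[OF B(1), of 0] by (rule_tac set_integrable_subset)
  qed
  show norm: "morrey_norm s (\<kappa> * s / p) (\<lambda>x. w x powr s) (\<lambda>x. w x powr s) g \<le> ennreal R"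
    unfolding morrey_norm_def
  proof (rule SUP_least)
    fix Q :: "(real^'n) set" assume "Q \<in> cubes"
    then obtain x r where r: "0 < r" and Q: "Q = ccube x r" by (rule cubesE)
    define J where "J = (LINT y:Q|lebesgue. ?h y)"
    have J0: "0 \<le> J" unfolding J_def set_lebesgue_integral_def by (intro integral_nonneg_AE) auto
    have "ennreal J = (\<integral>\<^sup>+y. ennreal (indicator (ccube x r) y *\<^sub>R ?h y) \<partial>lebesgue)"
      unfolding J_def Q set_lebesgue_integral_def using int[OF r, of x]
      by (intro nn_integral_eq_integral[symmetric]) (auto simp: set_integrable_def)
    then have "ennreal J \<le> ennreal (R powr s * V x r powr (\<kappa> * s / p))" using nn[OF r, of x] by simp
    then have "J \<le> R powr s * V x r powr (\<kappa> * s / p)" by (simp add: ennreal_le_iff)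
    then have "1 / V x r powr (\<kappa> * s / p) * J \<le> R powr s"
      using mass_pos[OF r, of x] by (simp add: field_simps)
    then have "(1 / V x r powr (\<kappa> * s / p) * J) powr (1 / s) \<le> (R powr s) powr (1 / s)"
      using J0 s_gt by (intro powr_mono2) auto
    also have "\<dots> = R" using R s_gt by (simp add: powr_powr)
    finally have "(1 / V x r powr (\<kappa> * s / p) * J) powr (1 / s) \<le> R" .
    from ennreal_leI[OF this] show "ennreal ((1 / (LINT x:Q|lebesgue. w x powr s) powr (\<kappa> * s / p) * (LINT x:Q|lebesgue. norm (g x) powr s * w x powr s)) powr (1 / s)) \<le> ennreal R"
      unfolding J_def Q mass .
  qed
  show "g \<in> morrey s (\<kappa> * s / p) (\<lambda>x. w x powr s) (\<lambda>x. w x powr s)"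
    using g loc le_less_trans[OF norm] by (simp add: morrey_def Lp_loc_def)
qed

text \<open>The bound for fractional integrals, stated for a Lebesgue measurable function dominated by one, and
with the constant in front of the norm.\<close>
lemma riesz_dominated_bound:
  obtains C where "0 \<le> C" "\<And>f0 N a (g :: real^'n \<Rightarrow> complex) x r. morrey_bound f0 (N powr p) \<Longrightarrow> 0 \<le> N \<Longrightarrow> 0 < a \<Longrightarrow> 0 < r \<Longrightarrow>
     g \<in> borel_measurable lebesgue \<Longrightarrow>
     AE x in lebesgue. ennreal (norm (g x)) \<le> ennreal a * riesz f0 x \<Longrightarrow>
     (\<integral>\<^sup>+y. ennreal (norm (g y) powr s * v y) * indicator (ccube x r) y \<partial>lborel)
       \<le> ennreal ((a * C * N) powr s * V x r powr (\<kappa> * s / p))"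
proof -
  obtain C where C: "0 \<le> C" "\<And>f M x0 r c. morrey_bound f M \<Longrightarrow> 0 < r \<Longrightarrow>
     c \<in> borel_measurable borel \<Longrightarrow> (\<And>x. 0 \<le> c x) \<Longrightarrow>
     AE x in lborel. ennreal (c x) \<le>
       (\<integral>\<^sup>+y. ennreal (norm (x - y) powr (\<beta> - real CARD('n)) * f y) \<partial>lborel) \<Longrightarrow>
     (\<integral>\<^sup>+x. ennreal (c x powr s * v x) * indicator (ccube x0 r) x \<partial>lborel)
       \<le> ennreal (C * M powr (s / p) * V x0 r powr (\<kappa> * s / p))"
    by (rule riesz_potential_bound) blast
  show thesis
  proof (rule that[of "C powr (1 / s)"])
    show "0 \<le> C powr (1 / s)" by simp
    fix f0 x and N a r :: real and g :: "real^'n \<Rightarrow> complex"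
    assume M: "morrey_bound f0 (N powr p)" and N: "0 \<le> N" and a: "0 < a" and r: "0 < r"
      and g: "g \<in> borel_measurable lebesgue"
      and dom: "AE x in lebesgue. ennreal (norm (g x)) \<le> ennreal a * riesz f0 x"
    have "(\<lambda>x. norm (g x) / a) \<in> borel_measurable lebesgue" using g by measurable
    from completion_ex_borel_measurable_real[OF this]
    obtain c1 where c1: "c1 \<in> borel_measurable lborel" "AE x in lborel. norm (g x) / a = c1 x" by (elim bexE)
    have [measurable]: "c1 \<in> borel_measurable borel" using c1(1) by simp
    define c where "c x = \<bar>c1 x\<bar>" for x
    have cm [measurable]: "c \<in> borel_measurable borel" unfolding c_def[abs_def] by measurable
    have gc: "AE x in lborel. norm (g x) = a * c x"
      using c1(2)
    proof eventually_elim
      case (elim x)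
      have "0 \<le> norm (g x) / a" using a by simp
      then have "c x = norm (g x) / a" unfolding c_def elim by simp
      then show ?case using a by simp
    qed
    have "AE x in lborel. ennreal (c x) \<le> (\<integral>\<^sup>+y. ennreal (norm (x - y) powr (\<beta> - real CARD('n)) * f0 y) \<partial>lborel)"
      using gc dom unfolding AE_lebesgue_iff
    proof eventually_elim
      case (elim x)
      then have "ennreal a * ennreal (c x) \<le> ennreal a * riesz f0 x"
        using a by (simp add: ennreal_mult' )
      then show ?case using a by (simp add: ennreal_mult_le_mult_iff riesz_def)
    qed
    from C(2)[OF M r cm _ this]
    have "(\<integral>\<^sup>+y. ennreal (c y powr s * v y) * indicator (ccube x r) y \<partial>lborel)
       \<le> ennreal (C * (N powr p) powr (s / p) * V x r powr (\<kappa> * s / p))" for x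
      by (simp add: c_def)
    note le = this[of x]
    have "(\<integral>\<^sup>+y. ennreal (norm (g y) powr s * v y) * indicator (ccube x r) y \<partial>lborel)
      = (\<integral>\<^sup>+y. ennreal (a powr s) * (ennreal (c y powr s * v y) * indicator (ccube x r) y) \<partial>lborel)"
    proof (rule nn_integral_cong_AE)
      show "AE y in lborel. ennreal (norm (g y) powr s * v y) * indicator (ccube x r) y
         = ennreal (a powr s) * (ennreal (c y powr s * v y) * indicator (ccube x r) y)"
        using gc by eventually_elim (simp add: powr_mult indicator_def ennreal_mult'[symmetric] mult.assoc)
    qed
    also have "\<dots> = ennreal (a powr s) * (\<integral>\<^sup>+y. ennreal (c y powr s * v y) * indicator (ccube x r) y \<partial>lborel)"
      by (intro nn_integral_cmult) measurable
    also have "\<dots> \<le> ennreal (a powr s) * ennreal (C * (N powr p) powr (s / p) * V x r powr (\<kappa> * s / p))"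
      by (rule mult_left_mono[OF le]) simp
    also have "\<dots> = ennreal (a powr s * (C * (N powr p) powr (s / p) * V x r powr (\<kappa> * s / p)))"
      by (simp add: ennreal_mult')
    also have "a powr s * (C * (N powr p) powr (s / p) * V x r powr (\<kappa> * s / p)) = (a * C powr (1 / s) * N) powr s * V x r powr (\<kappa> * s / p)"
    proof -
      have "(N powr p) powr (s / p) = N powr s" "(C powr (1 / s)) powr s = C"
        using p s_gt C(1) by (simp_all add: powr_powr)
      then show ?thesis by (simp add: powr_mult mult.assoc)
    qed
    finally show "(\<integral>\<^sup>+y. ennreal (norm (g y) powr s * v y) * indicator (ccube x r) y \<partial>lborel)
       \<le> ennreal ((a * C powr (1 / s) * N) powr s * V x r powr (\<kappa> * s / p))" .
  qed
qed

end

theorem theorem1p2: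
  fixes \<beta> p s \<kappa> :: real
    and w :: "real^'n \<Rightarrow> real"
    and b :: "real^'n \<Rightarrow> complex"
    and T :: "(real^'n \<Rightarrow> complex) \<Rightarrow> real^'n \<Rightarrow> complex"
  assumes "0 < \<beta>" "\<beta> < 1"
    and "1 < p" "p < real CARD('n) / \<beta>"
    and "1 / s = 1 / p - \<beta> / real CARD('n)"
    and "0 < \<kappa>" "\<kappa> < min (p / s) (p * \<beta> / real CARD('n))"
    and "weight w"
    and "A1 (\<lambda>x. w x powr s)"
    and "calderon_zygmund_operator T"
    and "b \<in> Lip \<beta>"
  shows "bounded_from_to (commutator b T)
           (morrey p \<kappa> (\<lambda>x. w x powr p) (\<lambda>x. w x powr s))
           (morrey_norm p \<kappa> (\<lambda>x. w x powr p) (\<lambda>x. w x powr s))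
           (morrey s (\<kappa> * s / p) (\<lambda>x. w x powr s) (\<lambda>x. w x powr s))
           (morrey_norm s (\<kappa> * s / p) (\<lambda>x. w x powr s) (\<lambda>x. w x powr s))"
proof -
  obtain v A where v: "A1_weight v A" and wv: "AE x in lebesgue. w x powr s = v x"
    and mass: "\<And>x r. mass v x r = (LINT z:ccube x r|lebesgue. w z powr s)"
    by (rule A1_imp_A1_weight[OF assms(9)]) blast
  interpret morrey_exponents v A \<beta> p s \<kappa>
  proof (intro morrey_exponents.intro morrey_exponents_axioms.intro v)
    show "\<kappa> < p / s" using assms(7) by simp
  qed (fact assms)+
  have wm: "w \<in> borel_measurable lebesgue"
    using assms(8) by (auto simp: weight_def intro: locally_integrable_imp_measurable)
  obtain b' H where b': "0 \<le> H" "\<And>x y. norm (b' x - b' y) \<le> H * norm (x - y) powr \<beta>"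
    "b' \<in> borel_measurable borel" "AE x in lebesgue. b x = b' x"
    by (rule Lip_Holder_representative[OF assms(11) assms(1)]) blast
  obtain Ker C0 C'
    where ex: "\<forall>f. integrable lebesgue f \<longrightarrow> (AE x in lebesgue. \<exists>l. has_pv Ker f x l)"
    and T: "\<forall>f. AE x in lebesgue. \<forall>l. has_pv Ker f x l \<longrightarrow> T f x = l"
    and C0: "\<forall>x. x \<noteq> 0 \<longrightarrow> norm (Ker x) \<le> C0 / norm x ^ CARD('n)"
    and reg: "\<forall>x y. 2 * norm y \<le> norm x \<and> 0 < norm y \<longrightarrow>
            norm (Ker (x - y) - Ker x) \<le> C' * norm y / norm x ^ (CARD('n) + 1)"
    using assms(10) unfolding calderon_zygmund_operator_def by (elim exE conjE) (rule that)
  have Ker: "Ker \<in> borel_measurable borel" by (rule kernel_measurable[of Ker C']) (use reg in auto)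
  define C1 where "C1 = max C0 0"
  have C1: "0 \<le> C1" "\<forall>x. x \<noteq> 0 \<longrightarrow> norm (Ker x) \<le> C1 / norm x ^ CARD('n)"
  proof -
    show "\<forall>x. x \<noteq> 0 \<longrightarrow> norm (Ker x) \<le> C1 / norm x ^ CARD('n)"
    proof (intro allI impI)
      fix x :: "real^'n" assume "x \<noteq> 0"
      then have "norm (Ker x) \<le> C0 / norm x ^ CARD('n)" using C0 by auto
      also have "\<dots> \<le> C1 / norm x ^ CARD('n)" by (intro divide_right_mono) (auto simp: C1_def)
      finally show "norm (Ker x) \<le> C1 / norm x ^ CARD('n)" .
    qed
  qed (simp add: C1_def)
  note comm = commutator_pointwise[OF Ker C1 ex T[rule_format] b'(3) b'(1) b'(2) b'(4)]
  obtain C where C: "0 \<le> C" "\<And>f0 N a (g :: real^'n \<Rightarrow> complex) x r. morrey_bound f0 (N powr p) \<Longrightarrow> 0 \<le> N \<Longrightarrow> 0 < a \<Longrightarrow> 0 < r \<Longrightarrow>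
     g \<in> borel_measurable lebesgue \<Longrightarrow>
     AE x in lebesgue. ennreal (norm (g x)) \<le> ennreal a * riesz f0 x \<Longrightarrow>
     (\<integral>\<^sup>+y. ennreal (norm (g y) powr s * v y) * indicator (ccube x r) y \<partial>lborel)
       \<le> ennreal ((a * C * N) powr s * V x r powr (\<kappa> * s / p))"
    by (rule riesz_dominated_bound) blast
  \<comment> \<open>Adding \<open>1\<close> keeps the constant positive when \<open>C1\<close> or \<open>H\<close> vanishes.\<close>
  define a where "a = C1 * H + 1"
  have a: "0 < a" using C1(1) b'(1) by (simp add: a_def add_nonneg_pos)
  show ?thesis
    unfolding bounded_from_to_def
  proof (intro exI[of _ "a * C"] conjI ballI)
    show "0 \<le> a * C" using a C(1) by simp
    fix f assume f: "f \<in> morrey p \<kappa> (\<lambda>x. w x powr p) (\<lambda>x. w x powr s)"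
    then have fm: "f \<in> borel_measurable lebesgue" by (simp add: morrey_def Lp_loc_def)
    define N where "N = enn2real (morrey_norm p \<kappa> (\<lambda>x. w x powr p) (\<lambda>x. w x powr s) f)"
    have N: "morrey_norm p \<kappa> (\<lambda>x. w x powr p) (\<lambda>x. w x powr s) f = ennreal N" "0 \<le> N"
      using f by (auto simp: morrey_def N_def less_top)
    obtain f0 where f0: "AE x in lebesgue. norm (f x) = f0 x" and M: "morrey_bound f0 (N powr p)"
      by (rule exists_morrey_bound[OF f wv mass N])
    have cm: "commutator b T f \<in> borel_measurable lebesgue" by (rule comm(1)[OF fm f0 M])
    have "AE x in lebesgue. ennreal (norm (commutator b T f x)) \<le> ennreal (C1 * H) * riesz f0 x"
      by (rule comm(2)[OF fm f0 M])
    then have dom: "AE x in lebesgue. ennreal (norm (commutator b T f x)) \<le> ennreal a * riesz f0 x"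
    proof eventually_elim
      case (elim x)
      also have "ennreal (C1 * H) * riesz f0 x \<le> ennreal a * riesz f0 x"
        by (intro mult_right_mono ennreal_leI) (auto simp: a_def)
      finally show ?case .
    qed
    have R: "0 \<le> a * C * N" using a C(1) N(2) by simp
    have "(\<integral>\<^sup>+y. ennreal (norm (commutator b T f y) powr s * v y) * indicator (ccube x r) y \<partial>lborel)
       \<le> ennreal ((a * C * N) powr s * V x r powr (\<kappa> * s / p))" if "0 < r" for x r
      by (rule C(2)[OF M N(2) a that cm dom])
    note target = integral_over_cubes_imp_morrey[OF cm wm wv mass this R]
    show "commutator b T f \<in> morrey s (\<kappa> * s / p) (\<lambda>x. w x powr s) (\<lambda>x. w x powr s)"
      by (rule target(1))
    show "morrey_norm s (\<kappa> * s / p) (\<lambda>x. w x powr s) (\<lambda>x. w x powr s) (commutator b T f)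
       \<le> ennreal (a * C) * morrey_norm p \<kappa> (\<lambda>x. w x powr p) (\<lambda>x. w x powr s) f"
    proof -
      have "ennreal (a * C * N) = ennreal (a * C) * morrey_norm p \<kappa> (\<lambda>x. w x powr p) (\<lambda>x. w x powr s) f"
        unfolding N(1) using a C(1) N(2) by (intro ennreal_mult) auto
      moreover have "morrey_norm s (\<kappa> * s / p) (\<lambda>x. w x powr s) (\<lambda>x. w x powr s) (commutator b T f) \<le> ennreal (a * C * N)"
        by (rule target(2))
      ultimately show ?thesis by simp
    qed
  qed
qed

end
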